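(* Let $a,b\ge 2$, let $K\subset M_{a,b}$ be a linear subspace of dimension three, and put $Z_K=\mathbb P(K)\cap\Sigma_{a,b}$ (scheme-theoretic intersection). If $\dim Z_K\ge 1$, then $Z_K$ is exactly one of the following scheme types: (1) a ruling plane; (2) a smooth conic; (3) two reduced Segre lines from opposite rulings; (4) a reduced Segre line; (5) a reduced Segre line together with one reduced point off the line; (6) a Segre line with one embedded residual point contributing length one. A doubled Segre line cannot occur outside a ruling linear space, i.e. if $\mathbb P(K)\not\subset\Sigma_{a,b}$, then $Z_K$ does not contain a doubled Segre line as its one dimensional part. In the smooth conic case (2), $K$ lies in a $2\times 2$ compression $U\otimes V$ and is equivalent to the traceless hyperplane $\{X\in M_2(\mathbb C):\operatorname{Tr}X=0\}$ of $M_2(\mathbb C)$.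
   Context: Everything is over $\mathbb C$. $M_{a,b}=M_{a,b}(\mathbb C)$ is identified with $A\otimes B$, $A=\mathbb C^a$, $B=\mathbb C^b$, via $x\otimes y\mapsto xy^{\mathsf T}$. $\mathbb P(E)$ is the projective space of one dimensional subspaces of $E$. $\Sigma_{a,b}=\mathbb P^{a-1}\times\mathbb P^{b-1}\subset\mathbb P(M_{a,b})$ is the Segre variety of rank one matrices, with scheme structure defined by the $2\times2$ minors. Intersections carry the induced scheme structure: choosing homogeneous coordinates $[s:t:u]$ on the plane $\mathbb P(K)\simeq\mathbb P^2$, $Z_K$ is the projective scheme defined by the ideal generated by the $2\times2$ minors restricted to $K$. A ruling linear space is a linear space $\mathbb P(\mathbb Cx\otimes Z)$ with $x\in A\setminus\{0\}$, $Z\subset B$ (first ruling), or $\mathbb P(Y\otimes\mathbb Cy)$ with $y\in B\setminus\{0\}$, $Y\subset A$ (second ruling); it is a ruling plane if it is two dimensional (here $Z_K=\mathbb P(K)$) and a Segre line if it is one dimensional. Opposite rulings means one line from each ruling. "A Segre line with one embedded residual point contributing length one" means that, in suitable linear coordinates $u,v,w$ on $\mathbb P(K)$ with the Segre line $L=\{u=0\}$, the saturated ideal of $Z_K$ is $(u^2,uv)=(u)\cap(u^2,v)$; the kernel of $\mathcal O_{Z_K}\to\mathcal O_L$ then has length one. A doubled line $\{u=0\}$ is the line counted with multiplicity at least two, i.e. all restricted minors are divisible by $u^2$. A $2\times2$ compression is a subspace $U\otimes V\subset A\otimes B$ with $U\subset A$, $V\subset B$ of dimension two, so $U\otimes V\simeq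 M_2(\mathbb C)$. Equivalence of subspaces of $U\otimes V$ is under the natural action of $\mathrm{GL}(U)\times\mathrm{GL}(V)$. *)

theory Defs
  imports "HOL-Analysis.Analysis" "HOL-Library.Poly_Mapping"
begin

section \<open>Matrices, rulings and compressions\<close>

text \<open>A matrix in \<open>M\<^sub>a\<^sub>,\<^sub>b\<close> has type \<open>complex^'b^'a\<close>, with \<open>a = CARD('a)\<close> rows and
  \<open>b = CARD('b)\<close> columns.  Projective linear subspaces are represented by the underlying vector
  subspaces, so a plane has dimension 3, a line dimension 2 and a point dimension 1.\<close>

definition mscale :: "complex \<Rightarrow> complex^'b^'a \<Rightarrow> complex^'b^'a"
  where "mscale c M = (\<chi> i j. c * M $ i $ j)"

interpretation cmat: vector_space "mscale :: complex \<Rightarrow> complex^'b^'a \<Rightarrow> complex^'b^'a"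
  by unfold_locales (simp_all add: mscale_def vec_eq_iff algebra_simps)

definition outer :: "complex^'a \<Rightarrow> complex^'b \<Rightarrow> complex^'b^'a"
  where "outer x y = (\<chi> i j. x $ i * y $ j)"

definition first_ruling :: "(complex^'b^'a) set \<Rightarrow> bool"
  where "first_ruling W \<longleftrightarrow> (\<exists>x Z. x \<noteq> 0 \<and> vec.subspace Z \<and> W = {outer x z | z. z \<in> Z})"

definition second_ruling :: "(complex^'b^'a) set \<Rightarrow> bool"
  where "second_ruling W \<longleftrightarrow> (\<exists>y Y. y \<noteq> 0 \<and> vec.subspace Y \<and> W = {outer x y | x. x \<in> Y})"

definition ruling_plane :: "(complex^'b^'a) set \<Rightarrow> bool"
  where "ruling_plane W \<longleftrightarrow> (first_ruling W \<or> second_ruling W) \<and> cmat.dim W = 3"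

definition Segre_line :: "(complex^'b^'a) set \<Rightarrow> bool"
  where "Segre_line W \<longleftrightarrow> (first_ruling W \<or> second_ruling W) \<and> cmat.dim W = 2"

definition tensor :: "(complex^'a) set \<Rightarrow> (complex^'b) set \<Rightarrow> (complex^'b^'a) set"
  where "tensor U V = cmat.span {outer x y | x y. x \<in> U \<and> y \<in> V}"

definition in_Segre :: "(complex^'b^'a) set \<Rightarrow> bool"
  where "in_Segre W \<longleftrightarrow> (\<forall>M\<in>W. M \<noteq> 0 \<longrightarrow> rank M = 1)"

definition GL_equivalent :: "(complex^2^2) set \<Rightarrow> (complex^2^2) set \<Rightarrow> bool"
  where "GL_equivalent W W' \<longleftrightarrow>
    (\<exists>G H :: complex^2^2. invertible G \<and> invertible H \<and> W = (\<lambda>X. G ** X ** transpose H) ` W')"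

section \<open>Polynomials in three variables and subschemes of the plane\<close>

type_synonym pol = "(3 \<Rightarrow>\<^sub>0 nat) \<Rightarrow>\<^sub>0 complex"

definition cnst :: "complex \<Rightarrow> pol"
  where "cnst c = Poly_Mapping.single 0 c"

definition var :: "3 \<Rightarrow> pol"
  where "var i = Poly_Mapping.single (Poly_Mapping.single i 1) 1"

definition homogeneous :: "nat \<Rightarrow> pol \<Rightarrow> bool"
  where "homogeneous d p \<longleftrightarrow>
    (\<forall>m\<in>Poly_Mapping.keys p. (\<Sum>i\<in>UNIV. Poly_Mapping.lookup m i) = d)"

definition eval_pol :: "pol \<Rightarrow> complex^3 \<Rightarrow> complex"
  where "eval_pol p x = (\<Sum>m\<in>Poly_Mapping.keys p.
    Poly_Mapping.lookup p m * (\<Prod>i\<in>UNIV. x $ i ^ Poly_Mapping.lookup m i))"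

text \<open>The truncated subtraction of exponents is harmless: monomials not involving the
  variable \<open>i\<close> get the coefficient 0.\<close>

definition partial_deriv :: "3 \<Rightarrow> pol \<Rightarrow> pol"
  where "partial_deriv i p = (\<Sum>m\<in>Poly_Mapping.keys p.
    Poly_Mapping.single (m - Poly_Mapping.single i 1)
      (of_nat (Poly_Mapping.lookup m i) * Poly_Mapping.lookup p m))"

definition dot :: "complex^3 \<Rightarrow> complex^3 \<Rightarrow> complex"
  where "dot c x = (\<Sum>i\<in>UNIV. c $ i * x $ i)"

definition linform :: "complex^3 \<Rightarrow> pol"
  where "linform c = (\<Sum>i\<in>UNIV. cnst (c $ i) * var i)"

text \<open>A commutative ring is a module over itself; its submodules are the ideals, and
  \<open>ideal.span\<close> is the ideal generated by a set.\<close>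

interpretation ideal: module "(*) :: 'r::comm_ring_1 \<Rightarrow> 'r \<Rightarrow> 'r"
  by unfold_locales (simp_all add: algebra_simps)

text \<open>Closed subschemes of the projective plane correspond bijectively to saturated homogeneous
  ideals; the scheme defined by a homogeneous ideal \<open>I\<close> corresponds to the saturation of \<open>I\<close>
  with respect to the irrelevant ideal, generated by the three variables.\<close>

definition saturation :: "pol set \<Rightarrow> pol set"
  where "saturation I = {f. \<forall>i. \<exists>n. var i ^ n * f \<in> I}"

definition prime_ideal :: "pol set \<Rightarrow> bool"
  where "prime_ideal P \<longleftrightarrow>
    ideal.subspace P \<and> 1 \<notin> P \<and> (\<forall>f g. f * g \<in> P \<longrightarrow> f \<in> P \<or> g \<in> P)"

definition homogeneous_ideal :: "pol set \<Rightarrow> bool"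
  where "homogeneous_ideal P \<longleftrightarrow> (\<exists>G. (\<forall>g\<in>G. \<exists>d. homogeneous d g) \<and> P = ideal.span G)"

text \<open>The points of the projective scheme defined by \<open>I\<close>.\<close>

definition proj_points :: "pol set \<Rightarrow> pol set set"
  where "proj_points I =
    {P. prime_ideal P \<and> homogeneous_ideal P \<and> I \<subseteq> P \<and> \<not> range var \<subseteq> P}"

text \<open>The dimension of that scheme: irreducible closed subsets are the closures of points, and
  reversing inclusion turns chains of them into chains of primes.  The empty scheme has
  dimension \<open>-\<infinity>\<close>.\<close>

definition proj_dim :: "pol set \<Rightarrow> ereal"
  where "proj_dim I = Sup {ereal (real n) | n.
    \<exists>P. (\<forall>i\<le>n. P i \<in> proj_points I) \<and> (\<forall>i<n. P i \<subset> P (Suc i))}"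

text \<open>Jacobian criterion for the plane curve with equation \<open>q\<close>.\<close>

definition smooth_curve :: "pol \<Rightarrow> bool"
  where "smooth_curve q \<longleftrightarrow>
    (\<forall>x. x \<noteq> 0 \<and> eval_pol q x = 0 \<longrightarrow> (\<exists>i. eval_pol (partial_deriv i q) x \<noteq> 0))"

section \<open>Plane sections of the Segre variety\<close>

text \<open>Homogeneous coordinates on \<open>\<P>(K)\<close> are given by a basis \<open>e\<close> of \<open>K\<close>; the point with
  coordinates \<open>x\<close> is \<open>pt e x\<close>.\<close>

definition plane_coords :: "(3 \<Rightarrow> complex^'b^'a) \<Rightarrow> (complex^'b^'a) set \<Rightarrow> bool"
  where "plane_coords e K \<longleftrightarrow>
    inj e \<and> cmat.independent (range e) \<and> cmat.span (range e) = K"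

definition pt :: "(3 \<Rightarrow> complex^'b^'a) \<Rightarrow> complex^3 \<Rightarrow> complex^'b^'a"
  where "pt e x = (\<Sum>k\<in>UNIV. mscale (x $ k) (e k))"

definition generic_entry :: "(3 \<Rightarrow> complex^'b^'a) \<Rightarrow> 'a \<Rightarrow> 'b \<Rightarrow> pol"
  where "generic_entry e i j = (\<Sum>k\<in>UNIV. cnst (e k $ i $ j) * var k)"

definition minors :: "(3 \<Rightarrow> complex^'b^'a) \<Rightarrow> pol set"
  where "minors e =
    {generic_entry e i j * generic_entry e i' j' - generic_entry e i j' * generic_entry e i' j
      | i i' j j'. i \<noteq> i' \<and> j \<noteq> j'}"

definition minors_ideal :: "(3 \<Rightarrow> complex^'b^'a) \<Rightarrow> pol set"
  where "minors_ideal e = ideal.span (minors e)"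

text \<open>The saturated ideal of \<open>Z\<^sub>K\<close>.\<close>

definition Z_ideal :: "(3 \<Rightarrow> complex^'b^'a) \<Rightarrow> pol set"
  where "Z_ideal e = saturation (minors_ideal e)"

text \<open>The homogeneous ideal of the reduced linear subspace \<open>\<P>(W)\<close> of \<open>\<P>(K)\<close>.\<close>

definition linear_ideal :: "(3 \<Rightarrow> complex^'b^'a) \<Rightarrow> (complex^'b^'a) set \<Rightarrow> pol set"
  where "linear_ideal e W = ideal.span {linform c | c. \<forall>x. pt e x \<in> W \<longrightarrow> dot c x = 0}"

text \<open>The subspace of \<open>K\<close> where the linear form with coefficients \<open>c\<close> vanishes.\<close>

definition zero_locus :: "(3 \<Rightarrow> complex^'b^'a) \<Rightarrow> complex^3 \<Rightarrow> (complex^'b^'a) set"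
  where "zero_locus e c = {pt e x | x. dot c x = 0}"

definition doubled_Segre_line :: "(3 \<Rightarrow> complex^'b^'a) \<Rightarrow> complex^3 \<Rightarrow> bool"
  where "doubled_Segre_line e c \<longleftrightarrow>
    Segre_line (zero_locus e c) \<and> (\<forall>m\<in>minors e. linform c ^ 2 dvd m)"

datatype section_type =
    Ruling_Plane
  | Smooth_Conic
  | Two_Opposite_Lines
  | Reduced_Line
  | Line_And_Point
  | Line_With_Embedded_Point

text \<open>Intersections of ideals are scheme-theoretic unions.  The rows of the invertible matrix
  \<open>C\<close> in the last case are linear coordinates \<open>u, v, w\<close> on \<open>\<P>(K)\<close>.\<close>

primrec has_type ::
  "(complex^'b^'a) set \<Rightarrow> (3 \<Rightarrow> complex^'b^'a) \<Rightarrow> section_type \<Rightarrow> bool"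
where
  "has_type K e Ruling_Plane \<longleftrightarrow> ruling_plane K \<and> Z_ideal e = linear_ideal e K"
| "has_type K e Smooth_Conic \<longleftrightarrow>
    (\<exists>q. q \<noteq> 0 \<and> homogeneous 2 q \<and> smooth_curve q \<and> Z_ideal e = ideal.span {q})"
| "has_type K e Two_Opposite_Lines \<longleftrightarrow>
    (\<exists>L L'. L \<subseteq> K \<and> L' \<subseteq> K \<and> Segre_line L \<and> first_ruling L \<and> Segre_line L' \<and> second_ruling L' \<and>
      Z_ideal e = linear_ideal e L \<inter> linear_ideal e L')"
| "has_type K e Reduced_Line \<longleftrightarrow>
    (\<exists>L. L \<subseteq> K \<and> Segre_line L \<and> Z_ideal e = linear_ideal e L)"
| "has_type K e Line_And_Point \<longleftrightarrow>
    (\<exists>L p. L \<subseteq> K \<and> Segre_line L \<and>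
      p \<subseteq> K \<and> cmat.subspace p \<and> cmat.dim p = 1 \<and> \<not> p \<subseteq> L \<and>
      Z_ideal e = linear_ideal e L \<inter> linear_ideal e p)"
| "has_type K e Line_With_Embedded_Point \<longleftrightarrow>
    (\<exists>C :: complex^3^3. invertible C \<and> Segre_line (zero_locus e (C $ 1)) \<and>
      Z_ideal e = ideal.span {linform (C $ 1) ^ 2, linform (C $ 1) * linform (C $ 2)})"

end

theory Submission
  imports Defs "HOL-Computational_Algebra.Fundamental_Theorem_Algebra"
begin

text \<open>Write \<open>M(x)\<close> for the matrix \<open>pt e x\<close>.  Its entries are linear forms in the three coordinates, so the
minors are quadratic forms, and everything rests on their common factors.

\<^emph>\<open>Positive dimension means a common factor.\<close>  Let \<open>P \<subset> P'\<close> be homogeneous primes containing the minors,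
neither of them containing all three variables.  Suppose first that \<open>P\<close> contains a linear form \<open>u \<noteq> 0\<close>.  A minor
that is not divisible by \<open>u\<close> splits into two linear forms on the line \<open>u = 0\<close>, so \<open>P\<close> contains a second
linear form and hence the ideal of a point; no prime of the required kind lies strictly above that.  So
\<open>u\<close> divides every minor.  Suppose now that \<open>P\<close> contains no linear form and that not all minors vanish.  Since a singular conic is a product
of two linear forms, a minor \<open>q \<noteq> 0\<close> defines a smooth conic; for any other minor \<open>m\<close> the pencil
\<open>m - t q\<close> has a singular member, which lies in \<open>P\<close> and is therefore zero.  So all minors are multiples of \<open>q\<close>.
This is \<open>positive_dimension_cases\<close>.

\<^emph>\<open>The types.\<close>  In the second case the ideal of minors is \<open>(q)\<close>, which is saturated.  In the first case
every minor is \<open>u\<close> times a linear form, so the ideal is \<open>u I(S)\<close>, where \<open>S\<close> is the space of common zeros of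
the cofactors.  If \<open>dim S = 0\<close>, the saturation is \<open>(u)\<close>: a reduced line.  If \<open>dim S = 1\<close>, the result is a line and
a point, isolated or embedded according to whether \<open>u\<close> vanishes on \<open>S\<close>.  If \<open>dim S = 2\<close>, it is a pair of lines,
which are different and from opposite rulings by the facts below.
If \<open>S\<close> is everything, all minors vanish.  This is \<open>linform_divides_minors_type\<close>.  Matrices enter only through three
facts: a linear space of matrices of rank at most one lies in a ruling (\<open>rank_le_1_space_ruling\<close>); if
the section is a doubled Segre line, or a pair of lines from the same ruling, then all of \<open>K\<close> has rank at most
one (\<open>doubled_line_rank_le_1\<close>, \<open>two_first_ruling_lines\<close>).

\<^emph>\<open>Uniqueness.\<close>  The zero set of the ideal, together with the presence of a linear form in it, tells the types
apart (\<open>section_type_unique\<close>).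

\<^emph>\<open>The conic.\<close>  Take two points \<open>p\<^sub>1, p\<^sub>2\<close> of the conic and the pole \<open>p\<^sub>3\<close> of their chord.  Then
\<open>M(p\<^sub>1) = a\<^sub>1 b\<^sub>1\<^sup>T\<close> and \<open>M(p\<^sub>2) = a\<^sub>2 b\<^sub>2\<^sup>T\<close>, and since all minors are multiples of one quadratic form, the minors
polarised at \<open>p\<^sub>1, p\<^sub>3\<close> and at \<open>p\<^sub>2, p\<^sub>3\<close> vanish.  This forces
\<open>M(p\<^sub>3) = \<beta> a\<^sub>1 b\<^sub>2\<^sup>T + \<gamma> a\<^sub>2 b\<^sub>1\<^sup>T\<close> with \<open>\<beta> \<gamma> \<noteq> 0\<close>, which up to the action of the two linear
groups is the traceless hyperplane (\<open>smooth_conic_normal_form\<close>, \<open>compression_equivalent\<close>).\<close>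

section \<open>Polynomials as functions\<close>

text \<open>For a ring over itself this rewrite rule reads \<open>a * (b * x) = (a * b) * x\<close>; it makes the simplifier loop
together with associativity.\<close>

declare ideal.scale_scale [simp del]

lemma pol_eq_sum_monomials:
  "p = (\<Sum>m\<in>Poly_Mapping.keys p. Poly_Mapping.single m (Poly_Mapping.lookup p m))"
proof (rule poly_mapping_eqI)
  fix k
  show "Poly_Mapping.lookup p k = Poly_Mapping.lookup
    (\<Sum>m\<in>Poly_Mapping.keys p. Poly_Mapping.single m (Poly_Mapping.lookup p m)) k"
    by (cases "k \<in> Poly_Mapping.keys p")
      (simp_all add: lookup_sum lookup_single when_def in_keys_iff)
qed

definition monom_at :: "complex^3 \<Rightarrow> (3 \<Rightarrow>\<^sub>0 nat) \<Rightarrow> complex"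
  where "monom_at x m = (\<Prod>i\<in>UNIV. x $ i ^ Poly_Mapping.lookup m i)"

lemma monom_at_add: "monom_at x (m + n) = monom_at x m * monom_at x n"
  by (simp add: monom_at_def lookup_add power_add prod.distrib)

lemma eval_pol_superset:
  assumes "finite A" "Poly_Mapping.keys p \<subseteq> A"
  shows "eval_pol p x = (\<Sum>m\<in>A. Poly_Mapping.lookup p m * monom_at x m)"
  unfolding eval_pol_def monom_at_def
  using assms by (intro sum.mono_neutral_left) (auto simp: in_keys_iff)

lemma eval_pol_0 [simp]: "eval_pol 0 x = 0"
  by (simp add: eval_pol_def)

lemma eval_pol_single: "eval_pol (Poly_Mapping.single m c) x = c * monom_at x m"
  using eval_pol_superset[of "{m}" "Poly_Mapping.single m c" x] by (auto split: if_splits)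

lemma eval_pol_add [simp]: "eval_pol (p + q) x = eval_pol p x + eval_pol q x"
proof -
  let ?A = "Poly_Mapping.keys p \<union> Poly_Mapping.keys q"
  have "Poly_Mapping.keys (p + q) \<subseteq> ?A" by (rule keys_add)
  then show ?thesis
    using eval_pol_superset[of ?A "p + q" x] eval_pol_superset[of ?A p x]
      eval_pol_superset[of ?A q x]
    by (simp add: lookup_add algebra_simps sum.distrib)
qed

lemma eval_pol_sum [simp]: "eval_pol (\<Sum>i\<in>A. f i) x = (\<Sum>i\<in>A. eval_pol (f i) x)"
  by (induction A rule: infinite_finite_induct) auto

lemma eval_pol_uminus [simp]: "eval_pol (- p) x = - eval_pol p x"
proof -
  have "eval_pol (p + - p) x = 0" by simp
  then show ?thesis by (simp only: eval_pol_add) algebra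
qed

lemma eval_pol_diff [simp]: "eval_pol (p - q) x = eval_pol p x - eval_pol q x"
  using eval_pol_add[of p "- q" x] by simp

lemma eval_pol_mult [simp]: "eval_pol (p * q) x = eval_pol p x * eval_pol q x"
proof -
  let ?s = Poly_Mapping.single and ?l = Poly_Mapping.lookup and ?k = Poly_Mapping.keys
  have "p * q = (\<Sum>m\<in>?k p. ?s m (?l p m)) * (\<Sum>n\<in>?k q. ?s n (?l q n))"
    using pol_eq_sum_monomials[of p] pol_eq_sum_monomials[of q] by simp
  also have "\<dots> = (\<Sum>m\<in>?k p. \<Sum>n\<in>?k q. ?s (m + n) (?l p m * ?l q n))"
    unfolding sum_product mult_single ..
  also have "eval_pol \<dots> x = (\<Sum>m\<in>?k p. \<Sum>n\<in>?k q. (?l p m * monom_at x m) * (?l q n * monom_at x n))"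
    unfolding eval_pol_sum eval_pol_single monom_at_add by (simp only: mult_ac)
  also have "\<dots> = (\<Sum>m\<in>?k p. ?l p m * monom_at x m) * (\<Sum>n\<in>?k q. ?l q n * monom_at x n)"
    unfolding sum_product ..
  also have "\<dots> = eval_pol p x * eval_pol q x"
    unfolding eval_pol_def monom_at_def ..
  finally show ?thesis .
qed

lemma eval_pol_1 [simp]: "eval_pol 1 x = 1"
  using eval_pol_single[of 0 1 x] by (simp add: monom_at_def)

lemma eval_pol_power [simp]: "eval_pol (p ^ n) x = eval_pol p x ^ n"
  by (induction n) auto

lemma eval_pol_prod [simp]: "eval_pol (\<Prod>i\<in>A. f i) x = (\<Prod>i\<in>A. eval_pol (f i) x)"
  by (induction A rule: infinite_finite_induct) auto

lemma eval_pol_cnst [simp]: "eval_pol (cnst c) x = c"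
  by (simp add: cnst_def eval_pol_single monom_at_def)

lemma eval_pol_var [simp]: "eval_pol (var i) x = x $ i"
proof -
  have "monom_at x (Poly_Mapping.single i 1) = (\<Prod>j\<in>UNIV. if j = i then x $ i else 1)"
    unfolding monom_at_def by (intro prod.cong) (auto simp: lookup_single when_def)
  then show ?thesis by (simp add: var_def eval_pol_single)
qed

lemma eval_pol_linform [simp]: "eval_pol (linform c) x = dot c x"
  by (simp add: linform_def dot_def)

text \<open>Kronecker substitution: along the curve \<open>(t, t\<^sup>N, t\<^sup>N\<^sup>N)\<close> with \<open>N\<close> above all exponents, distinct monomials become
distinct powers of \<open>t\<close>, and a univariate polynomial with infinitely many zeros is zero.\<close>

lemma eval_pol_eq_0D:
  assumes "\<And>x. eval_pol p x = 0"
  shows "p = 0"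
proof (rule ccontr)
  assume "p \<noteq> 0"
  let ?l = Poly_Mapping.lookup and ?k = "Poly_Mapping.keys p"
  obtain m0 where m0: "m0 \<in> ?k" using \<open>p \<noteq> 0\<close> keys_eq_empty by blast
  obtain N where N: "\<And>m i. m \<in> ?k \<Longrightarrow> ?l m i < N"
  proof -
    let ?S = "\<Sum>m\<in>?k. \<Sum>i\<in>UNIV. ?l m i"
    have "?l m i \<le> ?S" if "m \<in> ?k" for m i
    proof -
      have "?l m i \<le> (\<Sum>i\<in>UNIV. ?l m i)" by (rule member_le_sum) auto
      also have "\<dots> \<le> ?S" using that by (intro member_le_sum) auto
      finally show ?thesis .
    qed
    then show ?thesis by (intro that[of "Suc ?S"]) (simp add: less_Suc_eq_le)
  qed
  \<comment> \<open>The exponents of a monomial are the base \<open>N\<close> digits of its weight.\<close>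
  define w where "w m = ?l m 1 + N * (?l m 2 + N * ?l m 3)" for m :: "3 \<Rightarrow>\<^sub>0 nat"
  have inj: "m = n" if "m \<in> ?k" "n \<in> ?k" "w m = w n" for m n
  proof -
    have digits: "?l m 1 = w m mod N" "?l m 2 = (w m div N) mod N" "?l m 3 = (w m div N) div N"
      if "m \<in> ?k" for m
    proof -
      have lt: "?l m 1 < N" "?l m 2 < N" using N[OF that] by auto
      then have "w m div N = ?l m 2 + N * ?l m 3" by (simp add: w_def)
      then show "?l m 1 = w m mod N" "?l m 2 = (w m div N) mod N" "?l m 3 = (w m div N) div N"
        using lt by (simp_all add: w_def)
    qed
    have "?l m 1 = ?l n 1" "?l m 2 = ?l n 2" "?l m 3 = ?l n 3"
      by (simp_all only: digits[OF that(1)] digits[OF that(2)] that(3))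
    then have "?l m i = ?l n i" for i using exhaust_3[of i] by auto
    then show ?thesis by (intro poly_mapping_eqI)
  qed
  define P where "P = (\<Sum>m\<in>?k. monom (?l p m) (w m))"
  have "poly P t = 0" for t
  proof -
    have "monom_at (vector [t, t ^ N, t ^ (N * N)]) m = t ^ w m" for m
    proof -
      have "monom_at (vector [t, t ^ N, t ^ (N * N)]) m
          = t ^ ?l m 1 * ((t ^ N) ^ ?l m 2 * (t ^ (N * N)) ^ ?l m 3)"
        unfolding monom_at_def UNIV_3 by simp
      also have "\<dots> = t ^ w m"
        unfolding w_def power_mult [symmetric] power_add [symmetric] distrib_left mult.assoc ..
      finally show ?thesis .
    qed
    then have "poly P t = eval_pol p (vector [t, t ^ N, t ^ (N * N)])"
      by (simp add: P_def poly_sum poly_monom eval_pol_def monom_at_def)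
    then show ?thesis using assms by simp
  qed
  then have "P = 0" using poly_all_0_iff_0 by blast
  then have "0 = coeff P (w m0)" by simp
  also have "\<dots> = (\<Sum>m\<in>?k. if m = m0 then ?l p m else 0)"
    unfolding P_def coeff_sum using inj m0 by (intro sum.cong) auto
  also have "\<dots> = ?l p m0" using m0 by simp
  finally show False using m0 by (simp add: in_keys_iff)
qed

lemma pol_eqI:
  assumes "\<And>x. eval_pol p x = eval_pol q x"
  shows "p = q"
  using eval_pol_eq_0D[of "p - q"] assms by simp

section \<open>Vanishing ideals of linear subspaces\<close>

lemma dot_add_left [simp]: "dot (c + d) x = dot c x + dot d x"
  and dot_add_right [simp]: "dot c (x + y) = dot c x + dot c y"
  and dot_smult_left [simp]: "dot (k *s c) x = k * dot c x"
  and dot_smult_right [simp]: "dot c (k *s x) = k * dot c x"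
  and dot_diff_left [simp]: "dot (c - d) x = dot c x - dot d x"
  and dot_diff_right [simp]: "dot c (x - y) = dot c x - dot c y"
  and dot_0_left [simp]: "dot 0 x = 0"
  and dot_0_right [simp]: "dot c 0 = 0"
  unfolding dot_def sum_3 by (simp_all add: algebra_simps)

lemma dot_commute: "dot c x = dot x c"
  by (simp add: dot_def mult.commute)

lemma dot_axis [simp]: "dot c (axis i 1) = c $ i" "dot (axis i 1) c = c $ i"
  by (simp_all add: dot_def axis_def if_distrib[of "\<lambda>z. z * _"] if_distrib[of "\<lambda>z. _ * z"] cong: if_cong)

lemma dot_eq_0_iff: "(\<forall>x. dot c x = 0) \<longleftrightarrow> c = 0"
  by (metis dot_0_left dot_axis(1) vec_eq_iff zero_index)

lemma linform_eq_iff: "linform c = linform d \<longleftrightarrow> c = d"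
  by (metis dot_axis(1) eval_pol_linform vec_eq_iff)

lemma linform_0 [simp]: "linform 0 = 0"
  by (intro pol_eqI) simp

lemma linform_eq_0_iff [simp]: "linform c = 0 \<longleftrightarrow> c = 0"
  using linform_eq_iff[of c 0] by simp

lemma linform_add: "linform (c + d) = linform c + linform d"
  and linform_smult: "linform (k *s c) = cnst k * linform c"
  by (intro pol_eqI; simp)+

lemma var_eq_linform: "var i = linform (axis i 1)"
  by (intro pol_eqI) simp

definition subst :: "(3 \<Rightarrow> pol) \<Rightarrow> pol \<Rightarrow> pol"
  where "subst s p = (\<Sum>m\<in>Poly_Mapping.keys p.
    cnst (Poly_Mapping.lookup p m) * (\<Prod>i\<in>UNIV. s i ^ Poly_Mapping.lookup m i))"

lemma eval_pol_subst: "eval_pol (subst s p) x = eval_pol p (\<chi> i. eval_pol (s i) x)"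
  by (simp add: subst_def eval_pol_def[of p])

lemma ideal_diff_prod:
  fixes J :: "pol set"
  assumes J: "ideal.subspace J" and d: "\<And>i. i \<in> A \<Longrightarrow> f i - g i \<in> J"
  shows "prod f A - prod g A \<in> J"
  using d
proof (induction A rule: infinite_finite_induct)
  case (insert a A)
  have "prod f (insert a A) - prod g (insert a A)
      = prod f A * (f a - g a) + g a * (prod f A - prod g A)"
    using insert.hyps by (simp add: algebra_simps)
  then show ?case
    using insert by (auto intro!: ideal.subspace_add[OF J] ideal.subspace_scale[OF J])
qed (auto intro: ideal.subspace_0[OF J])

lemma subst_var: "subst var p = p"
  by (intro pol_eqI) (simp add: eval_pol_subst)

text \<open>Modulo \<open>J\<close> the variables are congruent to the polynomials substituted for them.\<close>

lemma ideal_diff_subst: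
  assumes J: "ideal.subspace J" and d: "\<And>i. var i - s i \<in> J"
  shows "p - subst s p \<in> J"
proof -
  let ?l = Poly_Mapping.lookup
  have 1: "var i ^ n - s i ^ n \<in> J" for i n
    using ideal_diff_prod[OF J, of "{..<n}" "\<lambda>_. var i" "\<lambda>_. s i"] d by simp
  have "p - subst s p = subst var p - subst s p" by (simp add: subst_var)
  also have "\<dots> = (\<Sum>m\<in>Poly_Mapping.keys p. cnst (?l p m) *
      ((\<Prod>i\<in>UNIV. var i ^ ?l m i) - (\<Prod>i\<in>UNIV. s i ^ ?l m i)))"
    by (simp add: subst_def sum_subtractf [symmetric] right_diff_distrib)
  also have "\<dots> \<in> J"
    by (intro ideal.subspace_sum[OF J] ideal.subspace_scale[OF J] ideal_diff_prod[OF J] 1)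
  finally show ?thesis .
qed

definition vanishing :: "(complex^3) set \<Rightarrow> pol set"
  where "vanishing S = {f. \<forall>x\<in>S. eval_pol f x = 0}"

lemma subspace_vanishing: "ideal.subspace (vanishing S)"
  by (auto simp: vanishing_def ideal.subspace_def)

text \<open>A linear projection onto \<open>S\<close>, given by its coordinate forms, so that it can be substituted into polynomials.\<close>

lemma projection_onto_subspace:
  assumes S: "vec.subspace (S :: (complex^3) set)"
  obtains p :: "3 \<Rightarrow> complex^3" where "\<And>x. (\<chi> i. dot (p i) x) \<in> S"
    "\<And>x. x \<in> S \<Longrightarrow> (\<chi> i. dot (p i) x) = x"
proof -
  obtain B where B: "B \<subseteq> S" "vec.independent B" "S \<subseteq> vec.span B"
    using vec.basis_exists[of S] by metis
  have BS: "vec.span B = S"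
    using B vec.span_minimal[OF B(1) S] by auto
  obtain g :: "complex^3 \<Rightarrow> complex^3"
    where g: "Vector_Spaces.linear (*s) (*s) g" "\<And>b. b \<in> B \<Longrightarrow> g b = b" "range g = vec.span B"
    using vec.linear_independent_extend_subspace[OF B(2), of "\<lambda>x. x"] by auto
  have id: "g x = x" if "x \<in> S" for x
  proof -
    have "x \<in> vec.span B" using that BS by simp
    then show ?thesis
      by (rule vec.linear_eq_on[OF g(1) vec.linear_ident]) (use g in auto)
  qed
  have eq: "(\<chi> i. dot (matrix g $ i) x) = g x" for x
    using matrix_works[OF g(1), of x]
    by (simp add: dot_def matrix_vector_mult_def)
  show thesis
    by (rule that[of "\<lambda>i. matrix g $ i"]) (use eq id g(3) BS in auto)
qed

text \<open>Substituting a projection onto \<open>S\<close> into \<open>f\<close> changes \<open>f\<close> only by an element of the ideal generated by linear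
forms, and kills \<open>f\<close> if \<open>f\<close> vanishes on \<open>S\<close>.\<close>

theorem vanishing_subspace:
  assumes S: "vec.subspace S"
  shows "vanishing S = ideal.span {linform c | c. \<forall>x\<in>S. dot c x = 0}" (is "_ = ?J")
proof
  show "?J \<subseteq> vanishing S"
    by (rule ideal.span_minimal[OF _ subspace_vanishing]) (auto simp: vanishing_def)
  obtain p where p: "\<And>x. (\<chi> i. dot (p i) x) \<in> S" "\<And>x. x \<in> S \<Longrightarrow> (\<chi> i. dot (p i) x) = x"
    using projection_onto_subspace[OF S] by metis
  show "vanishing S \<subseteq> ?J"
  proof
    fix f assume f: "f \<in> vanishing S"
    have "subst (\<lambda>i. linform (p i)) f = 0"
      using f p(1) by (intro eval_pol_eq_0D) (simp add: eval_pol_subst vanishing_def)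
    moreover have "var i - linform (p i) \<in> ?J" for i
    proof -
      have "var i - linform (p i) = linform (axis i 1 - p i)"
        by (intro pol_eqI) simp
      moreover have "dot (axis i 1 - p i) x = 0" if "x \<in> S" for x
        using p(2)[OF that] by (simp add: vec_eq_iff)
      ultimately show ?thesis by (intro ideal.span_base) auto
    qed
    then have "f - subst (\<lambda>i. linform (p i)) f \<in> ?J"
      by (intro ideal_diff_subst) auto
    ultimately show "f \<in> ?J" by simp
  qed
qed

text \<open>Substituting a projection onto \<open>S\<close> has the vanishing ideal as kernel and maps into a domain.\<close>

theorem vanishing_prime:
  assumes S: "vec.subspace S" and fg: "f * g \<in> vanishing S"
  shows "f \<in> vanishing S \<or> g \<in> vanishing S"
proof -
  obtain p where p: "\<And>x. (\<chi> i. dot (p i) x) \<in> S" "\<And>x. x \<in> S \<Longrightarrow> (\<chi> i. dot (p i) x) = x"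
    using projection_onto_subspace[OF S] by metis
  let ?s = "subst (\<lambda>i. linform (p i))"
  have 1: "h \<in> vanishing S" if "?s h = 0" for h
    unfolding vanishing_def
  proof safe
    fix x assume x: "x \<in> S"
    have "eval_pol (?s h) x = 0" by (simp add: that)
    then show "eval_pol h x = 0" using p(2)[OF x] by (simp add: eval_pol_subst)
  qed
  have "?s f * ?s g = 0"
    using fg p(1) by (intro eval_pol_eq_0D) (simp add: eval_pol_subst vanishing_def)
  then have "?s f = 0 \<or> ?s g = 0" by simp
  then show ?thesis using 1 by blast
qed

lemma subspace_ker: "vec.subspace {x. dot c x = 0}"
  by (auto simp: vec.subspace_def)

lemma in_span_single: "f \<in> ideal.span {q} \<longleftrightarrow> q dvd f" for q :: pol
  by (auto simp: ideal.span_singleton dvd_def mult.commute)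

lemma dot_zero_on_ker_multiple:
  assumes "\<And>x. dot c x = 0 \<Longrightarrow> dot d x = 0"
  obtains k where "d = k *s c"
proof (cases "c = 0")
  case True
  then have "dot d x = 0" for x using assms[of x] by simp
  then have "d = 0" using dot_eq_0_iff by blast
  then show thesis by (intro that[of 0]) simp
next
  case False
  then obtain x where x: "dot c x \<noteq> 0" using dot_eq_0_iff by blast
  have "d $ i = dot d x / dot c x * c $ i" for i
  proof -
    have "dot d (axis i 1 - (c $ i / dot c x) *s x) = 0"
      using x by (intro assms) simp
    then show ?thesis by (simp add: mult.commute)
  qed
  then show thesis by (intro that[of "dot d x / dot c x"]) (simp add: vec_eq_iff)
qed

lemma vanishing_ker: "vanishing {x. dot c x = 0} = ideal.span {linform c}"
proof
  have *: "{linform d | d. \<forall>x\<in>{x. dot c x = 0}. dot d x = 0} \<subseteq> ideal.span {linform c}"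
  proof safe
    fix d assume d: "\<forall>x\<in>{x. dot c x = 0}. dot d x = 0"
    obtain k where "d = k *s c"
      using dot_zero_on_ker_multiple[of c d] d by blast
    then show "linform d \<in> ideal.span {linform c}"
      by (simp add: linform_smult in_span_single)
  qed
  show "vanishing {x. dot c x = 0} \<subseteq> ideal.span {linform c}"
    unfolding vanishing_subspace[OF subspace_ker]
    by (rule ideal.span_minimal[OF *]) simp
  show "ideal.span {linform c} \<subseteq> vanishing {x. dot c x = 0}"
    by (rule ideal.span_minimal[OF _ subspace_vanishing]) (auto simp: vanishing_def)
qed

lemma linform_dvd_iff: "linform c dvd f \<longleftrightarrow> (\<forall>x. dot c x = 0 \<longrightarrow> eval_pol f x = 0)"
  using vanishing_ker[of c] by (auto simp: vanishing_def in_span_single set_eq_iff)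

lemma linform_prime: 
  assumes "linform c dvd f * g"
  shows "linform c dvd f \<or> linform c dvd g"
  using vanishing_prime[OF subspace_ker, of f g c] assms
  by (simp add: vanishing_ker in_span_single)

lemma linform_dvd_linform:
  assumes "linform c dvd linform d"
  obtains k where "d = k *s c"
proof -
  have "\<And>x. dot c x = 0 \<Longrightarrow> dot d x = 0"
    using assms unfolding linform_dvd_iff by simp
  then show thesis using dot_zero_on_ker_multiple that by blast
qed

section \<open>Quadratic forms in three variables\<close>

lemma symmetric_matrix_component:
  assumes "transpose H = H"
  shows "H $ i $ j = H $ j $ i"
  using arg_cong[OF assms, of "\<lambda>M. M $ j $ i"] by (simp add: transpose_def)

lemma dot_matrix_sym:
  assumes "transpose H = H"
  shows "dot x (H *v y) = dot y (H *v x)"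
proof -
  have "dot x (H *v y) = (\<Sum>i\<in>UNIV. \<Sum>j\<in>UNIV. x $ i * (H $ i $ j * y $ j))"
    by (simp add: dot_def matrix_vector_mult_def sum_distrib_left)
  also have "\<dots> = (\<Sum>j\<in>UNIV. \<Sum>i\<in>UNIV. x $ i * (H $ i $ j * y $ j))"
    by (rule sum.swap)
  also have "\<dots> = (\<Sum>j\<in>UNIV. \<Sum>i\<in>UNIV. y $ j * (H $ j $ i * x $ i))"
    by (intro sum.cong refl) (metis symmetric_matrix_component[OF assms] mult.commute mult.left_commute)
  also have "\<dots> = dot y (H *v x)"
    by (simp add: dot_def matrix_vector_mult_def sum_distrib_left)
  finally show ?thesis .
qed

lemma trivial_kernel_iff_det: "(\<forall>x. A *v x = 0 \<longrightarrow> x = 0) \<longleftrightarrow> det A \<noteq> 0"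
  for A :: "complex^'n^'n"
  using invertible_det_nz[of A] invertible_left_inverse[of A] matrix_left_invertible_ker[of A]
  by simp

lemma common_zero:
  obtains x where "x \<noteq> 0" "dot c x = 0" "dot d x = 0"
proof -
  define A :: "complex^3^3" where "A = (\<chi> i. if i = 1 then c else if i = 2 then d else 0)"
  have "row 3 A = 0" by (simp add: A_def row_def vec_eq_iff)
  then have "det A = 0" by (rule det_zero_row)
  then obtain x where "x \<noteq> 0" "A *v x = 0" using trivial_kernel_iff_det[of A] by blast
  then show thesis
    using that[of x] by (simp add: A_def matrix_vector_mult_def vec_eq_iff dot_def forall_3)
qed

text \<open>Quadratic forms are functions here, so that minors, which arise as differences of products of linear forms,
need no matrix; a symmetric one is chosen where the geometry of the conic asks for it.\<close>

definition quadratic :: "(complex^3 \<Rightarrow> complex) \<Rightarrow> bool"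
  where "quadratic f \<longleftrightarrow> (\<exists>H. transpose H = H \<and> (\<forall>x. f x = dot x (H *v x)))"

lemma quadratic_0: "quadratic (\<lambda>x. 0)"
  unfolding quadratic_def by (rule exI[of _ 0]) (simp add: transpose_def vec_eq_iff)

lemma quadratic_add:
  assumes "quadratic f" "quadratic g"
  shows "quadratic (\<lambda>x. f x + g x)"
proof -
  obtain H G where "transpose H = H" "\<And>x. f x = dot x (H *v x)"
    "transpose G = G" "\<And>x. g x = dot x (G *v x)"
    using assms unfolding quadratic_def by metis
  then show ?thesis unfolding quadratic_def
    by (intro exI[of _ "H + G"])
      (simp add: transpose_def vec_eq_iff matrix_vector_mult_add_rdistrib)
qed

lemma quadratic_scale:
  assumes "quadratic f"
  shows "quadratic (\<lambda>x. k * f x)"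
proof -
  obtain H where H: "transpose H = H" "\<And>x. f x = dot x (H *v x)"
    using assms unfolding quadratic_def by metis
  have "(\<chi> i j. k * H $ i $ j) *v x = k *s (H *v x)" for x
    by (simp add: matrix_vector_mult_def vec_eq_iff sum_distrib_left mult.assoc)
  moreover have "transpose (\<chi> i j. k * H $ i $ j) = (\<chi> i j. k * H $ i $ j)"
    using symmetric_matrix_component[OF H(1)] by (simp add: transpose_def vec_eq_iff)
  ultimately show ?thesis unfolding quadratic_def using H(2)
    by (intro exI[of _ "\<chi> i j. k * H $ i $ j"]) simp
qed

lemma quadratic_diff:
  assumes "quadratic f" "quadratic g"
  shows "quadratic (\<lambda>x. f x - g x)"
  using quadratic_add[OF assms(1) quadratic_scale[OF assms(2), of "-1"]] by simp

lemma quadratic_sum: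
  assumes "\<And>i. i \<in> A \<Longrightarrow> quadratic (f i)"
  shows "quadratic (\<lambda>x. \<Sum>i\<in>A. f i x)"
  using assms
  by (induction A rule: infinite_finite_induct) (auto intro: quadratic_0 quadratic_add)

lemma quadratic_product: "quadratic (\<lambda>x. dot c x * dot d x)"
proof -
  define H :: "complex^3^3" where "H = (\<chi> i j. (c $ i * d $ j + d $ i * c $ j) / 2)"
  have "H *v x = (1/2) *s (dot d x *s c + dot c x *s d)" for x
    by (simp add: H_def matrix_vector_mult_def vec_eq_iff dot_def sum_3 field_simps)
  then have "dot x (H *v x) = dot c x * dot d x" for x
    by (simp add: dot_commute[of x])
  moreover have "transpose H = H" by (simp add: H_def transpose_def vec_eq_iff add.commute mult.commute)
  ultimately show ?thesis unfolding quadratic_def by (intro exI[of _ H]) simp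
qed

lemma quadratic_form_add:
  assumes "transpose H = H"
  shows "dot (x + y) (H *v (x + y)) = dot x (H *v x) + 2 * dot x (H *v y) + dot y (H *v y)"
  using dot_matrix_sym[OF assms, of x y] by (simp add: matrix_vector_right_distrib)

lemma binary_form_splits:
  fixes \<alpha> \<beta> \<gamma> :: complex
  obtains a b c d where "\<And>s t. \<alpha> * s^2 + \<beta> * (s * t) + \<gamma> * t^2 = (a * s + b * t) * (c * s + d * t)"
proof (cases "\<alpha> = 0")
  case True
  then show thesis by (intro that[of 0 1 \<beta> \<gamma>]) (simp add: algebra_simps power2_eq_square)
next
  case False
  define D where "D = csqrt (\<beta>^2 - 4 * \<alpha> * \<gamma>)"
  have D: "D^2 = \<beta>^2 - 4 * \<alpha> * \<gamma>" by (simp add: D_def)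
  have "\<alpha> * s^2 + \<beta> * (s * t) + \<gamma> * t^2
      = (\<alpha> * s + (\<beta> - D) / 2 * t) * (1 * s + (\<beta> + D) / (2 * \<alpha>) * t)" for s t
  proof -
    have "4 * \<alpha> * \<gamma> = \<beta>^2 - D^2" using D by simp
    then have \<gamma>: "\<gamma> = (\<beta>^2 - D^2) / (4 * \<alpha>)" using False by (simp add: field_simps)
    show ?thesis unfolding \<gamma> using False by (simp add: divide_simps) algebra
  qed
  then show thesis by (rule that)
qed

text \<open>On the span of two vectors a quadratic form is binary, hence a product of linear forms.\<close>

lemma quadratic_splits_on_plane:
  assumes "quadratic f"
  obtains c d where "\<And>x. f (dot g x *s p + dot h x *s q) = dot c x * dot d x"
proof -
  obtain H where H: "transpose H = H" "\<And>x. f x = dot x (H *v x)"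
    using assms unfolding quadratic_def by metis
  obtain a b a' b' where ab: "\<And>s t. f p * s^2 + (2 * dot p (H *v q)) * (s * t) + f q * t^2
      = (a * s + b * t) * (a' * s + b' * t)"
    using binary_form_splits by blast
  have "f (dot g x *s p + dot h x *s q)
      = dot (a *s g + b *s h) x * dot (a' *s g + b' *s h) x" for x
    using ab[of "dot g x" "dot h x"]
    by (simp add: H(2) matrix_vector_right_distrib vector_scalar_commute
        dot_matrix_sym[OF H(1), of q p] power2_eq_square algebra_simps)
  then show thesis by (rule that)
qed

lemma other_indices:
  obtains i j where "UNIV = {i, j, k :: 3}" "i \<noteq> j" "i \<noteq> k" "j \<noteq> k"
proof -
  consider "k = 1" | "k = 2" | "k = 3" using exhaust_3 by blast
  then show thesis
  proof cases
    case 1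
    have "UNIV = {2, 3, 1 :: 3}" unfolding UNIV_3 by blast
    then show thesis using that[of 2 3] unfolding 1 by simp
  next
    case 2
    have "UNIV = {1, 3, 2 :: 3}" unfolding UNIV_3 by blast
    then show thesis using that[of 1 3] unfolding 2 by simp
  next
    case 3
    have "UNIV = {1, 2, 3 :: 3}" unfolding UNIV_3 by blast
    then show thesis using that[of 1 2] unfolding 3 by simp
  qed
qed

text \<open>Modulo a nonzero vector, three-space has two coordinates.\<close>

lemma projection_along_vector:
  assumes "x \<noteq> 0"
  obtains g p h q k where "\<And>y. y = dot g y *s p + dot h y *s q + dot k y *s x"
proof -
  obtain k where k: "x $ k \<noteq> 0" using assms by (auto simp: vec_eq_iff)
  obtain i j where ij: "UNIV = {i, j, k}" "i \<noteq> j" "i \<noteq> k" "j \<noteq> k" by (rule other_indices)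
  let ?e = "\<lambda>i. axis i 1 :: complex^3"
  have e: "?e m $ n = (if n = m then 1 else 0)" for m n by (simp add: axis_def)
  have "y = dot (?e i - (x $ i / x $ k) *s ?e k) y *s ?e i
      + dot (?e j - (x $ j / x $ k) *s ?e k) y *s ?e j + dot ((1 / x $ k) *s ?e k) y *s x" for y
  proof -
    have "y $ n = (dot (?e i - (x $ i / x $ k) *s ?e k) y *s ?e i
      + dot (?e j - (x $ j / x $ k) *s ?e k) y *s ?e j + dot ((1 / x $ k) *s ?e k) y *s x) $ n" for n
    proof -
      have "n \<in> {i, j, k}" unfolding ij(1) [symmetric] by simp
      then consider "n = i" | "n = j" | "n = k" by auto
      then show ?thesis by cases (use ij(2-4) k in \<open>simp_all add: e\<close>)
    qed
    then show ?thesis unfolding vec_eq_iff by blast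
  qed
  then show thesis by (rule that)
qed

lemma kernel_parametrised:
  assumes "l \<noteq> 0"
  obtains g p h q where "\<And>y. dot l y = 0 \<Longrightarrow> y = dot g y *s p + dot h y *s q"
    "\<And>y. dot l (dot g y *s p + dot h y *s q) = 0"
proof -
  obtain k where k: "l $ k \<noteq> 0" using assms by (auto simp: vec_eq_iff)
  obtain i j where ij: "UNIV = {i, j, k}" "i \<noteq> j" "i \<noteq> k" "j \<noteq> k" by (rule other_indices)
  let ?e = "\<lambda>i. axis i 1 :: complex^3"
  let ?p = "?e i - (l $ i / l $ k) *s ?e k" and ?q = "?e j - (l $ j / l $ k) *s ?e k"
  have "y = dot (?e i) y *s ?p + dot (?e j) y *s ?q" if "dot l y = 0" for y
  proof -
    have "l $ i * y $ i + (l $ j * y $ j + l $ k * y $ k) = 0"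
      using that[unfolded dot_def ij(1)] ij(2-4) by simp
    then have yk: "y $ k = y $ i * (- (l $ i / l $ k)) + y $ j * (- (l $ j / l $ k))"
      using k by (simp add: field_simps) algebra
    have e: "?e m $ n = (if n = m then 1 else 0)" for m n by (simp add: axis_def)
    have "y $ n = (dot (?e i) y *s ?p + dot (?e j) y *s ?q) $ n" for n
    proof -
      have "n \<in> {i, j, k}" unfolding ij(1) [symmetric] by simp
      then consider "n = i" | "n = j" | "n = k" by auto
      then show ?thesis
      proof cases
        case 3
        show ?thesis unfolding 3 yk using ij(2-4) by (simp add: e)
      qed (use ij(2-4) in \<open>simp_all add: e\<close>)
    qed
    then show ?thesis unfolding vec_eq_iff by blast
  qed
  moreover have "dot l ?p = 0" "dot l ?q = 0" using k by simp_all
  ultimately show thesis by (intro that[of "?e i" ?p "?e j" ?q]) (auto simp del: dot_axis)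
qed

text \<open>The form does not change along its kernel vector \<open>x\<close>, so it is a binary form in the remaining two coordinates.\<close>

lemma singular_quadratic_splits:
  assumes H: "transpose H = H" and x: "x \<noteq> 0" "H *v x = 0"
  obtains c d where "\<And>y. dot y (H *v y) = dot c y * dot d y"
proof -
  obtain g p h q k where y: "\<And>y. y = dot g y *s p + dot h y *s q + dot k y *s x"
    using projection_along_vector[OF x(1)] by metis
  have "quadratic (\<lambda>y. dot y (H *v y))" using H unfolding quadratic_def by blast
  then obtain c d where cd: "\<And>y. dot (dot g y *s p + dot h y *s q) (H *v (dot g y *s p + dot h y *s q))
      = dot c y * dot d y"
    using quadratic_splits_on_plane[of "\<lambda>y. dot y (H *v y)" g p h q] by metis
  have "dot (y + t *s x) (H *v (y + t *s x)) = dot y (H *v y)" for y t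
    unfolding quadratic_form_add[OF H] by (simp add: vector_scalar_commute x(2))
  then have "dot y (H *v y) = dot c y * dot d y" for y
    using y[of y] cd[of y] by metis
  then show thesis by (rule that)
qed

text \<open>A common zero of the two factors is a singular point.\<close>

lemma product_form_singular:
  assumes H: "transpose H = H" and cd: "\<And>y. dot y (H *v y) = dot c y * dot d y"
  obtains x where "x \<noteq> 0" "H *v x = 0"
proof -
  obtain x where x: "x \<noteq> 0" "dot c x = 0" "dot d x = 0" by (rule common_zero)
  have "dot (H *v x) y = 0" for y
  proof -
    have "dot (y + x) (H *v (y + x)) = dot y (H *v y)" using cd x by simp
    then show ?thesis
      using quadratic_form_add[OF H, of y x] cd[of x] x by (simp add: dot_commute)
  qed
  then have "H *v x = 0" using dot_eq_0_iff by blast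
  then show thesis using that x by blast
qed

lemma quadratic_vanishing_on_plane:
  assumes "quadratic f" and f: "\<And>x. dot c x = 0 \<Longrightarrow> f x = 0"
  obtains d where "\<And>x. f x = dot c x * dot d x"
proof (cases "c = 0")
  case True
  then show thesis using f by (intro that[of 0]) simp
next
  case False
  then obtain z where z: "dot c z \<noteq> 0" using dot_eq_0_iff by blast
  define w where "w = (1 / dot c z) *s z"
  have w: "dot c w = 1" using z by (simp add: w_def)
  obtain H where H: "transpose H = H" "\<And>x. f x = dot x (H *v x)"
    using assms unfolding quadratic_def by metis
  have "f x = dot c x * dot (2 *s (H *v w) - f w *s c) x" for x
  proof -
    let ?y = "x - dot c x *s w"
    have "f x = dot (?y + dot c x *s w) (H *v (?y + dot c x *s w))" by (simp add: H)
    also have "\<dots> = f ?y + 2 * (dot c x * dot ?y (H *v w)) + (dot c x)^2 * f w"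
      unfolding quadratic_form_add[OF H(1)] by (simp add: H vector_scalar_commute power2_eq_square)
    also have "f ?y = 0" using w by (intro f) simp
    also have "dot ?y (H *v w) = dot (H *v w) x - dot c x * f w"
      by (simp add: H dot_commute)
    finally show ?thesis by (simp add: algebra_simps power2_eq_square)
  qed
  then show thesis by (rule that)
qed

text \<open>The determinant of \<open>H - t G\<close> is a cubic in \<open>t\<close> with leading coefficient \<open>- det G\<close>, so it has a root.\<close>

lemma singular_pencil_member:
  fixes H G :: "complex^3^3"
  assumes G: "\<And>x. x \<noteq> 0 \<Longrightarrow> G *v x \<noteq> 0"
  obtains t x where "x \<noteq> 0" "H *v x = t *s (G *v x)"
proof -
  have "det G \<noteq> 0" using G trivial_kernel_iff_det by blast
  define a where "a i j = [:H $ i $ j, - G $ i $ j:]" for i j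
  define P where "P = a 1 1 * a 2 2 * a 3 3 + a 1 2 * a 2 3 * a 3 1 + a 1 3 * a 2 1 * a 3 2
    - a 1 1 * a 2 3 * a 3 2 - a 1 2 * a 2 1 * a 3 3 - a 1 3 * a 2 2 * a 3 1"
  have P: "poly P t = det (\<chi> i j. H $ i $ j - t * G $ i $ j)" for t
  proof -
    have "poly (a i j) t = H $ i $ j - t * G $ i $ j" for i j by (simp add: a_def)
    then show ?thesis by (simp add: P_def det_3)
  qed
  have "coeff P 3 = - det G"
    by (simp add: P_def a_def det_3 numeral_3_eq_3 algebra_simps)
  then have "\<not> degree P < 3" using \<open>det G \<noteq> 0\<close> coeff_eq_0[of P 3] by auto
  then have "degree P \<noteq> 0" by simp
  then have "\<not> constant (poly P)" by (simp add: constant_degree)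
  then obtain t where "poly P t = 0" using fundamental_theorem_of_algebra by blast
  then have "det (\<chi> i j. H $ i $ j - t * G $ i $ j) = 0" using P by simp
  then obtain x where x: "x \<noteq> 0" "(\<chi> i j. H $ i $ j - t * G $ i $ j) *v x = 0"
    using trivial_kernel_iff_det by blast
  have "(\<chi> i j. H $ i $ j - t * G $ i $ j) *v x = H *v x - t *s (G *v x)"
    by (simp add: matrix_vector_mult_def vec_eq_iff sum_subtractf left_diff_distrib
        sum_distrib_left mult.assoc)
  then show thesis using x that by auto
qed

section \<open>Plane conics\<close>

lemma homogeneous_linform: "homogeneous 1 (linform c)"
proof -
  have "linform c = (\<Sum>i\<in>UNIV. Poly_Mapping.single (Poly_Mapping.single i 1) (c $ i))"
    by (simp add: linform_def cnst_def var_def mult_single)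
  then have "Poly_Mapping.keys (linform c)
      \<subseteq> (\<Union>i\<in>UNIV. Poly_Mapping.keys (Poly_Mapping.single (Poly_Mapping.single i 1) (c $ i)))"
    by (metis keys_sum)
  moreover have "(\<Sum>j\<in>UNIV. Poly_Mapping.lookup (Poly_Mapping.single i (1::nat)) j) = 1" for i :: 3
    by (simp add: lookup_single when_def)
  ultimately show ?thesis by (fastforce simp: homogeneous_def split: if_splits)
qed

lemma homogeneous_mult:
  assumes "homogeneous k p" "homogeneous l q"
  shows "homogeneous (k + l) (p * q)"
  unfolding homogeneous_def
proof
  fix m assume "m \<in> Poly_Mapping.keys (p * q)"
  then obtain a b where "m = a + b" "a \<in> Poly_Mapping.keys p" "b \<in> Poly_Mapping.keys q"
    using keys_mult by fast
  then show "(\<Sum>i\<in>UNIV. Poly_Mapping.lookup m i) = k + l"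
    using assms by (simp add: homogeneous_def lookup_add sum.distrib)
qed

lemma homogeneous_diff:
  assumes "homogeneous k p" "homogeneous k q"
  shows "homogeneous k (p - q)"
  using assms keys_diff[of p q] by (auto simp: homogeneous_def)

lemma eval_pol_homogeneous:
  assumes "homogeneous d p"
  shows "eval_pol p (t *s x) = t ^ d * eval_pol p x"
proof -
  have "monom_at (t *s x) m = t ^ d * monom_at x m" if "m \<in> Poly_Mapping.keys p" for m
  proof -
    have "t ^ d = (\<Prod>i\<in>UNIV. t ^ Poly_Mapping.lookup m i)"
      using assms that by (simp add: homogeneous_def flip: power_sum)
    then show ?thesis by (simp add: monom_at_def power_mult_distrib prod.distrib)
  qed
  then show ?thesis
    by (simp add: eval_pol_superset[OF _ order_refl] sum_distrib_left mult.left_commute)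
qed

lemma quadratic_monom:
  assumes "(\<Sum>i\<in>UNIV. Poly_Mapping.lookup m i) = 2"
  shows "quadratic (\<lambda>x. monom_at x m)"
proof -
  let ?l = "Poly_Mapping.lookup m"
  have eq: "monom_at x m = x $ 1 ^ ?l 1 * (x $ 2 ^ ?l 2 * x $ 3 ^ ?l 3)" for x
    unfolding monom_at_def UNIV_3 by simp
  have s: "?l 1 + ?l 2 + ?l 3 = 2" using assms unfolding sum_3 .
  have *: "quadratic (\<lambda>x. x $ i * x $ j)" for i j
    using quadratic_product[of "axis i 1" "axis j 1"] by simp
  have digit_sum: "(a = 2 \<and> b = 0 \<and> c = 0) \<or> (a = 0 \<and> b = 2 \<and> c = 0) \<or> (a = 0 \<and> b = 0 \<and> c = 2)
    \<or> (a = 1 \<and> b = 1 \<and> c = 0) \<or> (a = 1 \<and> b = 0 \<and> c = 1) \<or> (a = 0 \<and> b = 1 \<and> c = 1)"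
    if "a + b + c = 2" for a b c :: nat
    using that by presburger
  obtain i j where "monom_at x m = x $ i * x $ j" for x
    using digit_sum[OF s] unfolding eq
    by (elim disjE conjE) (simp_all add: power2_eq_square)
  then show ?thesis using * by simp
qed

lemma quadratic_homogeneous:
  assumes "homogeneous 2 q"
  shows "quadratic (eval_pol q)"
proof -
  have "quadratic (\<lambda>x. \<Sum>m\<in>Poly_Mapping.keys q. Poly_Mapping.lookup q m * monom_at x m)"
    using assms by (intro quadratic_sum quadratic_scale quadratic_monom) (auto simp: homogeneous_def)
  moreover have "eval_pol q = (\<lambda>x. \<Sum>m\<in>Poly_Mapping.keys q. Poly_Mapping.lookup q m * monom_at x m)"
    by (auto simp: eval_pol_def monom_at_def)
  ultimately show ?thesis by simp
qed

text \<open>The formal derivative is the analytic one; this gives the gradient of a quadratic form without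
looking at its monomials.\<close>

lemma eval_pol_has_partial_deriv:
  "((\<lambda>t. eval_pol p (x + t *s axis i 1)) has_field_derivative eval_pol (partial_deriv i p) x) (at 0)"
proof -
  let ?l = Poly_Mapping.lookup
  have m: "((\<lambda>t. monom_at (x + t *s axis i 1) m) has_field_derivative
      of_nat (?l m i) * monom_at x (m - Poly_Mapping.single i 1)) (at 0)" for m
  proof -
    have 1: "monom_at y n = y $ i ^ ?l n i * (\<Prod>j\<in>UNIV - {i}. y $ j ^ ?l n j)" for y n
      unfolding monom_at_def by (rule prod.remove) auto
    have 2: "monom_at (x + t *s axis i 1) m = (x $ i + t) ^ ?l m i * (\<Prod>j\<in>UNIV - {i}. x $ j ^ ?l m j)"
      for t unfolding 1[of _ m] by (simp add: axis_def)
    have 3: "monom_at x (m - Poly_Mapping.single i 1)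
        = x $ i ^ (?l m i - 1) * (\<Prod>j\<in>UNIV - {i}. x $ j ^ ?l m j)"
      unfolding 1[of _ "m - Poly_Mapping.single i 1"]
      by (simp add: lookup_minus lookup_single when_def)
    show ?thesis unfolding 2 3
      by (rule derivative_eq_intros refl | simp)+
  qed
  have "eval_pol (partial_deriv i p) x = (\<Sum>m\<in>Poly_Mapping.keys p.
      ?l p m * (of_nat (?l m i) * monom_at x (m - Poly_Mapping.single i 1)))"
    by (simp add: partial_deriv_def eval_pol_single mult_ac)
  moreover have "((\<lambda>t. \<Sum>m\<in>Poly_Mapping.keys p. ?l p m * monom_at (x + t *s axis i 1) m) has_field_derivative
    (\<Sum>m\<in>Poly_Mapping.keys p. ?l p m * (of_nat (?l m i) * monom_at x (m - Poly_Mapping.single i 1)))) (at 0)"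
    by (intro DERIV_sum DERIV_cmult m)
  ultimately show ?thesis
    by (simp add: eval_pol_superset[OF _ order_refl, of p])
qed

lemma partial_deriv_quadratic:
  assumes H: "transpose H = H" and q: "\<And>x. eval_pol q x = dot x (H *v x)"
  shows "eval_pol (partial_deriv i q) x = 2 * (H *v x) $ i"
proof -
  have "eval_pol q (x + t *s axis i 1)
      = eval_pol q x + 2 * t * (H *v x) $ i + t\<^sup>2 * eval_pol q (axis i 1)" for t
    unfolding q quadratic_form_add[OF H]
    by (simp add: vector_scalar_commute dot_matrix_sym[OF H, of x "axis i 1"] power2_eq_square)
  moreover have "((\<lambda>t. eval_pol q x + 2 * t * (H *v x) $ i + t\<^sup>2 * eval_pol q (axis i 1))
      has_field_derivative 2 * (H *v x) $ i) (at 0)"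
    by (rule derivative_eq_intros refl | simp)+
  ultimately show ?thesis
    using eval_pol_has_partial_deriv[of q x i] DERIV_unique by fastforce
qed

lemma smooth_curve_iff:
  assumes H: "transpose H = H" and q: "\<And>x. eval_pol q x = dot x (H *v x)"
  shows "smooth_curve q \<longleftrightarrow> (\<forall>x. x \<noteq> 0 \<longrightarrow> H *v x \<noteq> 0)"
proof -
  have "(\<exists>i. 2 * (H *v x) $ i \<noteq> 0) \<longleftrightarrow> H *v x \<noteq> 0" for x
    by (auto simp: vec_eq_iff)
  then show ?thesis
    unfolding smooth_curve_def partial_deriv_quadratic[OF H q] q by (metis dot_0_right)
qed

text \<open>A singular point is a vector in the kernel of the symmetric matrix.\<close>

lemma not_smooth_iff_product:
  assumes "quadratic (eval_pol q)"
  shows "\<not> smooth_curve q \<longleftrightarrow> (\<exists>c d. q = linform c * linform d)"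
proof -
  obtain H where H: "transpose H = H" "\<And>x. eval_pol q x = dot x (H *v x)"
    using assms unfolding quadratic_def by metis
  show ?thesis
  proof
    assume "\<not> smooth_curve q"
    then obtain x where "x \<noteq> 0" "H *v x = 0" by (auto simp: smooth_curve_iff[OF H])
    then obtain c d where "\<And>y. dot y (H *v y) = dot c y * dot d y"
      using singular_quadratic_splits[OF H(1)] by metis
    then have "q = linform c * linform d" by (intro pol_eqI) (simp add: H)
    then show "\<exists>c d. q = linform c * linform d" by blast
  next
    assume "\<exists>c d. q = linform c * linform d"
    then obtain c d where "q = linform c * linform d" by blast
    then have "\<And>y. dot y (H *v y) = dot c y * dot d y" using H(2) by (metis eval_pol_linform eval_pol_mult)
    then obtain x where "x \<noteq> 0" "H *v x = 0"
      using product_form_singular[OF H(1)] by metis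
    then show "\<not> smooth_curve q" by (auto simp: smooth_curve_iff[OF H])
  qed
qed

text \<open>Divisibility gives some polynomial cofactor; that a linear form will do comes from the factorisation of a quadratic
form that vanishes on a plane.\<close>

lemma linform_dvd_quadratic:
  assumes "quadratic (eval_pol q)" "linform c dvd q"
  obtains d where "q = linform c * linform d"
proof -
  have "\<And>x. dot c x = 0 \<Longrightarrow> eval_pol q x = 0"
    using assms(2) unfolding linform_dvd_iff by simp
  then obtain d where "\<And>x. eval_pol q x = dot c x * dot d x"
    using quadratic_vanishing_on_plane[OF assms(1)] by metis
  then have "q = linform c * linform d" by (intro pol_eqI) simp
  then show thesis by (rule that)
qed

lemma smooth_not_linform_dvd:
  assumes "quadratic (eval_pol q)" "smooth_curve q"
  shows "\<not> linform c dvd q"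
  using assms not_smooth_iff_product linform_dvd_quadratic by metis

text \<open>Since the matrix of \<open>q\<close> is invertible, the pencil of symmetric matrices has a singular member.\<close>

lemma quadratic_pencil:
  assumes p: "quadratic (eval_pol p)" and q: "quadratic (eval_pol q)" "smooth_curve q"
  obtains t c d where "p - cnst t * q = linform c * linform d"
proof -
  obtain H where H: "transpose H = H" "\<And>x. eval_pol p x = dot x (H *v x)"
    using p unfolding quadratic_def by metis
  obtain G where G: "transpose G = G" "\<And>x. eval_pol q x = dot x (G *v x)"
    using q(1) unfolding quadratic_def by metis
  have "\<And>x. x \<noteq> 0 \<Longrightarrow> G *v x \<noteq> 0" using q(2) smooth_curve_iff[OF G] by simp
  then obtain t x where tx: "x \<noteq> 0" "H *v x = t *s (G *v x)"
    using singular_pencil_member[of G H] by metis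
  let ?r = "p - cnst t * q"
  define F where "F = (\<chi> i j. H $ i $ j - t * G $ i $ j)"
  have Fv: "F *v x = H *v x - t *s (G *v x)" for x
    by (simp add: F_def matrix_vector_mult_def vec_eq_iff sum_subtractf left_diff_distrib
        sum_distrib_left mult.assoc)
  have "transpose F = F"
    using symmetric_matrix_component[OF H(1)] symmetric_matrix_component[OF G(1)]
    by (simp add: F_def transpose_def vec_eq_iff)
  moreover have "eval_pol ?r x = dot x (F *v x)" for x
    by (simp add: Fv H G)
  ultimately have F: "quadratic (eval_pol ?r)" "\<not> smooth_curve ?r"
    using tx Fv[of x] smooth_curve_iff[of F ?r] unfolding quadratic_def by auto
  then show thesis using not_smooth_iff_product that by blast
qed

section \<open>Subspaces of three-space, saturation and zero sets\<close>

lemma three_vectors_span: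
  fixes p q r :: "complex^3"
  assumes "\<And>\<alpha> \<beta> \<gamma>. \<alpha> *s p + \<beta> *s q + \<gamma> *s r = 0 \<Longrightarrow> \<alpha> = 0 \<and> \<beta> = 0 \<and> \<gamma> = 0"
  obtains \<alpha> \<beta> \<gamma> where "y = \<alpha> *s p + \<beta> *s q + \<gamma> *s r"
proof -
  define A :: "complex^3^3" where "A = (\<chi> i j. (if j = 1 then p else if j = 2 then q else r) $ i)"
  have A: "A *v x = x $ 1 *s p + x $ 2 *s q + x $ 3 *s r" for x
    by (simp add: A_def matrix_vector_mult_def vec_eq_iff sum_3 mult.commute)
  have "\<forall>x. A *v x = 0 \<longrightarrow> x = 0"
  proof (intro allI impI)
    fix x assume "A *v x = 0"
    then have "x $ 1 = 0 \<and> x $ 2 = 0 \<and> x $ 3 = 0" using assms unfolding A by blast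
    then show "x = 0" by (simp add: vec_eq_iff forall_3)
  qed
  then have "invertible A" by (simp add: trivial_kernel_iff_det invertible_det_nz)
  then have "surj ((*v) A)"
    by (simp add: invertible_right_inverse matrix_right_invertible_surjective)
  then obtain x where "y = A *v x" by (metis surj_def)
  then show thesis using that A by blast
qed

lemma subspace_line: "vec.subspace (range (\<lambda>k. k *s p))"
proof -
  have "range (\<lambda>k. k *s p) = vec.span {p}" by (simp add: vec.span_singleton)
  then show ?thesis by simp
qed

text \<open>The case distinction behind the list of types.\<close>

lemma subspace_of_three_space_cases:
  assumes S: "vec.subspace (S :: (complex^3) set)"
  obtains (zero) "S = {0}"
    | (line) p where "p \<noteq> 0" "S = range (\<lambda>k. k *s p)"
    | (plane) c where "c \<noteq> 0" "S = {x. dot c x = 0}"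
    | (whole) "S = UNIV"
proof (cases "S = {0}")
  case False
  then obtain p where p: "p \<in> S" "p \<noteq> 0" using vec.subspace_0[OF S] by blast
  show thesis
  proof (cases "S \<subseteq> range (\<lambda>k. k *s p)")
    case True
    then have "S = range (\<lambda>k. k *s p)" using p vec.subspace_scale[OF S] by blast
    then show thesis using line p by blast
  next
    case False
    then obtain q where q: "q \<in> S" "q \<notin> range (\<lambda>k. k *s p)" by blast
    have indep: "\<alpha> = 0 \<and> \<beta> = 0" if "\<alpha> *s p + \<beta> *s q = 0" for \<alpha> \<beta>
    proof -
      have "\<beta> = 0"
      proof (rule ccontr)
        assume "\<beta> \<noteq> 0"
        have "\<beta> *s q = - \<alpha> *s p"
          using that by (metis add.commute add_eq_0_iff vec.scale_minus_left)
        then have "(1 / \<beta>) *s (\<beta> *s q) = (1 / \<beta>) *s (- \<alpha> *s p)" by simp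
        then have "q = (- \<alpha> / \<beta>) *s p" using \<open>\<beta> \<noteq> 0\<close> by simp
        then show False using q(2) by blast
      qed
      then show ?thesis using that p(2) by simp
    qed
    obtain c where c: "c \<noteq> 0" "dot c p = 0" "dot c q = 0"
      using common_zero[of p q] by (metis dot_commute)
    have y: "\<exists>\<alpha> \<beta> \<gamma>. y = \<alpha> *s p + \<beta> *s q + \<gamma> *s r" if "dot c r \<noteq> 0" for y r
    proof -
      have "\<alpha> = 0 \<and> \<beta> = 0 \<and> \<gamma> = 0" if z: "\<alpha> *s p + \<beta> *s q + \<gamma> *s r = 0" for \<alpha> \<beta> \<gamma>
      proof -
        have "dot c (\<alpha> *s p + \<beta> *s q + \<gamma> *s r) = 0" unfolding z by simp
        then have "\<gamma> = 0" using c \<open>dot c r \<noteq> 0\<close> by simp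
        then show ?thesis using z indep[of \<alpha> \<beta>] by simp
      qed
      then show ?thesis using three_vectors_span[of p q r y] by metis
    qed
    have comb: "\<alpha> *s p + \<beta> *s q \<in> S" for \<alpha> \<beta>
      using p q S by (simp add: vec.subspace_add vec.subspace_scale)
    show thesis
    proof (cases "S \<subseteq> {x. dot c x = 0}")
      case True
      have "y \<in> S" if "dot c y = 0" for y
      proof -
        obtain r where r: "dot c r \<noteq> 0" using c(1) dot_eq_0_iff by blast
        obtain \<alpha> \<beta> \<gamma> where yy: "y = \<alpha> *s p + \<beta> *s q + \<gamma> *s r" using y[OF r] by blast
        have "\<gamma> = 0" using that r c unfolding yy by simp
        then show ?thesis using comb yy by simp
      qed
      then have "S = {x. dot c x = 0}" using True by blast
      then show thesis using plane c(1) by blast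
    next
      case False
      then obtain r where r: "r \<in> S" "dot c r \<noteq> 0" by blast
      have "y \<in> S" for y
      proof -
        obtain \<alpha> \<beta> \<gamma> where yy: "y = \<alpha> *s p + \<beta> *s q + \<gamma> *s r" using y[OF r(2)] by blast
        then show ?thesis
          using comb r(1) S by (simp add: vec.subspace_add vec.subspace_scale)
      qed
      then show thesis using whole by blast
    qed
  qed
qed (rule zero)

lemma subspace_annihilator: "vec.subspace {x. \<forall>d\<in>D. dot d x = 0}"
  by (auto simp: vec.subspace_def)

text \<open>A form outside the span of \<open>D\<close> is separated from it by a point; the shape of that point depends on the
dimension of the span.\<close>

lemma double_annihilator:
  assumes c: "\<And>x. (\<And>d. d \<in> D \<Longrightarrow> dot d x = 0) \<Longrightarrow> dot c x = 0"
  shows "c \<in> vec.span D"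
proof (rule ccontr)
  assume n: "c \<notin> vec.span D"
  have D: "d \<in> vec.span D" if "d \<in> D" for d using that by (rule vec.span_base)
  have "vec.subspace (vec.span D)" by simp
  then show False
  proof (cases rule: subspace_of_three_space_cases)
    case zero
    then have "dot d x = 0" if "d \<in> D" for d x using D[OF that] by simp
    then have "\<forall>x. dot c x = 0" using c by blast
    then show False using n dot_eq_0_iff vec.span_zero by metis
  next
    case (line p)
    have "dot c x = 0" if "dot p x = 0" for x
    proof (rule c)
      fix d assume "d \<in> D"
      then obtain k where "d = k *s p" using D line by blast
      then show "dot d x = 0" using that by simp
    qed
    then obtain k where "c = k *s p" using dot_zero_on_ker_multiple by metis
    then show False using n line by blast
  next
    case (plane a)
    then have "dot d a = 0" if "d \<in> D" for d using D[OF that] by (simp add: dot_commute)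
    then have "dot c a = 0" by (rule c)
    then show False using n plane by (simp add: dot_commute)
  next
    case whole
    then show False using n by simp
  qed
qed

lemma linform_in_span:
  assumes "c \<in> vec.span D"
  shows "linform c \<in> ideal.span (linform ` D)"
  using assms
proof (induction rule: vec.span_induct_alt)
  case base
  then show ?case by (simp add: ideal.span_zero)
next
  case (step k x y)
  then have "linform x \<in> ideal.span (linform ` D)" by (intro ideal.span_base) auto
  then show ?case
    using step by (simp add: linform_add linform_smult ideal.span_add ideal.span_scale)
qed

text \<open>Ideals generated by arbitrary linear forms are vanishing ideals, so a single family of ideals covers all
cofactors of a common factor of the minors.\<close>

lemma span_linforms_eq_vanishing:
  "ideal.span (linform ` D) = vanishing {x. \<forall>d\<in>D. dot d x = 0}"
proof
  show "ideal.span (linform ` D) \<subseteq> vanishing {x. \<forall>d\<in>D. dot d x = 0}"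
    by (rule ideal.span_minimal[OF _ subspace_vanishing]) (auto simp: vanishing_def)
  show "vanishing {x. \<forall>d\<in>D. dot d x = 0} \<subseteq> ideal.span (linform ` D)"
    unfolding vanishing_subspace[OF subspace_annihilator]
    by (rule ideal.span_minimal) (auto intro!: linform_in_span double_annihilator)
qed

lemma span_times:
  "ideal.span ((*) u ` G) = (*) u ` ideal.span G" for u :: pol
proof
  have "ideal.subspace ((*) u ` ideal.span G)"
    unfolding ideal.subspace_def
  proof (intro conjI ballI allI)
    show "0 \<in> (*) u ` ideal.span G" using ideal.span_zero by force
    fix f g assume "f \<in> (*) u ` ideal.span G" "g \<in> (*) u ` ideal.span G"
    then obtain f' g' where "f = u * f'" "g = u * g'" "f' \<in> ideal.span G" "g' \<in> ideal.span G"
      by blast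
    then have "f + g = u * (f' + g')" "f' + g' \<in> ideal.span G"
      by (simp_all add: distrib_left ideal.span_add)
    then show "f + g \<in> (*) u ` ideal.span G" by blast
  next
    fix c f assume "f \<in> (*) u ` ideal.span G"
    then obtain g where "g \<in> ideal.span G" "f = u * g" by blast
    then have "c * f = u * (c * g)" "c * g \<in> ideal.span G"
      by (simp_all add: mult.left_commute ideal.span_scale)
    then show "c * f \<in> (*) u ` ideal.span G" by blast
  qed
  then show "ideal.span ((*) u ` G) \<subseteq> (*) u ` ideal.span G"
    by (intro ideal.span_minimal) (auto intro: ideal.span_base)
  have "u * g \<in> ideal.span ((*) u ` G)" if "g \<in> ideal.span G" for g
    using that
  proof (induction rule: ideal.span_induct_alt)
    case base
    then show ?case by (simp add: ideal.span_zero)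
  next
    case (step c x y)
    have "u * x \<in> ideal.span ((*) u ` G)" using step by (intro ideal.span_base) auto
    then have "c * (u * x) + u * y \<in> ideal.span ((*) u ` G)"
      using step.IH ideal.span_scale by (blast intro: ideal.span_add)
    then show ?case by (simp add: distrib_left mult.left_commute)
  qed
  then show "(*) u ` ideal.span G \<subseteq> ideal.span ((*) u ` G)" by blast
qed

lemma axis_neq_0: "(axis i 1 :: complex^3) \<noteq> 0"
  by (simp add: axis_eq_0_iff)

lemma var_not_dvd:
  assumes "u \<noteq> 0"
  obtains i where "\<not> linform u dvd var i"
proof -
  obtain x where "x \<noteq> 0" "dot u x = 0" using common_zero by blast
  moreover from this obtain i where "x $ i \<noteq> 0" by (auto simp: vec_eq_iff)
  ultimately show thesis by (intro that[of i]) (auto simp: linform_dvd_iff)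
qed

lemma linform_dvd_power_mult:
  assumes "linform u dvd g ^ n * f" "\<not> linform u dvd g"
  shows "linform u dvd f"
  using assms(1)
proof (induction n)
  case (Suc n)
  then have "linform u dvd g * (g ^ n * f)" by (simp add: mult.assoc)
  then show ?case using Suc.IH linform_prime assms(2) by blast
qed simp

lemma dvd_cancel_linform_power:
  assumes "q dvd linform u ^ n * f" "\<not> linform u dvd q" "u \<noteq> 0"
  shows "q dvd f"
  using assms(1)
proof (induction n)
  case (Suc n)
  then obtain g where g: "linform u * (linform u ^ n * f) = q * g" by (auto simp: mult.assoc)
  then have "linform u dvd q * g" by (metis dvd_triv_left)
  then have "linform u dvd g" using linform_prime assms(2) by blast
  then obtain h where "g = linform u * h" by blast
  then have "linform u * (linform u ^ n * f) = linform u * (q * h)" using g by (simp add: mult.left_commute)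
  then have "linform u ^ n * f = q * h" using assms(3) by simp
  then show ?case using Suc.IH by simp
qed simp

lemma subset_saturation: "I \<subseteq> saturation I"
  by (auto simp: saturation_def intro: exI[of _ 0])

text \<open>If a power of a variable times \<open>f\<close> lies in \<open>(q)\<close>, the variable, being prime and not a factor of \<open>q\<close>, can be
cancelled.\<close>

lemma saturation_principal:
  assumes "\<And>c. c \<noteq> 0 \<Longrightarrow> \<not> linform c dvd q"
  shows "saturation (ideal.span {q}) = ideal.span {q}"
proof
  show "saturation (ideal.span {q}) \<subseteq> ideal.span {q}"
  proof
    fix f assume "f \<in> saturation (ideal.span {q})"
    then obtain n where "q dvd var 1 ^ n * f" by (auto simp: saturation_def in_span_single)
    then have "q dvd f"
      unfolding var_eq_linform using assms dvd_cancel_linform_power axis_neq_0 by blast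
    then show "f \<in> ideal.span {q}" by (simp add: in_span_single)
  qed
qed (rule subset_saturation)

text \<open>The factor \<open>u\<close> splits off because some variable is not divisible by \<open>u\<close>; the cofactor lies in the
vanishing ideal because some variable does not vanish on \<open>S\<close>, and that ideal is prime.\<close>

lemma saturation_linform_times_vanishing:
  assumes u: "u \<noteq> 0" and S: "vec.subspace S" "S \<noteq> {0}"
  shows "saturation ((*) (linform u) ` vanishing S) = (*) (linform u) ` vanishing S"
proof
  show "saturation ((*) (linform u) ` vanishing S) \<subseteq> (*) (linform u) ` vanishing S"
  proof
    fix f assume f: "f \<in> saturation ((*) (linform u) ` vanishing S)"
    \<comment> \<open>Some variable is prime to \<open>u\<close>, so \<open>u\<close> divides \<open>f\<close>.\<close>
    obtain i where i: "\<not> linform u dvd var i" using var_not_dvd[OF u] .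
    obtain n h where "var i ^ n * f = linform u * h"
      using f unfolding saturation_def by blast
    then have "linform u dvd var i ^ n * f" by simp
    then have "linform u dvd f" using i linform_dvd_power_mult by blast
    then obtain g where g: "f = linform u * g" by blast
    obtain x where x: "x \<in> S" "x \<noteq> 0" using S vec.subspace_0 by blast
    then obtain j where j: "x $ j \<noteq> 0" by (auto simp: vec_eq_iff)
    obtain n h where h: "var j ^ n * f = linform u * h" "h \<in> vanishing S"
      using f unfolding saturation_def by blast
    have "linform u * (var j ^ n * g) = linform u * h"
      using h(1) g by (simp add: mult.left_commute)
    then have "var j ^ n * g \<in> vanishing S" using u h(2) by simp
    moreover have "var j ^ n \<notin> vanishing S" using x j by (auto simp: vanishing_def)
    ultimately have "g \<in> vanishing S" using vanishing_prime[OF S(1)] by blast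
    then show "f \<in> (*) (linform u) ` vanishing S" using g by blast
  qed
qed (rule subset_saturation)

text \<open>The vanishing ideal of the origin is the irrelevant ideal, which saturation removes.\<close>

lemma saturation_linform_times_irrelevant:
  assumes u: "u \<noteq> 0"
  shows "saturation ((*) (linform u) ` vanishing {0}) = ideal.span {linform u}"
proof
  show "saturation ((*) (linform u) ` vanishing {0}) \<subseteq> ideal.span {linform u}"
  proof
    fix f assume f: "f \<in> saturation ((*) (linform u) ` vanishing {0})"
    obtain i where i: "\<not> linform u dvd var i" using var_not_dvd[OF u] .
    obtain n h where "var i ^ n * f = linform u * h"
      using f unfolding saturation_def by blast
    then have "linform u dvd var i ^ n * f" by simp
    then have "linform u dvd f" using i linform_dvd_power_mult by blast
    then show "f \<in> ideal.span {linform u}" by (simp add: in_span_single)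
  qed
  show "ideal.span {linform u} \<subseteq> saturation ((*) (linform u) ` vanishing {0})"
  proof
    fix f assume "f \<in> ideal.span {linform u}"
    then obtain g where "f = linform u * g" by (auto simp: in_span_single)
    then have "var i ^ 1 * f = linform u * (var i * g)" "var i * g \<in> vanishing {0}" for i
      by (simp_all add: vanishing_def mult.left_commute)
    then show "f \<in> saturation ((*) (linform u) ` vanishing {0})"
      unfolding saturation_def by blast
  qed
qed

text \<open>As \<open>u\<close> is not in the prime ideal \<open>I(S)\<close>, the cofactor of a multiple of \<open>u\<close> in \<open>I(S)\<close> is in \<open>I(S)\<close>.\<close>

lemma linform_times_vanishing:
  assumes S: "vec.subspace S" and u: "x \<in> S" "dot u x \<noteq> 0"
  shows "(*) (linform u) ` vanishing S = vanishing {x. dot u x = 0} \<inter> vanishing S"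
proof
  show "vanishing {x. dot u x = 0} \<inter> vanishing S \<subseteq> (*) (linform u) ` vanishing S"
  proof
    fix f assume f: "f \<in> vanishing {x. dot u x = 0} \<inter> vanishing S"
    then obtain g where g: "f = linform u * g" by (auto simp: vanishing_ker in_span_single)
    have "linform u \<notin> vanishing S" using u by (auto simp: vanishing_def)
    then have "g \<in> vanishing S" using vanishing_prime[OF S] f g by blast
    then show "f \<in> (*) (linform u) ` vanishing S" using g by blast
  qed
qed (auto simp: vanishing_def)

definition zeros :: "pol set \<Rightarrow> (complex^3) set"
  where "zeros I = {x. \<forall>f\<in>I. eval_pol f x = 0}"

lemma not_in_subspace_separated:
  assumes "vec.subspace S" "x \<notin> S"
  obtains c where "linform c \<in> vanishing S" "dot c x \<noteq> 0"
proof -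
  obtain p where p: "\<And>x. (\<chi> i. dot (p i) x) \<in> S" "\<And>x. x \<in> S \<Longrightarrow> (\<chi> i. dot (p i) x) = x"
    using projection_onto_subspace[OF assms(1)] by metis
  have "(\<chi> i. dot (p i) x) \<noteq> x" using p(1)[of x] assms(2) by auto
  then obtain i where i: "dot (p i) x \<noteq> x $ i" by (auto simp: vec_eq_iff)
  have "dot (axis i 1 - p i) y = 0" if "y \<in> S" for y
    using p(2)[OF that] by (auto simp: vec_eq_iff)
  then show thesis
    using i by (intro that[of "axis i 1 - p i"]) (auto simp: vanishing_def)
qed

lemma zeros_vanishing_Un:
  assumes "vec.subspace S" "vec.subspace T"
  shows "zeros (vanishing S \<inter> vanishing T) = S \<union> T"
proof
  show "zeros (vanishing S \<inter> vanishing T) \<subseteq> S \<union> T"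
  proof (rule ccontr)
    assume "\<not> ?thesis"
    then obtain x where x: "x \<in> zeros (vanishing S \<inter> vanishing T)" "x \<notin> S" "x \<notin> T" by blast
    obtain c d where "linform c \<in> vanishing S" "dot c x \<noteq> 0" "linform d \<in> vanishing T" "dot d x \<noteq> 0"
      using not_in_subspace_separated assms x by metis
    then have "linform c * linform d \<in> vanishing S \<inter> vanishing T" "dot c x * dot d x \<noteq> 0"
      by (auto simp: vanishing_def)
    then show False using x(1) by (force simp: zeros_def)
  qed
qed (auto simp: zeros_def vanishing_def)

lemma zeros_vanishing:
  assumes "vec.subspace S"
  shows "zeros (vanishing S) = S"
  using zeros_vanishing_Un[OF assms assms] by simp

lemma zeros_span: "zeros (ideal.span G) = {x. \<forall>g\<in>G. eval_pol g x = 0}"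
proof
  show "{x. \<forall>g\<in>G. eval_pol g x = 0} \<subseteq> zeros (ideal.span G)"
  proof
    fix x assume "x \<in> {x. \<forall>g\<in>G. eval_pol g x = 0}"
    then have "ideal.span G \<subseteq> vanishing {x}"
      by (intro ideal.span_minimal subspace_vanishing) (auto simp: vanishing_def)
    then show "x \<in> zeros (ideal.span G)" by (auto simp: zeros_def vanishing_def)
  qed
qed (auto simp: zeros_def intro: ideal.span_base)

section \<open>Matrices of rank at most one and coordinates on the plane\<close>

definition coef :: "(3 \<Rightarrow> complex^'b^'a) \<Rightarrow> 'a \<Rightarrow> 'b \<Rightarrow> complex^3"
  where "coef e i j = (\<chi> k. e k $ i $ j)"

definition minor_at :: "complex^'b^'a \<Rightarrow> 'a \<Rightarrow> 'a \<Rightarrow> 'b \<Rightarrow> 'b \<Rightarrow> complex"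
  where "minor_at M i i' j j' = M $ i $ j * M $ i' $ j' - M $ i $ j' * M $ i' $ j"

definition rank_le_1 :: "complex^'b^'a \<Rightarrow> bool"
  where "rank_le_1 M \<longleftrightarrow> (\<forall>i i' j j'. minor_at M i i' j j' = 0)"

definition minor_pol :: "(3 \<Rightarrow> complex^'b^'a) \<Rightarrow> 'a \<Rightarrow> 'a \<Rightarrow> 'b \<Rightarrow> 'b \<Rightarrow> pol"
  where "minor_pol e i i' j j' =
    linform (coef e i j) * linform (coef e i' j') - linform (coef e i j') * linform (coef e i' j)"

lemma generic_entry_eq_linform: "generic_entry e i j = linform (coef e i j)"
  by (simp add: generic_entry_def linform_def coef_def)

lemma pt_component: "pt e x $ i $ j = dot (coef e i j) x"
  by (simp add: pt_def dot_def coef_def mscale_def mult.commute)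

lemma minors_eq: "minors e = {minor_pol e i i' j j' | i i' j j'. i \<noteq> i' \<and> j \<noteq> j'}"
  by (simp add: minors_def minor_pol_def generic_entry_eq_linform)

text \<open>Lets the index restrictions in the set of minors be ignored.\<close>

lemma minor_pol_degenerate: "i = i' \<or> j = j' \<Longrightarrow> minor_pol e i i' j j' = 0"
  by (auto simp: minor_pol_def mult.commute)

lemma minors_cases:
  obtains "minor_pol e i i' j j' = 0" | "minor_pol e i i' j j' \<in> minors e"
  using minor_pol_degenerate[of i i' j j' e] unfolding minors_eq by blast

lemma minorsE:
  assumes "m \<in> minors e" obtains i i' j j' where "m = minor_pol e i i' j j'"
  using assms unfolding minors_eq by blast

lemma eval_minor_pol: "eval_pol (minor_pol e i i' j j') x = minor_at (pt e x) i i' j j'"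
  by (simp add: minor_pol_def minor_at_def pt_component)

lemma quadratic_minor:
  assumes "m \<in> minors e" shows "quadratic (eval_pol m)"
proof -
  obtain i i' j j' where m: "m = minor_pol e i i' j j'" using assms by (rule minorsE)
  have "eval_pol m = (\<lambda>x. dot (coef e i j) x * dot (coef e i' j') x
      - dot (coef e i j') x * dot (coef e i' j) x)"
    by (simp add: m minor_pol_def fun_eq_iff)
  then show ?thesis using quadratic_diff quadratic_product by metis
qed

lemma homogeneous_minor:
  assumes "m \<in> minors e" shows "homogeneous 2 m"
proof -
  obtain i i' j j' where "m = minor_pol e i i' j j'" using assms by (rule minorsE)
  moreover have "homogeneous (1 + 1) (linform c * linform d)" for c d
    by (intro homogeneous_mult homogeneous_linform)
  ultimately show ?thesis by (simp only: minor_pol_def one_add_one homogeneous_diff)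
qed

lemma rank_le_1_iff_minors: "rank_le_1 (pt e x) \<longleftrightarrow> (\<forall>m\<in>minors e. eval_pol m x = 0)"
proof
  assume "rank_le_1 (pt e x)"
  then show "\<forall>m\<in>minors e. eval_pol m x = 0"
    by (auto simp: rank_le_1_def eval_minor_pol elim!: minorsE)
next
  assume m: "\<forall>m\<in>minors e. eval_pol m x = 0"
  have "eval_pol (minor_pol e i i' j j') x = 0" for i i' j j'
    by (rule minors_cases[of e i i' j j']) (use m in auto)
  then show "rank_le_1 (pt e x)" by (simp add: rank_le_1_def eval_minor_pol)
qed

lemma outer_component [simp]: "outer x y $ i $ j = x $ i * y $ j"
  by (simp add: outer_def)

lemma rank_le_1_outer [simp]: "rank_le_1 (outer x y)"
  by (simp add: rank_le_1_def minor_at_def)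

lemma rank_le_1E:
  assumes "rank_le_1 M"
  obtains x y where "M = outer x y"
proof (cases "M = 0")
  case True
  then have "M = outer 0 0" by (simp add: outer_def vec_eq_iff)
  then show thesis by (rule that)
next
  case False
  then obtain i j where ij: "M $ i $ j \<noteq> 0" by (auto simp: vec_eq_iff)
  have "M $ k $ l = M $ k $ j * (M $ i $ l / M $ i $ j)" for k l
    using assms[unfolded rank_le_1_def minor_at_def, rule_format, of i j k l] ij
    by (simp add: field_simps)
  then have "M = outer (\<chi> k. M $ k $ j) (\<chi> l. M $ i $ l / M $ i $ j)"
    unfolding vec_eq_iff outer_component vec_lambda_beta by blast
  then show thesis by (rule that)
qed

lemma outer_eq_0_iff: "outer x y = 0 \<longleftrightarrow> x = 0 \<or> y = 0"
  by (auto simp: vec_eq_iff)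

lemma outer_add_right: "outer x (y + z) = outer x y + outer x z"
  and outer_smult_right: "outer x (k *s y) = mscale k (outer x y)"
  and outer_0_right: "outer x 0 = 0"
  and outer_add_left: "outer (x + w) y = outer x y + outer w y"
  and outer_smult_left: "outer (k *s x) y = mscale k (outer x y)"
  and outer_0_left: "outer 0 y = 0"
  by (simp_all add: vec_eq_iff mscale_def algebra_simps)

lemma transpose_component [simp]: "transpose M $ i $ j = M $ j $ i"
  by (simp add: transpose_def)

lemma transpose_outer: "transpose (outer x y) = outer y x"
  by (simp add: vec_eq_iff mult.commute)

lemma rank_le_1_transpose [simp]: "rank_le_1 (transpose M) \<longleftrightarrow> rank_le_1 M"
  unfolding rank_le_1_def minor_at_def transpose_component by (metis mult.commute)

lemma pt_transpose: "pt (\<lambda>k. transpose (e k)) x = transpose (pt e x)"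
  by (simp add: vec_eq_iff pt_component coef_def)

lemma rank_rank_le_1:
  assumes "rank_le_1 M" "M \<noteq> 0"
  shows "rank M = 1"
proof -
  obtain x y where M: "M = outer x y" using assms(1) by (rule rank_le_1E)
  then have xy: "x \<noteq> 0" "y \<noteq> 0" using assms(2) by (auto simp: outer_eq_0_iff)
  have row: "row i M = x $ i *s y" for i by (simp add: M row_def vec_eq_iff)
  obtain i where i: "x $ i \<noteq> 0" using xy by (auto simp: vec_eq_iff)
  have "rows M \<subseteq> vec.span {y}" by (auto simp: rows_def row vec.span_singleton)
  moreover have "{y} \<subseteq> vec.span (rows M)"
  proof -
    have "(1 / x $ i) *s row i M \<in> vec.span (rows M)"
      by (intro vec.span_scale vec.span_base) (auto simp: rows_def)
    then show ?thesis using i by (simp add: row)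
  qed
  ultimately have "vec.span (rows M) = vec.span {y}" unfolding vec.span_eq by blast
  then have "vec.dim (rows M) = vec.dim {y}" by (metis vec.dim_span)
  also have "\<dots> = 1" using xy by (simp add: vec.dim_singleton)
  finally show ?thesis by (simp add: row_rank_def_gen)
qed

lemma in_SegreI: "(\<And>M. M \<in> W \<Longrightarrow> rank_le_1 M) \<Longrightarrow> in_Segre W"
  by (simp add: in_Segre_def rank_rank_le_1)

lemma proportional_of_outer_eq:
  assumes "outer x z = outer x' z'" "outer x z \<noteq> 0"
  obtains k where "k \<noteq> 0" "x' = k *s x"
proof -
  obtain i j where ij: "x $ i * z $ j \<noteq> 0" using assms(2) by (auto simp: vec_eq_iff)
  have eq: "x $ m * z $ n = x' $ m * z' $ n" for m n
    using arg_cong[OF assms(1), of "\<lambda>M. M $ m $ n"] by simp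
  have nz: "z' $ j \<noteq> 0" "z $ j \<noteq> 0" using ij eq[of i j] by auto
  have "x' $ m = z $ j / z' $ j * x $ m" for m
    using eq[of m j] nz by (simp add: field_simps)
  then have "x' = (z $ j / z' $ j) *s x" unfolding vec_eq_iff by simp
  moreover have "z $ j / z' $ j \<noteq> 0" using nz by simp
  ultimately show thesis using that by blast
qed

text \<open>The minors of \<open>a b\<^sup>T + c d\<^sup>T\<close> are the products of the minors of the pairs \<open>a, c\<close> and \<open>b, d\<close>.\<close>

lemma rank_le_1_sum_cases:
  assumes "rank_le_1 (outer a b + outer c d)" "b \<noteq> 0"
  shows "(\<exists>k. c = k *s a) \<or> (\<exists>k. d = k *s b) \<or> a = 0"
proof (rule ccontr)
  assume n: "\<not> ?thesis"
  then obtain i where i: "a $ i \<noteq> 0" by (auto simp: vec_eq_iff)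
  obtain j where j: "b $ j \<noteq> 0" using assms(2) by (auto simp: vec_eq_iff)
  have "\<exists>i'. c $ i' \<noteq> c $ i / a $ i * a $ i'"
    using n by (metis vec_eq_iff vector_smult_component)
  then obtain i' where i': "c $ i' * a $ i \<noteq> c $ i * a $ i'" using i by (auto simp: field_simps)
  have "\<exists>j'. d $ j' \<noteq> d $ j / b $ j * b $ j'"
    using n by (metis vec_eq_iff vector_smult_component)
  then obtain j' where j': "d $ j' * b $ j \<noteq> d $ j * b $ j'" using j by (auto simp: field_simps)
  have "minor_at (outer a b + outer c d) i i' j j' = 0"
    using assms(1) by (simp add: rank_le_1_def)
  moreover have "minor_at (outer a b + outer c d) i i' j j'
      = (c $ i' * a $ i - c $ i * a $ i') * (d $ j' * b $ j - d $ j * b $ j')"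
    by (simp add: minor_at_def algebra_simps)
  ultimately show False using i' j' by simp
qed

text \<open>Fix \<open>a b\<^sup>T \<noteq> 0\<close> in \<open>W\<close>.  If \<open>W\<close> lies in neither ruling through it, some \<open>c d\<^sup>T\<close> in \<open>W\<close> has \<open>c\<close> not proportional
to \<open>a\<close>, which makes \<open>d\<close> proportional to \<open>b\<close>, and some \<open>f g\<^sup>T\<close> in \<open>W\<close> has \<open>g\<close> not proportional to \<open>b\<close>,
which makes \<open>f\<close> proportional to \<open>a\<close>.  Then \<open>c d\<^sup>T + f g\<^sup>T\<close> has rank two.\<close>

lemma rank_le_1_space_ruling:
  fixes W :: "(complex^'b^'a) set"
  assumes W: "cmat.subspace W" and r: "\<And>M. M \<in> W \<Longrightarrow> rank_le_1 M"
  shows "first_ruling W \<or> second_ruling W"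
proof -
  have firstI: "first_ruling W" if "x \<noteq> 0" "\<And>M. M \<in> W \<Longrightarrow> \<exists>z. M = outer x z" for x
  proof -
    have "vec.subspace {z. outer x z \<in> W}"
      using W by (simp add: vec.subspace_def cmat.subspace_def outer_add_right outer_smult_right
          outer_0_right)
    moreover have "W = {outer x z | z. z \<in> {z. outer x z \<in> W}}" using that(2) by blast
    ultimately show ?thesis unfolding first_ruling_def using that(1) by blast
  qed
  have secondI: "second_ruling W" if "y \<noteq> 0" "\<And>M. M \<in> W \<Longrightarrow> \<exists>z. M = outer z y" for y
  proof -
    have "vec.subspace {z. outer z y \<in> W}"
      using W by (simp add: vec.subspace_def cmat.subspace_def outer_add_left outer_smult_left
          outer_0_left)
    moreover have "W = {outer z y | z. z \<in> {z. outer z y \<in> W}}" using that(2) by blast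
    ultimately show ?thesis unfolding second_ruling_def using that(1) by blast
  qed
  show ?thesis
  proof (cases "W \<subseteq> {0}")
    case True
    obtain x :: "complex^'a" where "x \<noteq> 0" by (metis axis_eq_0_iff one_neq_zero)
    moreover have "\<exists>z. M = outer x z" if "M \<in> W" for M
      using True that by (auto intro!: exI[of _ 0] simp: outer_0_right)
    ultimately show ?thesis using firstI by blast
  next
    case False
    then obtain A where A: "A \<in> W" "A \<noteq> 0" by blast
    then obtain a b where ab: "A = outer a b" using r rank_le_1E by metis
    then have nz: "a \<noteq> 0" "b \<noteq> 0" using A by (auto simp: outer_eq_0_iff)
    show ?thesis
    proof (rule ccontr)
      assume n: "\<not> ?thesis"
      obtain B where B: "B \<in> W" "\<nexists>z. B = outer a z" using n firstI nz by blast
      obtain C where C: "C \<in> W" "\<nexists>z. C = outer z b" using n secondI nz by blast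
      obtain c d where cd: "B = outer c d" using r[OF B(1)] by (rule rank_le_1E)
      obtain f g where fg: "C = outer f g" using r[OF C(1)] by (rule rank_le_1E)
      have mov: "outer (k *s u) v = outer u (k *s v)" for k and u :: "complex^'a" and v :: "complex^'b"
        by (simp add: vec_eq_iff mult.assoc mult.left_commute)
      have sum: "rank_le_1 (M + N)" if "M \<in> W" "N \<in> W" for M N
        using W that r cmat.subspace_add by blast
      have ca: "\<nexists>k. c = k *s a" using B cd mov by metis
      have gb: "\<nexists>k. g = k *s b" using C fg mov by metis
      obtain k where k: "d = k *s b"
        using rank_le_1_sum_cases[of a b c d] sum[OF A(1) B(1)] ca nz ab cd by blast
      obtain l where l: "f = l *s a"
        using rank_le_1_sum_cases[of a b f g] sum[OF A(1) C(1)] gb nz ab fg by blast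
      have B0: "c \<noteq> 0" "d \<noteq> 0" using B cd
        by (metis outer_0_right outer_eq_0_iff)+
      have C0: "f \<noteq> 0"
      proof
        assume "f = 0"
        then have "C = outer 0 b" using fg by (simp add: vec_eq_iff)
        then show False using C by blast
      qed
      have k0: "k \<noteq> 0" using B0 k by auto
      have l0: "l \<noteq> 0" using C0 l by auto
      from rank_le_1_sum_cases[of c d f g] sum[OF B(1) C(1)] B0 cd fg
      consider m where "f = m *s c" | m where "g = m *s d" by blast
      then show False
      proof cases
        case 1
        then have m0: "m \<noteq> 0" using C0 by auto
        have "(1 / m) *s (m *s c) = (1 / m) *s (l *s a)" using 1 l by simp
        then have "c = (l / m) *s a" using m0 by simp
        then show False using ca by blast
      next
        case 2
        then show False using k gb by (metis vector_smult_assoc)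
      qed
    qed
  qed
qed

lemma pt_add: "pt e (x + y) = pt e x + pt e y"
  and pt_smult: "pt e (k *s x) = mscale k (pt e x)"
  and pt_0: "pt e 0 = 0"
  by (simp_all add: vec_eq_iff pt_component mscale_def)

lemma pt_eq_0_iff:
  assumes "plane_coords e K" shows "pt e x = 0 \<longleftrightarrow> x = 0"
proof
  assume z: "pt e x = 0"
  have "(\<Sum>M\<in>range e. mscale (x $ inv e M) M) = (\<Sum>k\<in>UNIV. mscale (x $ inv e (e k)) (e k))"
    using assms by (subst sum.reindex) (auto simp: plane_coords_def)
  also have "\<dots> = 0"
    using z assms by (simp add: pt_def plane_coords_def inv_f_f)
  finally have "\<forall>M\<in>range e. x $ inv e M = 0"
    using assms cmat.independentD[of "range e" "range e" "\<lambda>M. x $ inv e M"]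
    by (auto simp: plane_coords_def)
  then show "x = 0" using assms by (auto simp: plane_coords_def vec_eq_iff inv_f_f)
qed (simp add: pt_0)

lemma linear_pt: "Vector_Spaces.linear (*s) mscale (pt e)"
  by unfold_locales (simp_all add: pt_add pt_smult)

lemma inj_pt: "plane_coords e K \<Longrightarrow> inj (pt e)"
  by (rule injI) (metis diff_add_cancel eq_iff_diff_eq_0 add_diff_cancel_right' pt_add pt_eq_0_iff)

text \<open>The map \<open>pt e\<close> goes from coordinates to matrices; linear algebra is needed between these two spaces.\<close>

interpretation vec_cmat: vector_space_pair "(*s) :: complex \<Rightarrow> complex^3 \<Rightarrow> complex^3" mscale
  by unfold_locales

lemma range_pt:
  assumes "plane_coords e K" shows "range (pt e) = K"
proof
  have K: "K = cmat.span (range e)" using assms by (simp add: plane_coords_def)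
  show "range (pt e) \<subseteq> K"
  proof
    fix M assume "M \<in> range (pt e)"
    then obtain x where "M = (\<Sum>k\<in>UNIV. mscale (x $ k) (e k))" by (auto simp: pt_def)
    also have "\<dots> \<in> K"
      unfolding K by (intro cmat.span_sum cmat.span_scale cmat.span_base) auto
    finally show "M \<in> K" .
  qed
  have "cmat.subspace (range (pt e))"
    using vec_cmat.linear_subspace_image[OF linear_pt vec.subspace_UNIV] by simp
  moreover have "e k = pt e (axis k 1)" for k
    by (simp add: vec_eq_iff pt_component coef_def)
  then have "range e \<subseteq> range (pt e)" by auto
  ultimately show "K \<subseteq> range (pt e)" unfolding K by (intro cmat.span_minimal)
qed

lemma dim_pt_image:
  assumes "plane_coords e K"
  shows "cmat.dim (pt e ` S) = vec.dim S"
proof -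
  interpret finite_dimensional_vector_space_pair_1
    "(*s) :: complex \<Rightarrow> complex^3 \<Rightarrow> complex^3" cart_basis mscale ..
  show ?thesis
    by (rule dim_image_eq[OF linear_pt]) (use inj_pt[OF assms] in \<open>auto intro: inj_on_subset\<close>)
qed

lemma subspace_pt_image: "vec.subspace S \<Longrightarrow> cmat.subspace (pt e ` S)"
  by (rule vec_cmat.linear_subspace_image[OF linear_pt])

lemma subspace_pt_vimage: "cmat.subspace W \<Longrightarrow> vec.subspace {x. pt e x \<in> W}"
  by (auto simp: vec.subspace_def cmat.subspace_def pt_add pt_smult pt_0)

lemma linear_ideal_eq:
  assumes "cmat.subspace W"
  shows "linear_ideal e W = vanishing {x. pt e x \<in> W}"
  unfolding vanishing_subspace[OF subspace_pt_vimage[OF assms]] linear_ideal_def by simp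

lemma linear_ideal_pt_image:
  assumes "plane_coords e K" "vec.subspace S"
  shows "linear_ideal e (pt e ` S) = vanishing S"
proof -
  have "{x. pt e x \<in> pt e ` S} = S" using inj_pt[OF assms(1)] by (auto dest: injD)
  then show ?thesis
    using linear_ideal_eq[OF subspace_pt_image[OF assms(2), of e], of e] by simp
qed

lemma zero_locus_eq: "zero_locus e c = pt e ` {x. dot c x = 0}"
  by (auto simp: zero_locus_def)

lemma dim_line: "p \<noteq> 0 \<Longrightarrow> vec.dim (range (\<lambda>k. k *s p)) = 1" for p :: "complex^3"
  by (simp add: vec.span_singleton [symmetric] vec.dim_singleton)

lemma dim_ker:
  assumes "c \<noteq> 0" shows "vec.dim {x. dot c x = 0} = 2"
proof -
  let ?S = "{x. dot c x = 0}"
  obtain w where w: "dot c w \<noteq> 0" using assms dot_eq_0_iff by blast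
  have "y \<in> vec.span (insert w ?S)" for y
  proof -
    have "y - (dot c y / dot c w) *s w \<in> ?S" using w by simp
    then have "y - (dot c y / dot c w) *s w \<in> vec.span (insert w ?S)"
      by (intro vec.span_base) blast
    moreover have "(dot c y / dot c w) *s w \<in> vec.span (insert w ?S)"
      by (intro vec.span_scale vec.span_base) blast
    ultimately have "(y - (dot c y / dot c w) *s w) + (dot c y / dot c w) *s w \<in> vec.span (insert w ?S)"
      by (rule vec.span_add)
    then show ?thesis by simp
  qed
  then have "vec.span (insert w ?S) = UNIV" by blast
  then have "vec.dim (insert w ?S) = 3"
    using vec_dim_card[where 'a = complex and 'n = 3] vec.dim_span[of "insert w ?S"] by simp
  moreover have "w \<notin> vec.span ?S"
    unfolding vec.span_eq_iff[THEN iffD2, OF subspace_ker] using w by simp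
  ultimately show ?thesis by (simp add: vec.dim_insert)
qed

lemma plane_of_dim_2:
  assumes e: "plane_coords e K" and L: "L \<subseteq> K" "cmat.subspace L" "cmat.dim L = 2"
  obtains c where "c \<noteq> 0" "{x. pt e x \<in> L} = {x. dot c x = 0}"
proof -
  let ?S = "{x. pt e x \<in> L}"
  have "L = pt e ` ?S" using L(1) range_pt[OF e] by auto
  then have d: "vec.dim ?S = 2" using dim_pt_image[OF e, of ?S] L(3) by simp
  have "vec.subspace ?S" using L(2) by (rule subspace_pt_vimage)
  then show thesis
  proof (cases rule: subspace_of_three_space_cases)
    case zero
    then show thesis using d by simp
  next
    case (line p)
    then show thesis using d dim_line by simp
  next
    case (plane c)
    then show thesis using that by blast
  next
    case whole
    then show thesis using d vec_dim_card[where 'a = complex and 'n = 3] by simp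
  qed
qed

section \<open>Doubled lines and lines of the same ruling\<close>

text \<open>Since a minor is a multiple of the square of \<open>c\<close>, it does not change when a zero \<open>p\<close> of \<open>c\<close> is added to the
argument.  The terms that are bilinear in \<open>M(p) = x z\<^sup>T\<close> and \<open>M(y)\<close> therefore vanish: they say that each combination
\<open>x\<^sub>i M(y)\<^sub>i\<^sub>' - x\<^sub>i\<^sub>' M(y)\<^sub>i\<close> of rows is proportional to \<open>z\<close>.  As \<open>z\<close> varies, these combinations
are zero, so that every row of \<open>M(y)\<close> is a multiple of one row.\<close>

lemma doubled_first_ruling_line_rank_le_1:
  fixes e :: "3 \<Rightarrow> complex^'b^'a"
  assumes e: "plane_coords e K" and x: "x \<noteq> 0"
    and L: "\<And>y. dot c y = 0 \<Longrightarrow> \<exists>z. pt e y = outer x z"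
    and dbl: "\<And>i i' j j'. \<exists>k. \<forall>y. minor_at (pt e y) i i' j j' = k * (dot c y)\<^sup>2"
  shows "rank_le_1 (pt e y)"
proof -
  let ?D = "pt e y"
  obtain i0 where i0: "x $ i0 \<noteq> 0" using x by (auto simp: vec_eq_iff)
  have mix: "x $ i * z $ j * ?D $ i' $ j' + ?D $ i $ j * (x $ i' * z $ j')
      - x $ i * z $ j' * ?D $ i' $ j - ?D $ i $ j' * (x $ i' * z $ j) = 0"
    if p: "dot c p = 0" "pt e p = outer x z" for p z i i' j j'
  proof -
    obtain k where k: "\<And>y. minor_at (pt e y) i i' j j' = k * (dot c y)\<^sup>2"
      using dbl by blast
    have "minor_at (pt e (p + y)) i i' j j' = minor_at (pt e y) i i' j j'"
      by (simp add: k p)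
    then show ?thesis by (simp add: minor_at_def pt_add p algebra_simps)
  qed
  have rows: "x $ i * ?D $ i' $ j = x $ i' * ?D $ i $ j" for i i' j
  proof (rule ccontr)
    assume ne: "\<not> ?thesis"
    \<comment> \<open>At this point of the line the right factor \<open>z\<close> has a zero in column \<open>j\<close>;
      the other columns must then vanish too.\<close>
    obtain p where p: "p \<noteq> 0" "dot c p = 0" "dot (coef e i0 j) p = 0" by (rule common_zero)
    obtain z where z: "pt e p = outer x z" using L[OF p(2)] by blast
    have "x $ i0 * z $ j = 0" using p(3) arg_cong[OF z, of "\<lambda>M. M $ i0 $ j"] by (simp add: pt_component)
    then have zj: "z $ j = 0" using i0 by simp
    have "z $ l = 0" for l
    proof -
      have "z $ l * (x $ i * ?D $ i' $ j - x $ i' * ?D $ i $ j) = 0"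
        using mix[OF p(2) z, of i l i' j] zj by (simp add: algebra_simps)
      then show ?thesis using ne by simp
    qed
    then have "z = 0" by (simp add: vec_eq_iff)
    then have "pt e p = 0" using z by (simp add: outer_0_right)
    then show False using p(1) pt_eq_0_iff[OF e] by simp
  qed
  have "?D $ i' $ j = x $ i' * (?D $ i0 $ j / x $ i0)" for i' j
    using rows[of i0 i' j] i0 by (simp add: field_simps)
  then have "?D = outer x (\<chi> j. ?D $ i0 $ j / x $ i0)"
    unfolding vec_eq_iff outer_component vec_lambda_beta by blast
  then show ?thesis using rank_le_1_outer by metis
qed

lemma plane_coords_transpose:
  fixes e :: "3 \<Rightarrow> complex^'b^'a"
  assumes "plane_coords e K"
  shows "plane_coords (\<lambda>k. transpose (e k)) (transpose ` K)"
proof -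
  let ?e = "\<lambda>k. transpose (e k)"
  have inj: "inj ?e"
    using assms transpose_iff by (fastforce simp: plane_coords_def inj_def)
  have "cmat.independent (range ?e)"
  proof (rule cmat.independent_if_scalars_zero)
    fix f M assume 0: "(\<Sum>M\<in>range ?e. mscale (f M) M) = 0" and M: "M \<in> range ?e"
    define x :: "complex^3" where "x = (\<chi> k. f (?e k))"
    have "pt ?e x = 0"
      using 0 inj by (simp add: sum.reindex pt_def x_def)
    then have "pt e x = 0" unfolding pt_transpose by (metis transpose_iff transpose_transpose pt_0 pt_transpose)
    then have "x = 0" using pt_eq_0_iff[OF assms] by simp
    then show "f M = 0" using M by (auto simp: x_def vec_eq_iff)
  qed simp
  moreover have "cmat.span (range ?e) = transpose ` K"
  proof -
    have lin: "Vector_Spaces.linear mscale mscale (transpose :: complex^'c^'d \<Rightarrow> complex^'d^'c)"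
      by unfold_locales (simp_all add: vec_eq_iff mscale_def)
    interpret vector_space_pair "mscale :: complex \<Rightarrow> complex^'b^'a \<Rightarrow> _" "mscale :: complex \<Rightarrow> complex^'a^'b \<Rightarrow> _"
      by unfold_locales
    have "range ?e = transpose ` range e" by auto
    then show ?thesis
      using linear_span_image[OF lin, of "range e"] assms by (simp add: plane_coords_def)
  qed
  ultimately show ?thesis using inj by (simp add: plane_coords_def)
qed

lemma second_ruling_transpose:
  fixes W :: "(complex^'b^'a) set"
  shows "second_ruling W \<longleftrightarrow> first_ruling (transpose ` W)"
proof -
  have img: "W = {outer x y | x. x \<in> Y} \<longleftrightarrow> transpose ` W = {outer y x | x. x \<in> Y}" for y Y
  proof -
    have "{outer y x | x. x \<in> Y} = transpose ` {outer x y | x. x \<in> Y}"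
      by (force simp: transpose_outer image_iff)
    moreover have "inj (transpose :: complex^'b^'a \<Rightarrow> complex^'a^'b)"
      by (rule inj_on_inverseI[of _ transpose]) (simp add: transpose_transpose)
    ultimately show ?thesis by (simp add: inj_image_eq_iff)
  qed
  show ?thesis unfolding first_ruling_def second_ruling_def img ..
qed

lemma doubled_line_rank_le_1:
  fixes e :: "3 \<Rightarrow> complex^'b^'a"
  assumes e: "plane_coords e K" and L: "first_ruling (zero_locus e c) \<or> second_ruling (zero_locus e c)"
    and dbl: "\<And>i i' j j'. \<exists>k. \<forall>y. minor_at (pt e y) i i' j j' = k * (dot c y)\<^sup>2"
  shows "rank_le_1 (pt e y)"
  using L
proof
  assume "first_ruling (zero_locus e c)"
  then obtain x where "x \<noteq> 0" "\<And>y. dot c y = 0 \<Longrightarrow> \<exists>z. pt e y = outer x z"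
    unfolding first_ruling_def zero_locus_eq by blast
  then show ?thesis using doubled_first_ruling_line_rank_le_1[OF e] dbl by blast
next
  assume "second_ruling (zero_locus e c)"
  then obtain x where x: "x \<noteq> 0" "\<And>y. dot c y = 0 \<Longrightarrow> \<exists>z. pt e y = outer z x"
    unfolding second_ruling_def zero_locus_eq by blast
  let ?e = "\<lambda>k. transpose (e k)"
  have "rank_le_1 (pt ?e y)"
  proof (rule doubled_first_ruling_line_rank_le_1[OF plane_coords_transpose[OF e] x(1)])
    show "\<exists>z. pt ?e y = outer x z" if "dot c y = 0" for y
      using x(2)[OF that] by (auto simp: pt_transpose transpose_outer)
    show "\<exists>k. \<forall>y. minor_at (pt ?e y) i i' j j' = k * (dot c y)\<^sup>2" for i i' j j'
    proof -
      have "minor_at (pt ?e y) i i' j j' = minor_at (pt e y) j j' i i'" for y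
        by (simp add: minor_at_def pt_transpose mult.commute)
      then show ?thesis using dbl[of j j' i i'] by simp
    qed
  qed
  then show ?thesis by (simp add: pt_transpose)
qed

text \<open>The two lines meet in a point, which makes their left factors proportional, and together they span the plane.\<close>

lemma two_first_ruling_lines:
  fixes e :: "3 \<Rightarrow> complex^'b^'a"
  assumes e: "plane_coords e K" and c: "\<And>k. d \<noteq> k *s c"
    and L: "first_ruling (zero_locus e c)" "first_ruling (zero_locus e d)"
  shows "rank_le_1 (pt e y)"
proof -
  obtain x where x: "x \<noteq> 0" "\<And>y. dot c y = 0 \<Longrightarrow> \<exists>z. pt e y = outer x z"
    using L(1) unfolding first_ruling_def zero_locus_eq by blast
  obtain x' where x': "x' \<noteq> 0" "\<And>y. dot d y = 0 \<Longrightarrow> \<exists>z. pt e y = outer x' z"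
    using L(2) unfolding first_ruling_def zero_locus_eq by blast
  obtain p where p: "p \<noteq> 0" "dot c p = 0" "dot d p = 0" by (rule common_zero)
  obtain z z' where z: "pt e p = outer x z" "pt e p = outer x' z'" using x(2) x'(2) p by blast
  moreover have "outer x z \<noteq> 0" using p(1) z(1) pt_eq_0_iff[OF e] by metis
  ultimately obtain k where k: "x' = k *s x" using proportional_of_outer_eq by metis
  \<comment> \<open>Any \<open>y\<close> is a multiple of \<open>v\<close>, on the first line, plus a point of the second line.\<close>
  obtain v where v: "dot c v = 0" "dot d v \<noteq> 0" using dot_zero_on_ker_multiple c by metis
  let ?t = "dot d y / dot d v"
  obtain w where w: "pt e (?t *s v) = outer x w" using x(2)[of "?t *s v"] v by auto
  obtain w' where w': "pt e (y - ?t *s v) = outer x' w'" using x'(2)[of "y - ?t *s v"] v by auto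
  have "pt e y = pt e (?t *s v + (y - ?t *s v))" by simp
  also have "\<dots> = outer x (w + k *s w')"
    unfolding pt_add w w' k by (simp add: vec_eq_iff algebra_simps)
  finally show ?thesis by simp
qed

lemma two_second_ruling_lines:
  fixes e :: "3 \<Rightarrow> complex^'b^'a"
  assumes e: "plane_coords e K" and c: "\<And>k. d \<noteq> k *s c"
    and L: "second_ruling (zero_locus e c)" "second_ruling (zero_locus e d)"
  shows "rank_le_1 (pt e y)"
proof -
  let ?e = "\<lambda>k. transpose (e k)"
  have z: "zero_locus ?e c = transpose ` zero_locus e c" for c
    by (auto simp: zero_locus_eq pt_transpose)
  have "rank_le_1 (pt ?e y)"
    using two_first_ruling_lines[OF plane_coords_transpose[OF e] c] L
    by (simp add: z second_ruling_transpose)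
  then show ?thesis by (simp add: pt_transpose)
qed

lemma Segre_line_zero_locus:
  assumes e: "plane_coords e K" and c: "c \<noteq> 0"
    and r: "\<And>x. dot c x = 0 \<Longrightarrow> rank_le_1 (pt e x)"
  shows "Segre_line (zero_locus e c)"
proof -
  have "first_ruling (zero_locus e c) \<or> second_ruling (zero_locus e c)"
    unfolding zero_locus_eq
    by (rule rank_le_1_space_ruling) (use r subspace_pt_image[OF subspace_ker] in auto)
  moreover have "cmat.dim (zero_locus e c) = 2"
    unfolding zero_locus_eq dim_pt_image[OF e] by (rule dim_ker[OF c])
  ultimately show ?thesis by (simp add: Segre_line_def)
qed

section \<open>Every positive-dimensional section has one of the six types\<close>

lemma vanishing_UNIV: "vanishing UNIV = {0}"
  by (auto simp: vanishing_def intro: eval_pol_eq_0D)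

text \<open>The hypothesis on the minors is stated with constant cofactors, in the form in which it comes out of the
classification; divisibility by the square is reduced to it at the end.\<close>

lemma no_doubled_line:
  assumes e: "plane_coords e K" and L: "Segre_line (zero_locus e u)"
    and m: "\<And>m. m \<in> minors e \<Longrightarrow> \<exists>k. m = cnst k * linform u ^ 2"
  shows "rank_le_1 (pt e y)"
proof (rule doubled_line_rank_le_1[OF e])
  show "first_ruling (zero_locus e u) \<or> second_ruling (zero_locus e u)"
    using L by (simp add: Segre_line_def)
  fix i i' j j'
  have "\<exists>k. minor_pol e i i' j j' = cnst k * linform u ^ 2"
  proof (cases rule: minors_cases[of e i i' j j'])
    case 1
    then show ?thesis by (intro exI[of _ 0]) (simp add: cnst_def)
  qed (rule m)
  then show "\<exists>k. \<forall>y. minor_at (pt e y) i i' j j' = k * (dot u y)\<^sup>2"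
    by (metis eval_minor_pol eval_pol_cnst eval_pol_linform eval_pol_mult eval_pol_power)
qed

lemma ruling_plane_type:
  assumes e: "plane_coords e K" and K: "cmat.subspace K" "cmat.dim K = 3"
    and m: "\<And>m. m \<in> minors e \<Longrightarrow> m = 0"
  shows "has_type K e Ruling_Plane"
proof -
  have "rank_le_1 M" if "M \<in> K" for M
    using that m rank_le_1_iff_minors[of e] range_pt[OF e] by force
  then have "ruling_plane K"
    using rank_le_1_space_ruling[OF K(1)] K(2) by (simp add: ruling_plane_def)
  moreover have "minors_ideal e = {0}"
  proof -
    have "minors e \<subseteq> {0}" using m by blast
    moreover have "ideal.subspace {0 :: pol}" by (simp add: ideal.subspace_def)
    ultimately have "ideal.span (minors e) \<subseteq> {0}" by (rule ideal.span_minimal)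
    then show ?thesis unfolding minors_ideal_def using ideal.span_zero by blast
  qed
  then have "Z_ideal e = {0}" by (auto simp: Z_ideal_def saturation_def var_eq_linform axis_neq_0)
  moreover have "{x. pt e x \<in> K} = UNIV" using range_pt[OF e] by auto
  then have "linear_ideal e K = {0}" using linear_ideal_eq[OF K(1)] vanishing_UNIV by metis
  ultimately show ?thesis by simp
qed

text \<open>Linear coordinates adapted to a point on a line: \<open>u\<close> defines the line, and \<open>u\<close> and \<open>v\<close> define the point.\<close>

lemma line_in_plane_coordinates:
  assumes u: "u \<noteq> 0" and p: "p \<noteq> 0" "dot u p = 0"
  obtains v and C :: "complex^3^3" where "invertible C" "C $ 1 = u" "C $ 2 = v"
    "range (\<lambda>k. k *s p) = {x. \<forall>d\<in>{u, v}. dot d x = 0}"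
proof -
  obtain w where w: "dot w p \<noteq> 0" using p(1) dot_eq_0_iff[of p] by (auto simp: dot_commute)
  obtain q where q: "q \<noteq> 0" "dot u q = 0" "dot w q = 0" by (rule common_zero)
  have "q \<notin> range (\<lambda>k. k *s p)" using q w by auto
  then obtain v where v: "linform v \<in> vanishing (range (\<lambda>k. k *s p))" "dot v q \<noteq> 0"
    using not_in_subspace_separated[OF subspace_line] by metis
  have vp: "dot v p = 0" using v(1) rangeI[of "\<lambda>k. k *s p" 1] by (auto simp: vanishing_def)
  obtain r where r: "dot u r \<noteq> 0" using u dot_eq_0_iff by blast
  have N: "x \<in> range (\<lambda>k. k *s p)" if x: "dot u x = 0" "dot v x = 0" for x
  proof -
    have ind: "\<gamma> = 0 \<and> \<beta> = 0" if "dot u (\<alpha> *s p + \<beta> *s q + \<gamma> *s r) = 0"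
      "dot v (\<alpha> *s p + \<beta> *s q + \<gamma> *s r) = 0" for \<alpha> \<beta> \<gamma>
    proof -
      have "\<gamma> = 0" using that(1) p q r by simp
      moreover from this have "\<beta> = 0" using that(2) vp v(2) by simp
      ultimately show ?thesis by simp
    qed
    have "\<alpha> = 0 \<and> \<beta> = 0 \<and> \<gamma> = 0" if z: "\<alpha> *s p + \<beta> *s q + \<gamma> *s r = 0" for \<alpha> \<beta> \<gamma>
    proof -
      have "\<gamma> = 0 \<and> \<beta> = 0" by (rule ind[of \<alpha>]) (simp_all only: z dot_0_right)
      then show ?thesis using z p(1) by simp
    qed
    then obtain \<alpha> \<beta> \<gamma> where xx: "x = \<alpha> *s p + \<beta> *s q + \<gamma> *s r"
      using three_vectors_span[of p q r x] by metis
    then have "x = \<alpha> *s p" using ind[of \<alpha> \<beta> \<gamma>] x by simp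
    then show ?thesis by blast
  qed
  define C :: "complex^3^3" where "C = (\<chi> i. if i = 1 then u else if i = 2 then v else w)"
  have C: "C $ 1 = u" "C $ 2 = v" "C $ 3 = w" by (simp_all add: C_def)
  have "\<forall>x. C *v x = 0 \<longrightarrow> x = 0"
  proof (intro allI impI)
    fix x assume "C *v x = 0"
    then have "dot (C $ i) x = 0" for i
      by (simp add: vec_eq_iff matrix_vector_mult_def dot_def)
    then have x: "dot u x = 0" "dot v x = 0" "dot w x = 0" using C by metis+
    then obtain k where "x = k *s p" using N by blast
    then show "x = 0" using x(3) w by simp
  qed
  then have "invertible C" by (simp add: trivial_kernel_iff_det invertible_det_nz)
  moreover have "range (\<lambda>k. k *s p) = {x. \<forall>d\<in>{u, v}. dot d x = 0}"
    using N p vp by auto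
  ultimately show thesis using that C by blast
qed

text \<open>The ideal of minors is \<open>u\<close> times the vanishing ideal of the common zeros \<open>S\<close> of the cofactors, and the dimension
of \<open>S\<close> decides the type.\<close>

lemma linform_divides_minors_type:
  fixes e :: "3 \<Rightarrow> complex^'b^'a"
  assumes e: "plane_coords e K" and K: "cmat.subspace K" "cmat.dim K = 3"
    and u: "u \<noteq> 0" "\<And>m. m \<in> minors e \<Longrightarrow> linform u dvd m"
  shows "\<exists>T. has_type K e T"
proof -
  define D where "D = {d. linform u * linform d \<in> minors e}"
  define S where "S = {x. \<forall>d\<in>D. dot d x = 0}"
  have S: "vec.subspace S" unfolding S_def by (rule subspace_annihilator)
  have "minors e = (*) (linform u) ` linform ` D"
  proof
    show "minors e \<subseteq> (*) (linform u) ` linform ` D"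
    proof
      fix m assume m: "m \<in> minors e"
      then obtain d where "m = linform u * linform d"
        using linform_dvd_quadratic quadratic_minor u(2) by metis
      then show "m \<in> (*) (linform u) ` linform ` D" using m D_def by blast
    qed
  qed (auto simp: D_def)
  then have I: "minors_ideal e = (*) (linform u) ` vanishing S"
    by (simp add: minors_ideal_def span_times span_linforms_eq_vanishing S_def)
  have line: "Segre_line (zero_locus e c)" if "c = u \<or> S = {x. dot c x = 0}" "c \<noteq> 0" for c
  proof (rule Segre_line_zero_locus[OF e that(2)])
    fix x assume x: "dot c x = 0"
    have "eval_pol m x = 0" if "m \<in> minors e" for m
    proof -
      have "m \<in> (*) (linform u) ` vanishing S"
        using that I by (metis ideal.span_base minors_ideal_def)
      then show ?thesis using x \<open>c = u \<or> _\<close> by (auto simp: vanishing_def)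
    qed
    then show "rank_le_1 (pt e x)" by (simp add: rank_le_1_iff_minors)
  qed
  have sub: "zero_locus e c \<subseteq> K" for c
    using range_pt[OF e] by (auto simp: zero_locus_eq)
  have lin: "linear_ideal e (zero_locus e c) = vanishing {x. dot c x = 0}" for c
    unfolding zero_locus_eq by (rule linear_ideal_pt_image[OF e subspace_ker])
  note Lu = line[of u, simplified, OF u(1)]
  show ?thesis using S
  proof (cases rule: subspace_of_three_space_cases)
    case zero
    have "Z_ideal e = linear_ideal e (zero_locus e u)"
      unfolding Z_ideal_def I zero lin vanishing_ker
      by (rule saturation_linform_times_irrelevant[OF u(1)])
    then have "has_type K e Reduced_Line" using Lu sub by auto
    then show ?thesis ..
  next
    case whole
    have "m = 0" if "m \<in> minors e" for m
    proof -
      have "m \<in> (*) (linform u) ` vanishing S"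
        using that I by (metis ideal.span_base minors_ideal_def)
      then show ?thesis by (auto simp: whole vanishing_UNIV)
    qed
    then show ?thesis using ruling_plane_type[OF e K] by blast
  next
    case (line p)
    have "S \<noteq> {0}" using line rangeI[of "\<lambda>k. k *s p" 1] by auto
    then have Z: "Z_ideal e = (*) (linform u) ` vanishing S"
      unfolding Z_ideal_def I by (rule saturation_linform_times_vanishing[OF u(1) S])
    have pS: "p \<in> S" using line rangeI[of "\<lambda>k. k *s p" 1] by simp
    show ?thesis
    proof (cases "dot u p = 0")
      case False
      let ?p = "pt e ` S"
      have "?p \<subseteq> K" using range_pt[OF e] by auto
      moreover have "cmat.subspace ?p" by (rule subspace_pt_image[OF S])
      moreover have "cmat.dim ?p = 1" unfolding dim_pt_image[OF e] line by (rule dim_line[OF line(1)])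
      moreover have "\<not> ?p \<subseteq> zero_locus e u"
      proof
        assume "?p \<subseteq> zero_locus e u"
        then obtain x where "pt e p = pt e x" "dot u x = 0" using pS by (auto simp: zero_locus_eq)
        then show False using False injD[OF inj_pt[OF e]] by metis
      qed
      moreover have "Z_ideal e = linear_ideal e (zero_locus e u) \<inter> linear_ideal e ?p"
        unfolding Z lin linear_ideal_pt_image[OF e S]
        by (rule linform_times_vanishing[OF S pS False])
      ultimately have "has_type K e Line_And_Point"
        unfolding has_type.simps using Lu sub by blast
      then show ?thesis ..
    next
      case True
      obtain v and C :: "complex^3^3" where C: "invertible C" "C $ 1 = u" "C $ 2 = v"
        "range (\<lambda>k. k *s p) = {x. \<forall>d\<in>{u, v}. dot d x = 0}"
        by (rule line_in_plane_coordinates[OF u(1) line(1) True])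
      have "vanishing S = ideal.span (linform ` {u, v})"
        unfolding span_linforms_eq_vanishing line(2) C(4) ..
      then have "Z_ideal e = ideal.span ((*) (linform u) ` linform ` {u, v})"
        unfolding Z span_times by simp
      then have "has_type K e Line_With_Embedded_Point"
        using C(1-3) Lu by (auto simp: power2_eq_square intro!: exI[of _ C])
      then show ?thesis ..
    qed
  next
    case (plane c)
    show ?thesis
    proof (cases "\<exists>k. c = k *s u")
      case True
      then obtain k where k: "c = k *s u" by blast
      have "rank_le_1 (pt e y)" for y
      proof (rule no_doubled_line[OF e Lu])
        fix m assume "m \<in> minors e"
        then have "m \<in> (*) (linform u) ` vanishing S"
          using I by (metis ideal.span_base minors_ideal_def)
        then obtain g where g: "m = linform u * g" "g \<in> vanishing {x. dot c x = 0}"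
          unfolding plane(2) by blast
        obtain d where d: "m = linform u * linform d"
          using linform_dvd_quadratic quadratic_minor u(2) \<open>m \<in> minors e\<close> by metis
        then have "linform d \<in> vanishing {x. dot c x = 0}" using g u(1) by simp
        then have "linform c dvd linform d" by (simp add: vanishing_ker in_span_single)
        then obtain l where "d = l *s c" by (rule linform_dvd_linform)
        then show "\<exists>k. m = cnst k * linform u ^ 2"
          using d k by (intro exI[of _ "l * k"] pol_eqI) (simp add: power2_eq_square)
      qed
      then have "m = 0" if "m \<in> minors e" for m
        using that rank_le_1_iff_minors by (intro eval_pol_eq_0D) blast
      then show ?thesis using ruling_plane_type[OF e K] by blast
    next
      case False
      then have nk: "\<And>k. c \<noteq> k *s u" by blast
      have "\<exists>x. dot c x = 0 \<and> dot u x \<noteq> 0"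
      proof (rule ccontr)
        assume "\<not> ?thesis"
        then obtain k where k: "u = k *s c" using dot_zero_on_ker_multiple[of c u] by blast
        then have "c = (1 / k) *s u" using u(1) by auto
        then show False using nk by blast
      qed
      then obtain x where x: "dot c x = 0" "dot u x \<noteq> 0" by blast
      have "x \<in> S" "x \<noteq> 0" using x plane(2) by auto
      then have "S \<noteq> {0}" by blast
      then have Z: "Z_ideal e = (*) (linform u) ` vanishing S"
        unfolding Z_ideal_def I by (rule saturation_linform_times_vanishing[OF u(1) S])
      have Z': "Z_ideal e = linear_ideal e (zero_locus e u) \<inter> linear_ideal e (zero_locus e c)"
        unfolding Z lin plane(2) using linform_times_vanishing[OF subspace_ker, of x c u] x by simp
      have Lc: "Segre_line (zero_locus e c)" using line plane by blast
      have nr: "\<exists>y. \<not> rank_le_1 (pt e y)"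
      proof (rule ccontr)
        assume "\<not> ?thesis"
        then have m0: "m = 0" if "m \<in> minors e" for m
          using that rank_le_1_iff_minors by (intro eval_pol_eq_0D) blast
        have "d = 0" if "d \<in> D" for d
        proof -
          have "linform u * linform d = 0" by (rule m0) (use that D_def in blast)
          then show ?thesis using u(1) by simp
        qed
        then have "dot d x = 0" if "d \<in> D" for d x using that by force
        then have "S = UNIV" unfolding S_def by blast
        then show False using plane dot_eq_0_iff by blast
      qed
      have "\<not> (first_ruling (zero_locus e u) \<and> first_ruling (zero_locus e c))"
        "\<not> (second_ruling (zero_locus e u) \<and> second_ruling (zero_locus e c))"
        using nr two_first_ruling_lines[OF e nk] two_second_ruling_lines[OF e nk] by blast+
      then consider "first_ruling (zero_locus e u)" "second_ruling (zero_locus e c)"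
        | "first_ruling (zero_locus e c)" "second_ruling (zero_locus e u)"
        using Lu Lc by (auto simp: Segre_line_def)
      then have "has_type K e Two_Opposite_Lines"
      proof cases
        case 1
        then show ?thesis using Lu Lc sub Z' by auto
      next
        case 2
        then show ?thesis using Lu Lc sub Z' Int_commute by (metis has_type.simps(3))
      qed
      then show ?thesis ..
    qed
  qed
qed

lemma proportional_minors_type:
  assumes q: "q \<in> minors e" "smooth_curve q" and m: "\<And>m. m \<in> minors e \<Longrightarrow> \<exists>t. m = cnst t * q"
  shows "has_type K e Smooth_Conic"
proof -
  have nd: "\<not> linform c dvd q" for c
    using smooth_not_linform_dvd[OF quadratic_minor[OF q(1)] q(2)] .
  have "minors_ideal e = ideal.span {q}"
    unfolding minors_ideal_def
  proof
    show "ideal.span (minors e) \<subseteq> ideal.span {q}"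
    proof (rule ideal.span_minimal)
      show "minors e \<subseteq> ideal.span {q}" unfolding in_span_single subset_iff
        using m by (metis dvd_triv_right)
    qed simp
    show "ideal.span {q} \<subseteq> ideal.span (minors e)"
      using q(1) by (intro ideal.span_mono) auto
  qed
  then have "Z_ideal e = ideal.span {q}"
    by (simp add: Z_ideal_def saturation_principal nd)
  moreover have "q \<noteq> 0" using nd by auto
  ultimately show ?thesis using q homogeneous_minor[OF q(1)] by auto
qed

lemma homogeneous_ideal_not_subset:
  assumes "homogeneous_ideal P" "ideal.subspace Q" "\<not> P \<subseteq> Q"
  obtains g d where "g \<in> P" "homogeneous d g" "g \<notin> Q"
proof -
  obtain G where G: "\<And>g. g \<in> G \<Longrightarrow> \<exists>d. homogeneous d g" "P = ideal.span G"
    using assms(1) unfolding homogeneous_ideal_def by blast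
  then have "\<not> G \<subseteq> Q" using assms(2,3) ideal.span_minimal by blast
  then show thesis using that G ideal.span_base by blast
qed

text \<open>A form in \<open>P\<close> but not in \<open>Q\<close> is nonzero at \<open>p\<close>; modulo the ideal of \<open>p\<close> it is a multiple of a power of each
coordinate that is nonzero at \<open>p\<close>, and the other coordinates lie in that ideal anyway.\<close>

lemma prime_of_point_maximal:
  assumes P: "prime_ideal P" "homogeneous_ideal P" and Q: "ideal.subspace Q" "vanishing (range (\<lambda>k. k *s p)) \<subseteq> Q"
    and QP: "Q \<subset> P"
  shows "range var \<subseteq> P"
proof -
  have idP: "ideal.subspace P" and "1 \<notin> P" and pr: "\<And>f g. f * g \<in> P \<Longrightarrow> f \<in> P \<or> g \<in> P"
    using P(1) by (auto simp: prime_ideal_def)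
  obtain g d where g: "g \<in> P" "homogeneous d g" "g \<notin> Q"
    using homogeneous_ideal_not_subset[OF P(2) Q(1)] QP by blast
  have "g \<notin> vanishing (range (\<lambda>k. k *s p))" using g Q by blast
  then have gp: "eval_pol g p \<noteq> 0"
    using eval_pol_homogeneous[OF g(2)] by (auto simp: vanishing_def)
  have inP: "f \<in> P" if "\<And>k. eval_pol f (k *s p) = 0" for f
    using that Q QP by (auto simp: vanishing_def)
  have pow: "f \<in> P" if "f ^ n \<in> P" for f n
    using that \<open>1 \<notin> P\<close> pr by (induction n) auto
  show ?thesis
  proof safe
    fix i
    show "var i \<in> P"
    proof (cases "p $ i = 0")
      case True
      then show ?thesis by (intro inP) simp
    next
      case False
      \<comment> \<open>By homogeneity this form vanishes on the whole line through \<open>p\<close>.\<close>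
      let ?h = "cnst (eval_pol g p) * var i ^ d - cnst (p $ i ^ d) * g"
      have "?h \<in> P"
        by (rule inP) (simp add: eval_pol_homogeneous[OF g(2)] power_mult_distrib)
      then have "?h + cnst (p $ i ^ d) * g \<in> P"
        using g(1) idP by (intro ideal.subspace_add ideal.subspace_scale)
      then have "cnst (eval_pol g p) * var i ^ d \<in> P" by simp
      then have "cnst (1 / eval_pol g p) * (cnst (eval_pol g p) * var i ^ d) \<in> P"
        by (rule ideal.subspace_scale[OF idP])
      moreover have "cnst (1 / eval_pol g p) * (cnst (eval_pol g p) * var i ^ d) = var i ^ d"
        using gp by (intro pol_eqI) simp
      ultimately show ?thesis using pow by simp
    qed
  qed
qed

text \<open>A chain of two primes leaves room for at most one independent condition on the plane, so the minors share a
factor: a linear form, or one smooth conic of which they are all multiples.\<close>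

lemma positive_dimension_cases:
  assumes dim: "proj_dim (minors_ideal e) \<ge> 1"
  shows "(\<exists>u. u \<noteq> 0 \<and> (\<forall>m\<in>minors e. linform u dvd m)) \<or>
    (\<exists>q\<in>minors e. smooth_curve q \<and> (\<forall>m\<in>minors e. \<exists>t. m = cnst t * q))"
proof -
  obtain P0 P1 where P: "P0 \<in> proj_points (minors_ideal e)" "P1 \<in> proj_points (minors_ideal e)" "P0 \<subset> P1"
  proof -
    let ?C = "\<lambda>n. \<exists>P. (\<forall>i\<le>n. P i \<in> proj_points (minors_ideal e)) \<and> (\<forall>i<n. P i \<subset> P (Suc i))"
    have "\<exists>n. n \<ge> 1 \<and> ?C n"
    proof (rule ccontr)
      assume n: "\<not> ?thesis"
      have "proj_dim (minors_ideal e) \<le> 0"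
        unfolding proj_dim_def
      proof (rule Sup_least)
        fix x assume "x \<in> {ereal (real n) | n. ?C n}"
        then obtain n' where n': "x = ereal (real n')" "?C n'" by blast
        then have "\<not> n' \<ge> 1" using n by blast
        then have "n' = 0" by simp
        then show "x \<le> 0" using n' by simp
      qed
      then have "(1::ereal) \<le> 0" using dim order_trans by blast
      then show False by simp
    qed
    then obtain n Q where "n \<ge> 1" "\<forall>i\<le>n. Q i \<in> proj_points (minors_ideal e)" "\<forall>i<n. Q i \<subset> Q (Suc i)"
      by blast
    then show thesis by (intro that[of "Q 0" "Q 1"]) auto
  qed
  have idP: "ideal.subspace P0" and pr: "\<And>f g. f * g \<in> P0 \<Longrightarrow> f \<in> P0 \<or> g \<in> P0" and "minors_ideal e \<subseteq> P0"
    and P1: "prime_ideal P1" "homogeneous_ideal P1" "\<not> range var \<subseteq> P1"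
    using P by (auto simp: proj_points_def prime_ideal_def)
  then have mP: "m \<in> P0" if "m \<in> minors e" for m
    using that by (auto simp: minors_ideal_def intro: ideal.span_base)
  show ?thesis
  proof (cases "\<exists>u. u \<noteq> 0 \<and> linform u \<in> P0")
    case True
    then obtain u where u: "u \<noteq> 0" "linform u \<in> P0" by blast
    have "linform u dvd m" if m: "m \<in> minors e" for m
    proof (rule ccontr)
      assume n: "\<not> linform u dvd m"
      obtain g p h q where k: "\<And>y. dot u y = 0 \<Longrightarrow> y = dot g y *s p + dot h y *s q"
        using kernel_parametrised[OF u(1)] by metis
      obtain c d where cd: "\<And>x. eval_pol m (dot g x *s p + dot h x *s q) = dot c x * dot d x"
        using quadratic_splits_on_plane[OF quadratic_minor[OF m]] by metis
      have ev: "eval_pol m x = dot c x * dot d x" if "dot u x = 0" for x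
        using k[OF that] cd[of x] by simp
      then have "linform u dvd m - linform c * linform d" by (simp add: linform_dvd_iff)
      then obtain r where "m - linform c * linform d = r * linform u"
        by (metis dvdE mult.commute)
      then have "m - linform c * linform d \<in> P0"
        using ideal.subspace_scale[OF idP u(2), of r] by simp
      then have "m - (m - linform c * linform d) \<in> P0"
        by (rule ideal.subspace_diff[OF idP mP[OF m]])
      then have "linform c * linform d \<in> P0"
        by (simp only: diff_diff_eq2 add_diff_cancel_left')
      moreover have "\<not> linform u dvd linform c" "\<not> linform u dvd linform d"
        using n ev by (auto simp: linform_dvd_iff)
      ultimately obtain c' where c': "linform c' \<in> P0" "\<not> linform u dvd linform c'"
        using pr by blast
      obtain p where p: "p \<noteq> 0" "dot u p = 0" "dot c' p = 0" by (rule common_zero)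
      \<comment> \<open>The two linear forms in \<open>P0\<close> generate the ideal of the point \<open>p\<close>.\<close>
      obtain v where C: "range (\<lambda>k. k *s p) = {x. \<forall>d\<in>{u, v}. dot d x = 0}"
        by (rule line_in_plane_coordinates[OF u(1) p(1,2)])
      have c'v: "c' \<in> vec.span {u, v}"
      proof (rule double_annihilator)
        fix x assume "\<And>d. d \<in> {u, v} \<Longrightarrow> dot d x = 0"
        then have "x \<in> range (\<lambda>k. k *s p)" unfolding C by blast
        then show "dot c' x = 0" using p(3) by auto
      qed
      have line: "{x. \<forall>d\<in>{u, c'}. dot d x = 0} = range (\<lambda>k. k *s p)"
      proof -
        obtain a b where ab: "c' = a *s u + b *s v"
          using c'v by (auto simp: vec.span_insert vec.span_singleton eq_diff_eq algebra_simps)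
        have "b \<noteq> 0"
          using c'(2) by (auto simp: ab linform_dvd_iff)
        then show ?thesis unfolding C ab by auto
      qed
      have "linform ` {u, c'} \<subseteq> P0" using u(2) c'(1) by blast
      then have "ideal.span (linform ` {u, c'}) \<subseteq> P0" using idP by (rule ideal.span_minimal)
      then have "vanishing (range (\<lambda>k. k *s p)) \<subseteq> P0"
        unfolding span_linforms_eq_vanishing line .
      then have "range var \<subseteq> P1" using prime_of_point_maximal[OF P1(1,2) idP] P(3) by blast
      then show False using P1(3) by blast
    qed
    then show ?thesis using u(1) by blast
  next
    case False
    then have nl: "c = 0 \<or> d = 0" if "linform c * linform d \<in> P0" for c d
      using pr[OF that] by blast
    show ?thesis
    proof (cases "\<forall>m\<in>minors e. m = 0")
      case True
      then have "\<forall>m\<in>minors e. linform (axis 1 1) dvd m"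
        using dvd_0_right by metis
      then show ?thesis by (intro disjI1 exI[of _ "axis 1 1"] conjI axis_neq_0)
    next
      case False
      then obtain q where q: "q \<in> minors e" "q \<noteq> 0" by blast
      have sm: "smooth_curve q"
      proof (rule ccontr)
        assume "\<not> smooth_curve q"
        then obtain c d where "q = linform c * linform d"
          using not_smooth_iff_product[OF quadratic_minor[OF q(1)]] by blast
        then show False using nl[of c d] mP[OF q(1)] q(2) by auto
      qed
      have "\<exists>t. m = cnst t * q" if m: "m \<in> minors e" for m
      proof -
        obtain t c d where t: "m - cnst t * q = linform c * linform d"
          using quadratic_pencil[OF quadratic_minor[OF m] quadratic_minor[OF q(1)] sm] by metis
        have "m - cnst t * q \<in> P0"
          using mP m q(1) idP by (intro ideal.subspace_diff ideal.subspace_scale) auto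
        then have "m - cnst t * q = 0" using t nl[of c d] by auto
        then show ?thesis by (intro exI[of _ t]) simp
      qed
      then show ?thesis using q(1) sm by blast
    qed
  qed
qed

theorem positive_dimension_type:
  assumes "plane_coords e K" "cmat.subspace K" "cmat.dim K = 3" "proj_dim (minors_ideal e) \<ge> 1"
  shows "\<exists>T. has_type K e T"
  using positive_dimension_cases[OF assms(4)] linform_divides_minors_type[OF assms(1-3)]
    proportional_minors_type by blast

section \<open>The type is unique\<close>

definition contains_plane :: "(complex^3) set \<Rightarrow> complex^3 \<Rightarrow> bool"
  where "contains_plane V c \<longleftrightarrow> c \<noteq> 0 \<and> {x. dot c x = 0} \<subseteq> V"

lemma ker_subset_ker_eq:
  assumes "c \<noteq> 0" "d \<noteq> 0" "{x. dot c x = 0} \<subseteq> {x. dot d x = 0}"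
  shows "{x. dot c x = 0} = {x. dot d x = 0}"
proof -
  obtain k where "d = k *s c" using dot_zero_on_ker_multiple[of c d] assms(3) by blast
  then show ?thesis using assms(2) by auto
qed

lemma exists_off_ker: "c \<noteq> 0 \<Longrightarrow> \<exists>x. dot c x \<noteq> 0"
  using dot_eq_0_iff by blast

lemma exists_off_two_kers:
  assumes "c \<noteq> 0" "d \<noteq> 0" shows "\<exists>x. dot c x \<noteq> 0 \<and> dot d x \<noteq> 0"
proof -
  obtain x y where x: "dot c x \<noteq> 0" and y: "dot d y \<noteq> 0" using assms exists_off_ker by metis
  consider "dot d x \<noteq> 0" | "dot c y \<noteq> 0" | "dot d x = 0" "dot c y = 0" by blast
  then show ?thesis
  proof cases
    case 3
    then have "dot c (x + y) \<noteq> 0" "dot d (x + y) \<noteq> 0" using x y by simp_all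
    then show ?thesis by blast
  qed (use x y in blast)+
qed

text \<open>If \<open>x\<close> is a zero of \<open>d\<close> but not of \<open>c\<close>, and \<open>y \<noteq> 0\<close> a common zero, then \<open>x\<close> and \<open>x + y\<close> would both lie on the line.\<close>

lemma ker_in_ker_Un_line:
  assumes c: "c \<noteq> 0" "d \<noteq> 0" and sub: "{x. dot d x = 0} \<subseteq> {x. dot c x = 0} \<union> range (\<lambda>k. k *s p)"
    and p: "dot c p \<noteq> 0"
  shows "{x. dot d x = 0} = {x. dot c x = 0}"
proof (rule ker_subset_ker_eq[OF c(2,1)], rule ccontr)
  assume "\<not> {x. dot d x = 0} \<subseteq> {x. dot c x = 0}"
  then obtain x where x: "dot d x = 0" "dot c x \<noteq> 0" by blast
  obtain y where y: "y \<noteq> 0" "dot d y = 0" "dot c y = 0" by (rule common_zero)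
  have "dot d (x + y) = 0" "dot c (x + y) \<noteq> 0" using x y by simp_all
  then have "x \<in> range (\<lambda>k. k *s p)" "x + y \<in> range (\<lambda>k. k *s p)"
    using sub x by blast+
  then obtain k l where kl: "x = k *s p" "x + y = l *s p" by blast
  then have yp: "y = (l - k) *s p" by (metis add_diff_cancel_left' vec.scale_left_diff_distrib)
  then have "l - k = 0" using y(3) p by simp
  then show False using yp y(1) by simp
qed

lemma linear_ideal_line:
  fixes e :: "3 \<Rightarrow> complex^'b^'a"
  assumes e: "plane_coords e K" and L: "L \<subseteq> K" "Segre_line L"
  obtains c where "c \<noteq> 0" "linear_ideal e L = vanishing {x. dot c x = 0}"
    "{x. pt e x \<in> L} = {x. dot c x = 0}"
proof -
  have sub: "cmat.subspace L"
  proof -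
    consider x Z where "vec.subspace Z" "L = {outer x z | z. z \<in> Z}"
      | y Y where "vec.subspace Y" "L = {outer x y | x. x \<in> Y}"
      using L(2) unfolding Segre_line_def first_ruling_def second_ruling_def by blast
    then show ?thesis
    proof cases
      case 1
      then show ?thesis
        using cmat.subspace_def[of L] vec.subspace_def[of Z] outer_0_right[of x, symmetric]
          outer_add_right[of x, symmetric] outer_smult_right[of x, symmetric]
        by (simp only: mem_Collect_eq) blast
    next
      case 2
      then show ?thesis
        using cmat.subspace_def[of L] vec.subspace_def[of Y] outer_0_left[of y, symmetric]
          outer_add_left[of _ _ y, symmetric] outer_smult_left[of _ _ y, symmetric]
        by (simp only: mem_Collect_eq) blast
    qed
  qed
  obtain c where "c \<noteq> 0" "{x. pt e x \<in> L} = {x. dot c x = 0}"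
    using plane_of_dim_2[OF e L(1) sub] L(2) by (auto simp: Segre_line_def)
  then show thesis using that linear_ideal_eq[OF sub, of e] by metis
qed

lemma ruling_plane_zeros:
  assumes e: "plane_coords e K" and K: "cmat.subspace K" and T: "has_type K e Ruling_Plane"
  shows "zeros (Z_ideal e) = UNIV"
proof -
  have "{x. pt e x \<in> K} = UNIV" using range_pt[OF e] by auto
  then show ?thesis using T linear_ideal_eq[OF K, of e] zeros_vanishing[of UNIV] by simp
qed

lemma smooth_conic_zeros:
  assumes "has_type K e Smooth_Conic"
  shows "\<not> contains_plane (zeros (Z_ideal e)) c" "zeros (Z_ideal e) \<noteq> UNIV"
proof -
  obtain q where q: "q \<noteq> 0" "homogeneous 2 q" "smooth_curve q" "Z_ideal e = ideal.span {q}"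
    using assms by auto
  have z: "zeros (Z_ideal e) = {x. eval_pol q x = 0}" by (simp add: q zeros_span)
  have nd: "\<not> linform c dvd q" for c
    using smooth_not_linform_dvd[OF quadratic_homogeneous[OF q(2)] q(3)] .
  show "\<not> contains_plane (zeros (Z_ideal e)) c"
    using nd[of c] unfolding linform_dvd_iff contains_plane_def z by blast
  show "zeros (Z_ideal e) \<noteq> UNIV"
    using q(1) eval_pol_eq_0D unfolding z by blast
qed

text \<open>The two planes differ, since a matrix space in both rulings at once has dimension at most one.\<close>

lemma two_lines_zeros:
  assumes e: "plane_coords e K" and T: "has_type K e Two_Opposite_Lines"
  obtains c d where "c \<noteq> 0" "d \<noteq> 0" "{x. dot c x = 0} \<noteq> {x. dot d x = 0}"
    "zeros (Z_ideal e) = {x. dot c x = 0} \<union> {x. dot d x = 0}"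
proof -
  obtain L L' where L: "L \<subseteq> K" "L' \<subseteq> K" "Segre_line L" "first_ruling L" "Segre_line L'" "second_ruling L'"
    and Z: "Z_ideal e = linear_ideal e L \<inter> linear_ideal e L'"
    using T by auto
  obtain c where c: "c \<noteq> 0" "linear_ideal e L = vanishing {x. dot c x = 0}"
    "{x. pt e x \<in> L} = {x. dot c x = 0}" using linear_ideal_line[OF e L(1,3)] by metis
  obtain d where d: "d \<noteq> 0" "linear_ideal e L' = vanishing {x. dot d x = 0}"
    "{x. pt e x \<in> L'} = {x. dot d x = 0}" using linear_ideal_line[OF e L(2,5)] by metis
  have ne: "{x. dot c x = 0} \<noteq> {x. dot d x = 0}"
  proof
    assume eq: "{x. dot c x = 0} = {x. dot d x = 0}"
    obtain x where x: "x \<noteq> 0" "\<And>y. dot c y = 0 \<Longrightarrow> \<exists>z. pt e y = outer x z"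
      using L(4) c(3) unfolding first_ruling_def by blast
    obtain z where z: "z \<noteq> 0" "\<And>y. dot c y = 0 \<Longrightarrow> \<exists>x. pt e y = outer x z"
      using L(6) d(3) eq unfolding second_ruling_def by blast
    obtain i where i: "x $ i \<noteq> 0" using x(1) by (auto simp: vec_eq_iff)
    obtain j where j: "z $ j \<noteq> 0" using z(1) by (auto simp: vec_eq_iff)
    \<comment> \<open>On a line in both rulings the matrices are multiples of \<open>x z\<^sup>T\<close>, so none but zero
      vanishes at a place where \<open>x z\<^sup>T\<close> does not.\<close>
    obtain p where p: "p \<noteq> 0" "dot c p = 0" "dot (coef e i j) p = 0" by (rule common_zero)
    obtain a b where ab: "pt e p = outer x a" "pt e p = outer b z" using x(2) z(2) p(2) by blast
    have "pt e p $ i $ j = 0" using p(3) by (simp add: pt_component)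
    then have "b $ i * z $ j = 0" unfolding ab(2) by simp
    then have b: "b $ i = 0" using j by simp
    have "x $ i * a $ n = b $ i * z $ n" for n
      using ab by (metis outer_component)
    then have "a = 0" using b i by (simp add: vec_eq_iff)
    then have "pt e p = 0" using ab by (simp add: outer_0_right)
    then show False using p(1) pt_eq_0_iff[OF e] by simp
  qed
  have "zeros (Z_ideal e) = {x. dot c x = 0} \<union> {x. dot d x = 0}"
    unfolding Z c d by (rule zeros_vanishing_Un[OF subspace_ker subspace_ker])
  then show thesis using that c d ne by blast
qed

lemma reduced_line_zeros:
  assumes e: "plane_coords e K" and T: "has_type K e Reduced_Line"
  obtains c where "c \<noteq> 0" "zeros (Z_ideal e) = {x. dot c x = 0}" "linform c \<in> Z_ideal e"
proof -
  obtain L where L: "L \<subseteq> K" "Segre_line L" "Z_ideal e = linear_ideal e L" using T by auto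
  obtain c where c: "c \<noteq> 0" "linear_ideal e L = vanishing {x. dot c x = 0}"
    using linear_ideal_line[OF e L(1,2)] by metis
  then show thesis
    using that[of c] L(3) zeros_vanishing[OF subspace_ker] by (simp add: vanishing_def)
qed

lemma line_and_point_zeros:
  assumes e: "plane_coords e K" and T: "has_type K e Line_And_Point"
  obtains c p where "c \<noteq> 0" "dot c p \<noteq> 0"
    "zeros (Z_ideal e) = {x. dot c x = 0} \<union> range (\<lambda>k. k *s p)"
proof -
  obtain L P where L: "L \<subseteq> K" "Segre_line L" and P: "P \<subseteq> K" "cmat.subspace P" "cmat.dim P = 1" "\<not> P \<subseteq> L"
    and Z: "Z_ideal e = linear_ideal e L \<inter> linear_ideal e P" using T by auto
  obtain c where c: "c \<noteq> 0" "linear_ideal e L = vanishing {x. dot c x = 0}"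
    "{x. pt e x \<in> L} = {x. dot c x = 0}"
    using linear_ideal_line[OF e L(1,2)] by metis
  let ?S = "{x. pt e x \<in> P}"
  have S: "vec.subspace ?S" using P(2) by (rule subspace_pt_vimage)
  have PS: "P = pt e ` ?S" using P(1) range_pt[OF e] by auto
  then have d: "vec.dim ?S = 1" using dim_pt_image[OF e, of ?S] P(3) by simp
  obtain p where p: "?S = range (\<lambda>k. k *s p)"
    using S
  proof (cases rule: subspace_of_three_space_cases)
    case zero
    then show thesis using d by simp
  next
    case (line p)
    then show thesis using that by blast
  next
    case (plane c)
    then show thesis using d dim_ker by simp
  next
    case whole
    then show thesis using d vec_dim_card[where 'a = complex and 'n = 3] by simp
  qed
  have "dot c p \<noteq> 0"
  proof
    assume cp: "dot c p = 0"
    have "P \<subseteq> L"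
    proof
      fix M assume "M \<in> P"
      then obtain x where x: "M = pt e x" "x \<in> ?S" using PS by blast
      then have "dot c x = 0" using cp unfolding p by auto
      then show "M \<in> L" using c(3) x(1) by blast
    qed
    then show False using P(4) by simp
  qed
  moreover have "zeros (Z_ideal e) = {x. dot c x = 0} \<union> range (\<lambda>k. k *s p)"
    unfolding Z c(2) linear_ideal_eq[OF P(2)] p
    by (rule zeros_vanishing_Un[OF subspace_ker subspace_line])
  ultimately show thesis using that c(1) by blast
qed

text \<open>The zero set cannot tell this type from a reduced line, but a linear form can: it would be \<open>u\<close> times a constant,
and that constant would vanish at the embedded point.\<close>

lemma embedded_point_zeros:
  assumes T: "has_type K e Line_With_Embedded_Point"
  obtains c where "c \<noteq> 0" "zeros (Z_ideal e) = {x. dot c x = 0}"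
    "\<And>d. linform d \<in> Z_ideal e \<Longrightarrow> d = 0"
proof -
  obtain C :: "complex^3^3" where C: "invertible C"
    and Z: "Z_ideal e = ideal.span {linform (C $ 1) ^ 2, linform (C $ 1) * linform (C $ 2)}"
    using T by auto
  let ?u = "C $ 1" and ?v = "C $ 2"
  have u: "?u \<noteq> 0"
  proof
    assume "?u = 0"
    then have "row 1 C = 0" by (simp add: row_def vec_eq_iff)
    then have "det C = 0" by (rule det_zero_row)
    then show False using C by (simp add: invertible_det_nz)
  qed
  have z: "zeros (Z_ideal e) = {x. dot ?u x = 0}"
    by (auto simp: Z zeros_span)
  have "d = 0" if lin: "linform d \<in> Z_ideal e" for d
  proof (rule ccontr)
    assume d: "d \<noteq> 0"
    have "Z_ideal e = ideal.span ((*) (linform ?u) ` linform ` {?u, ?v})"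
      by (simp add: Z power2_eq_square)
    then have "Z_ideal e = (*) (linform ?u) ` vanishing {x. \<forall>d\<in>{?u, ?v}. dot d x = 0}"
      by (simp only: span_times span_linforms_eq_vanishing)
    then obtain g where g: "linform d = linform ?u * g" "g \<in> vanishing {x. \<forall>d\<in>{?u, ?v}. dot d x = 0}"
      using lin by blast
    have "linform ?u dvd linform d" unfolding g(1) by simp
    then obtain k where k: "d = k *s ?u" by (rule linform_dvd_linform)
    then have "linform ?u * cnst k = linform ?u * g"
      using g(1) by (simp add: linform_smult mult.commute)
    then have "g = cnst k" using u by (metis linform_eq_0_iff mult_left_cancel)
    moreover have "0 \<in> {x. \<forall>d\<in>{?u, ?v}. dot d x = 0}" by simp
    then have "eval_pol g 0 = 0" using g(2) unfolding vanishing_def by blast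
    ultimately have "k = 0" by simp
    then show False using d k by simp
  qed
  then show thesis using that u z by blast
qed

text \<open>Five properties separate the types: whether the zero set is everything, contains a plane, is closed under
addition, contains two different planes, and whether the ideal contains a linear form.\<close>

theorem section_type_unique:
  assumes e: "plane_coords e K" and K: "cmat.subspace K"
    and T: "has_type K e T" "has_type K e T'"
  shows "T = T'"
proof -
  let ?V = "zeros (Z_ideal e)"
  have 1: "?V = UNIV" if "has_type K e Ruling_Plane"
    using ruling_plane_zeros[OF e K that] .
  have 2: "?V \<noteq> UNIV \<and> \<not> (\<exists>c. contains_plane ?V c)" if "has_type K e Smooth_Conic"
    using smooth_conic_zeros[OF that] by blast
  let ?add = "\<forall>x\<in>?V. \<forall>y\<in>?V. x + y \<in> ?V"
  let ?two = "\<exists>c d. contains_plane ?V c \<and> contains_plane ?V d \<and> {x. dot c x = 0} \<noteq> {x. dot d x = 0}"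
  let ?lin = "\<exists>d. d \<noteq> 0 \<and> linform d \<in> Z_ideal e"
  have 3: "?V \<noteq> UNIV \<and> (\<exists>c. contains_plane ?V c) \<and> \<not> ?add \<and> ?two" if T3: "has_type K e Two_Opposite_Lines"
  proof -
    obtain c d where cd: "c \<noteq> 0" "d \<noteq> 0" "{x. dot c x = 0} \<noteq> {x. dot d x = 0}"
      and V: "?V = {x. dot c x = 0} \<union> {x. dot d x = 0}"
      using two_lines_zeros[OF e T3] by metis
    have "?V \<noteq> UNIV" using exists_off_two_kers[OF cd(1,2)] V by blast
    moreover have "?two" using cd V unfolding contains_plane_def by blast
    moreover have "\<not> ?add"
    proof -
      obtain x where x: "dot c x = 0" "dot d x \<noteq> 0"
        using ker_subset_ker_eq[of c d] cd by blast
      obtain y where y: "dot d y = 0" "dot c y \<noteq> 0"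
        using ker_subset_ker_eq[of d c] cd by blast
      have "x \<in> ?V" "y \<in> ?V" "x + y \<notin> ?V" unfolding V using x y by auto
      then show ?thesis by blast
    qed
    ultimately show ?thesis by blast
  qed
  have off: "{x. dot c x = 0} \<noteq> UNIV" if "c \<noteq> 0" for c using exists_off_ker[OF that] by blast
  have ker: "?V \<noteq> UNIV \<and> (\<exists>c. contains_plane ?V c) \<and> ?add" if "c \<noteq> 0" "?V = {x. dot c x = 0}" for c
  proof -
    have ?add unfolding that(2) by simp
    then show ?thesis using that off contains_plane_def by blast
  qed
  have 4: "?V \<noteq> UNIV \<and> (\<exists>c. contains_plane ?V c) \<and> ?add \<and> ?lin" if "has_type K e Reduced_Line"
    using reduced_line_zeros[OF e that] ker by metis
  have 5: "?V \<noteq> UNIV \<and> (\<exists>c. contains_plane ?V c) \<and> \<not> ?add \<and> \<not> ?two" if T5: "has_type K e Line_And_Point"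
  proof -
    obtain c p where c: "c \<noteq> 0" "dot c p \<noteq> 0" and V: "?V = {x. dot c x = 0} \<union> range (\<lambda>k. k *s p)"
      using line_and_point_zeros[OF e T5] by metis
    obtain y where y: "y \<noteq> 0" "dot c y = 0" using common_zero by blast
    have no: "p + y \<notin> ?V"
    proof
      assume "p + y \<in> ?V"
      then obtain k where k: "p + y = k *s p" unfolding V using c y by auto
      then have "dot c (p + y) = dot c (k *s p)" by simp
      then have "k = 1" using c y by simp
      then show False using k y by simp
    qed
    have "p \<in> ?V" unfolding V using rangeI[of "\<lambda>k. k *s p" 1] by simp
    moreover have "y \<in> ?V" unfolding V using y by simp
    moreover have "{x. dot d x = 0} = {x. dot c x = 0}" if "contains_plane ?V d" for d
      by (rule ker_in_ker_Un_line[of c d p]) (use that c V contains_plane_def in blast)+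
    then have "\<not> ?two" by metis
    moreover have "contains_plane ?V c" using c V unfolding contains_plane_def by blast
    ultimately show ?thesis using no by blast
  qed
  have 6: "?V \<noteq> UNIV \<and> (\<exists>c. contains_plane ?V c) \<and> ?add \<and> \<not> ?lin" if "has_type K e Line_With_Embedded_Point"
    using embedded_point_zeros[OF that] ker by metis
  show ?thesis
    by (cases T; cases T'; use T 1 2 3 4 5 6 in blast)
qed

section \<open>The smooth conic lies in a compression\<close>

lemma quadratic_has_zero:
  assumes "quadratic f"
  obtains x where "x \<noteq> 0" "f x = 0"
proof -
  obtain g p h q where k: "\<And>y. dot (axis 1 1) y = 0 \<Longrightarrow> y = dot g y *s p + dot h y *s q"
    using kernel_parametrised[OF axis_neq_0] by metis
  obtain c d where cd: "\<And>x. f (dot g x *s p + dot h x *s q) = dot c x * dot d x"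
    using quadratic_splits_on_plane[OF assms] by metis
  obtain x where x: "x \<noteq> 0" "dot (axis 1 1) x = 0" "dot c x = 0" by (rule common_zero)
  have "f x = 0" using cd[of x] k[OF x(2)] x(3) by simp
  then show thesis using that x(1) by blast
qed

text \<open>Two points of the conic, the second on a line through the first that is not tangent, and the pole of their chord.\<close>

lemma hyperbolic_frame:
  assumes H: "transpose H = H" and ns: "\<And>x. x \<noteq> 0 \<Longrightarrow> H *v x \<noteq> 0"
  obtains p1 p2 p3 where "dot p1 (H *v p1) = 0" "dot p2 (H *v p2) = 0" "dot p1 (H *v p2) \<noteq> 0"
    "dot p1 (H *v p3) = 0" "dot p2 (H *v p3) = 0" "dot p3 (H *v p3) \<noteq> 0"
    "\<And>y. \<exists>s t r. y = s *s p1 + t *s p2 + r *s p3"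
proof -
  have "quadratic (\<lambda>x. dot x (H *v x))" using H unfolding quadratic_def by blast
  then obtain p1 where p1: "p1 \<noteq> 0" "dot p1 (H *v p1) = 0" by (rule quadratic_has_zero)
  \<comment> \<open>A line through \<open>p1\<close> that is not tangent there meets the conic in a second point \<open>p2\<close>.\<close>
  obtain y where y: "dot (H *v p1) y \<noteq> 0" using ns[OF p1(1)] dot_eq_0_iff by blast
  then have y': "dot y (H *v p1) \<noteq> 0" by (simp add: dot_commute)
  define s where "s = - dot y (H *v y) / (2 * dot y (H *v p1))"
  define p2 where "p2 = y + s *s p1"
  have "dot p2 (H *v p2) = dot y (H *v y) + 2 * s * dot y (H *v p1)"
    unfolding p2_def quadratic_form_add[OF H] by (simp add: vector_scalar_commute p1(2))
  also have "\<dots> = 0" using y' by (simp add: s_def)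
  finally have p2: "dot p2 (H *v p2) = 0" .
  have p12: "dot p2 (H *v p1) \<noteq> 0" using y' p1(2) by (simp add: p2_def)
  obtain p3 where p3: "p3 \<noteq> 0" "dot (H *v p1) p3 = 0" "dot (H *v p2) p3 = 0"
    by (rule common_zero)
  have sym: "dot p1 (H *v p2) = dot p2 (H *v p1)" "dot p1 (H *v p3) = 0" "dot p2 (H *v p3) = 0"
    using p3 dot_matrix_sym[OF H] by (simp_all add: dot_commute)
  have "\<alpha> = 0 \<and> \<beta> = 0 \<and> \<gamma> = 0" if z: "\<alpha> *s p1 + \<beta> *s p2 + \<gamma> *s p3 = 0" for \<alpha> \<beta> \<gamma>
  proof -
    have "dot (\<alpha> *s p1 + \<beta> *s p2 + \<gamma> *s p3) (H *v p1) = 0"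
      "dot (\<alpha> *s p1 + \<beta> *s p2 + \<gamma> *s p3) (H *v p2) = 0" unfolding z by simp_all
    then have "\<beta> = 0" "\<alpha> = 0" using p1 p2 p3 p12 sym by (simp_all add: dot_commute[of p3])
    then show ?thesis using z p3(1) by simp
  qed
  then have span: "\<exists>s t r. y = s *s p1 + t *s p2 + r *s p3" for y
    using three_vectors_span[of p1 p2 p3 y] by metis
  have "dot p3 (H *v p3) \<noteq> 0"
  proof
    assume p33: "dot p3 (H *v p3) = 0"
    have "dot (H *v p3) y = 0" for y
    proof -
      obtain s t r where y: "y = s *s p1 + t *s p2 + r *s p3" using span by blast
      have "dot y (H *v p3) = 0" unfolding y using sym p33 by simp
      then show ?thesis by (simp add: dot_commute)
    qed
    then have "H *v p3 = 0" using dot_eq_0_iff by blast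
    then show False using ns p3(1) by blast
  qed
  then show thesis using that[of p1 p2 p3] p1 p2 p12 sym span by simp
qed

text \<open>A degree argument: some \<open>m - t q\<close> is a product of two linear forms and divisible by \<open>q\<close>.  Were it nonzero, the
linear forms could be cancelled one after the other, making \<open>q\<close> a unit although it has a zero.\<close>

lemma smooth_dvd_quadratic:
  assumes q: "quadratic (eval_pol q)" "smooth_curve q" and m: "quadratic (eval_pol m)" "q dvd m"
  obtains t where "m = cnst t * q"
proof -
  obtain t c d where t: "m - cnst t * q = linform c * linform d"
    using quadratic_pencil[OF m(1) q] by metis
  have nd: "\<not> linform c dvd q" for c using smooth_not_linform_dvd[OF q] .
  have "c = 0 \<or> d = 0"
  proof (rule ccontr)
    assume n: "\<not> ?thesis"
    have "q dvd linform c ^ 1 * (linform d ^ 1 * 1)"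
      using m(2) t by (metis dvd_diff dvd_triv_right power_one_right mult.right_neutral)
    then have "q dvd linform d ^ 1 * 1" using dvd_cancel_linform_power nd n by blast
    then have "q dvd 1" using dvd_cancel_linform_power nd n by blast
    then obtain r where "1 = q * r" by blast
    moreover obtain x where "eval_pol q x = 0" using quadratic_has_zero[OF q(1)] by metis
    ultimately show False
      by (metis eval_pol_1 eval_pol_mult mult_zero_left zero_neq_one)
  qed
  then have "m - cnst t * q = 0" using t by auto
  then show thesis using that[of t] by simp
qed

text \<open>The polarised minors of \<open>a b\<^sup>T\<close> and \<open>D\<close> vanish when \<open>D\<close> is tangent to the Segre variety at \<open>a b\<^sup>T\<close>; conversely, solving
one of these equations at a nonzero entry of \<open>a b\<^sup>T\<close> writes \<open>D\<close> as such a tangent vector.\<close>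

lemma polar_outer:
  assumes a: "a \<noteq> 0" "b \<noteq> 0"
    and pol: "\<And>i i' j j'. a $ i * b $ j * D $ i' $ j' + D $ i $ j * (a $ i' * b $ j')
      - a $ i * b $ j' * D $ i' $ j - D $ i $ j' * (a $ i' * b $ j) = 0"
  obtains x y where "D = outer a y + outer x b"
proof -
  obtain i where i: "a $ i \<noteq> 0" using a(1) by (auto simp: vec_eq_iff)
  obtain j where j: "b $ j \<noteq> 0" using a(2) by (auto simp: vec_eq_iff)
  have "D $ m $ n = a $ m * (D $ i $ n / a $ i - D $ i $ j * b $ n / (a $ i * b $ j))
      + D $ m $ j / b $ j * b $ n" for m n
  proof -
    have "a $ i * b $ j * D $ m $ n
        = a $ i * b $ n * D $ m $ j + D $ i $ n * a $ m * b $ j - D $ i $ j * a $ m * b $ n"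
      using pol[of i j m n] by algebra
    then show ?thesis using i j by (simp add: field_simps)
  qed
  then have "D = outer a (\<chi> n. D $ i $ n / a $ i - D $ i $ j * b $ n / (a $ i * b $ j))
      + outer (\<chi> m. D $ m $ j / b $ j) b"
    unfolding vec_eq_iff outer_component vec_lambda_beta vector_add_component by blast
  then show thesis by (rule that)
qed

lemma two_equations_trivial:
  fixes s t u v u' v' :: complex
  assumes "s * u + t * v = 0" "s * u' + t * v' = 0" "u * v' \<noteq> u' * v"
  shows "s = 0 \<and> t = 0"
proof -
  have "s * (u * v' - u' * v) = 0" "t * (u * v' - u' * v) = 0" using assms(1,2) by algebra+
  then show ?thesis using assms(3) by simp
qed

text \<open>The two tangent spaces meet in the span of \<open>a\<^sub>1 b\<^sub>2\<^sup>T\<close> and \<open>a\<^sub>2 b\<^sub>1\<^sup>T\<close>.  The functionals \<open>\<psi>\<close> and \<open>\<phi>\<close> below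
are dual to the two pairs: \<open>\<psi>\<close> takes the values 1 and 0 on \<open>b\<^sub>1, b\<^sub>2\<close>, and \<open>\<phi>\<close> does so on \<open>a\<^sub>1, a\<^sub>2\<close>.\<close>

lemma antidiagonal_form:
  fixes a1 a2 :: "complex^'a" and b1 b2 :: "complex^'b"
  assumes a: "a1 $ i * a2 $ i' \<noteq> a1 $ i' * a2 $ i" and b: "b1 $ j * b2 $ j' \<noteq> b1 $ j' * b2 $ j"
    and D1: "D = outer a1 y + outer x b1" and D2: "D = outer a2 y' + outer x' b2"
  obtains \<beta> \<gamma> where "D = mscale \<beta> (outer a1 b2) + mscale \<gamma> (outer a2 b1)"
proof -
  define \<delta> where "\<delta> = b1 $ j * b2 $ j' - b1 $ j' * b2 $ j"
  define \<epsilon> where "\<epsilon> = a1 $ i * a2 $ i' - a1 $ i' * a2 $ i"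
  define \<psi> where "\<psi> z = (z $ j * b2 $ j' - z $ j' * b2 $ j) / \<delta>" for z :: "complex^'b"
  define \<phi> where "\<phi> z = (z $ i * a2 $ i' - z $ i' * a2 $ i) / \<epsilon>" for z :: "complex^'a"
  have nz: "\<delta> \<noteq> 0" "\<epsilon> \<noteq> 0" using a b by (simp_all add: \<delta>_def \<epsilon>_def)
  have eq: "a1 $ m * y $ n + x $ m * b1 $ n = a2 $ m * y' $ n + x' $ m * b2 $ n" for m n
    using arg_cong[OF trans[OF D1[symmetric] D2], of "\<lambda>M. M $ m $ n"] by simp
  have x: "x $ m = a2 $ m * \<psi> y' - a1 $ m * \<psi> y" for m
  proof -
    have "x $ m * \<delta> = a2 $ m * (y' $ j * b2 $ j' - y' $ j' * b2 $ j)
        - a1 $ m * (y $ j * b2 $ j' - y $ j' * b2 $ j)"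
      unfolding \<delta>_def using eq[of m j] eq[of m j'] by algebra
    then have "x $ m = (a2 $ m * (y' $ j * b2 $ j' - y' $ j' * b2 $ j)
        - a1 $ m * (y $ j * b2 $ j' - y $ j' * b2 $ j)) / \<delta>"
      using nz by (simp add: nonzero_eq_divide_eq)
    then show ?thesis by (simp add: \<psi>_def diff_divide_distrib right_diff_distrib)
  qed
  define y2 where "y2 = y - \<psi> y *s b1"
  have D3: "D $ m $ n = a1 $ m * y2 $ n + \<psi> y' * (a2 $ m * b1 $ n)" for m n
    by (simp add: D1 x y2_def algebra_simps)
  have y2: "y2 $ n = \<phi> x' * b2 $ n" for n
  proof -
    have "a1 $ m * y2 $ n + \<psi> y' * (a2 $ m * b1 $ n) = a2 $ m * y' $ n + x' $ m * b2 $ n" for m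
      using D3[of m n] by (simp add: D2)
    from this[of i] this[of i'] have "y2 $ n * \<epsilon> = (x' $ i * a2 $ i' - x' $ i' * a2 $ i) * b2 $ n"
      unfolding \<epsilon>_def by algebra
    then show ?thesis using nz by (simp add: \<phi>_def field_simps)
  qed
  have "D = mscale (\<phi> x') (outer a1 b2) + mscale (\<psi> y') (outer a2 b1)"
    by (simp add: vec_eq_iff D3 y2 mscale_def)
  then show thesis by (rule that)
qed

lemma dim_span_pair:
  fixes a1 a2 :: "complex^'n"
  assumes a: "a1 $ i * a2 $ i' \<noteq> a1 $ i' * a2 $ i"
  shows "vec.dim (vec.span {a1, a2}) = 2"
proof -
  have "a2 \<noteq> 0" using a by auto
  have ns: "a1 \<notin> vec.span {a2}"
  proof
    assume "a1 \<in> vec.span {a2}"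
    then obtain k where "a1 = k *s a2" by (auto simp: vec.span_singleton)
    then show False using a by simp
  qed
  then have "a1 \<noteq> a2" using vec.span_base[of a2 "{a2}"] by auto
  moreover have "vec.independent {a1, a2}"
    using ns \<open>a2 \<noteq> 0\<close> by (simp add: vec.independent_insert)
  ultimately show ?thesis by (simp add: vec.dim_eq_card_independent)
qed

lemma smooth_conic_normal_form:
  fixes e :: "3 \<Rightarrow> complex^'b^'a"
  assumes e: "plane_coords e K" and T: "has_type K e Smooth_Conic"
  obtains a1 a2 b1 b2 i i' j j' \<beta> \<gamma> where
    "a1 $ i * a2 $ i' \<noteq> a1 $ i' * a2 $ i" "b1 $ j * b2 $ j' \<noteq> b1 $ j' * b2 $ j" "\<beta> \<noteq> 0" "\<gamma> \<noteq> 0"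
    "K = {M. \<exists>s t r. M = mscale s (outer a1 b1) + mscale t (outer a2 b2)
      + mscale r (mscale \<beta> (outer a1 b2) + mscale \<gamma> (outer a2 b1))}"
proof -
  obtain q where q: "homogeneous 2 q" "smooth_curve q" "Z_ideal e = ideal.span {q}"
    using T by auto
  note quad = quadratic_homogeneous[OF q(1)]
  obtain H where H: "transpose H = H" "\<And>x. eval_pol q x = dot x (H *v x)"
    using quad unfolding quadratic_def by metis
  have "\<And>x. x \<noteq> 0 \<Longrightarrow> H *v x \<noteq> 0" using q(2) smooth_curve_iff[OF H] by simp
  then obtain p1 p2 p3 where p: "dot p1 (H *v p1) = 0" "dot p2 (H *v p2) = 0" "dot p1 (H *v p2) \<noteq> 0"
    "dot p1 (H *v p3) = 0" "dot p2 (H *v p3) = 0" "dot p3 (H *v p3) \<noteq> 0"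
    and span: "\<And>y. \<exists>s t r. y = s *s p1 + t *s p2 + r *s p3"
    using hyperbolic_frame[OF H(1)] by metis
  have "\<exists>k. \<forall>y. minor_at (pt e y) i i' j j' = k * eval_pol q y" for i i' j j'
  proof (cases rule: minors_cases[of e i i' j j'])
    case 1
    then have "minor_at (pt e y) i i' j j' = 0 * eval_pol q y" for y
      using eval_minor_pol[of e i i' j j' y] by simp
    then show ?thesis by blast
  next
    case 2
    then have "minor_pol e i i' j j' \<in> Z_ideal e"
      unfolding Z_ideal_def minors_ideal_def using subset_saturation ideal.span_base by blast
    then have "q dvd minor_pol e i i' j j'" by (simp add: q(3) in_span_single)
    then obtain t where "minor_pol e i i' j j' = cnst t * q"
      using smooth_dvd_quadratic[OF quad q(2) quadratic_minor[OF 2]] by metis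
    then have "minor_at (pt e y) i i' j j' = t * eval_pol q y" for y
      using eval_minor_pol[of e i i' j j' y] by simp
    then show ?thesis by blast
  qed
  then obtain k where k: "\<And>i i' j j' y. minor_at (pt e y) i i' j j' = k i i' j j' * dot y (H *v y)"
    unfolding H(2) by metis
  have "\<not> rank_le_1 (pt e p3)"
  proof
    assume r: "rank_le_1 (pt e p3)"
    have "p3 \<noteq> 0" using p(6) by auto
    then obtain n where n: "p3 $ n \<noteq> 0" by (auto simp: vec_eq_iff)
    have "q \<in> Z_ideal e" using q(3) ideal.span_base by blast
    then obtain l where "var n ^ l * q \<in> ideal.span (minors e)"
      unfolding Z_ideal_def minors_ideal_def saturation_def by blast
    moreover have "p3 \<in> zeros (ideal.span (minors e))"
      using r by (simp add: zeros_span rank_le_1_iff_minors)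
    ultimately have "eval_pol (var n ^ l * q) p3 = 0" unfolding zeros_def by blast
    then show False using n p(6) H(2) by simp
  qed
  then obtain i i' j j' where "minor_at (pt e p3) i i' j j' \<noteq> 0" by (auto simp: rank_le_1_def)
  then have k0: "k i i' j j' \<noteq> 0" by (auto simp: k)
  have "rank_le_1 (pt e p1)" "rank_le_1 (pt e p2)" by (simp_all add: rank_le_1_def k p)
  then obtain a1 b1 a2 b2 where M1: "pt e p1 = outer a1 b1" and M2: "pt e p2 = outer a2 b2"
    by (metis rank_le_1E)
  let ?D = "pt e p3"
  have "minor_at (pt e (p1 + p2)) i i' j j' \<noteq> 0"
    unfolding k quadratic_form_add[OF H(1)] using k0 p by simp
  moreover have "minor_at (pt e (p1 + p2)) i i' j j'
      = (a1 $ i * a2 $ i' - a1 $ i' * a2 $ i) * (b1 $ j * b2 $ j' - b1 $ j' * b2 $ j)"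
    by (simp add: minor_at_def pt_add M1 M2 algebra_simps)
  ultimately have ab: "a1 $ i * a2 $ i' \<noteq> a1 $ i' * a2 $ i" "b1 $ j * b2 $ j' \<noteq> b1 $ j' * b2 $ j"
    by auto
  have pol: "a $ i * b $ j * ?D $ i' $ j' + ?D $ i $ j * (a $ i' * b $ j')
      - a $ i * b $ j' * ?D $ i' $ j - ?D $ i $ j' * (a $ i' * b $ j) = 0"
    if "pt e p = outer a b" "dot p (H *v p) = 0" "dot p (H *v p3) = 0" for p a b i i' j j'
  proof -
    have "minor_at (pt e (p + p3)) i i' j j' = minor_at (pt e p3) i i' j j'"
      unfolding k quadratic_form_add[OF H(1)] using that by simp
    then show ?thesis by (simp add: minor_at_def pt_add that algebra_simps)
  qed
  have nz: "a1 \<noteq> 0" "a2 \<noteq> 0" "b1 \<noteq> 0" "b2 \<noteq> 0" using ab by auto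
  obtain x y where D1: "?D = outer a1 y + outer x b1"
    using polar_outer[OF nz(1,3), of ?D] pol[OF M1] p by metis
  obtain x' y' where D2: "?D = outer a2 y' + outer x' b2"
    using polar_outer[OF nz(2,4), of ?D] pol[OF M2] p by metis
  obtain \<beta> \<gamma> where D: "?D = mscale \<beta> (outer a1 b2) + mscale \<gamma> (outer a2 b1)"
    using antidiagonal_form[OF ab D1 D2] by metis
  have "minor_at ?D i i' j j' \<noteq> 0" using k k0 p by simp
  then have bg: "\<beta> \<noteq> 0" "\<gamma> \<noteq> 0" by (auto simp: D minor_at_def mscale_def)
  have "K = {M. \<exists>s t r. M = mscale s (outer a1 b1) + mscale t (outer a2 b2)
      + mscale r (mscale \<beta> (outer a1 b2) + mscale \<gamma> (outer a2 b1))}" (is "_ = ?R")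
  proof
    show "K \<subseteq> ?R"
    proof
      fix M assume "M \<in> K"
      then obtain z where z: "M = pt e z" using range_pt[OF e] by blast
      obtain s t r where "z = s *s p1 + t *s p2 + r *s p3" using span by blast
      then have "M = mscale s (outer a1 b1) + mscale t (outer a2 b2)
          + mscale r (mscale \<beta> (outer a1 b2) + mscale \<gamma> (outer a2 b1))"
        unfolding z by (simp only: pt_add pt_smult M1 M2 D)
      then show "M \<in> ?R" by blast
    qed
    show "?R \<subseteq> K"
    proof
      fix M assume "M \<in> ?R"
      then obtain s t r where "M = mscale s (outer a1 b1) + mscale t (outer a2 b2)
          + mscale r (mscale \<beta> (outer a1 b2) + mscale \<gamma> (outer a2 b1))" by blast
      then have "M = pt e (s *s p1 + t *s p2 + r *s p3)"
        by (simp only: pt_add pt_smult M1 M2 D)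
      then show "M \<in> K" using range_pt[OF e] by blast
    qed
  qed
  then show thesis using that ab bg by blast
qed

lemma matrix_component_axis: "M $ m $ k = (M *v axis k 1) $ m" for M :: "complex^'n^'m"
  by (simp add: matrix_vector_mult_def axis_def if_distrib[of "(*) _"] cong: if_cong)

text \<open>Let \<open>\<alpha>\<^sub>i\<close> and \<open>\<beta>\<^sub>j\<close> be the coordinate vectors of \<open>a\<^sub>i\<close> and \<open>b\<^sub>j\<close>.  The columns of \<open>G\<close> are \<open>\<beta> \<alpha>\<^sub>1\<close> and \<open>- \<gamma> \<alpha>\<^sub>2\<close>,
those of \<open>H\<close> are \<open>\<beta>\<^sub>2\<close> and \<open>\<beta>\<^sub>1\<close>.  Then the coefficients of \<open>a\<^sub>1 b\<^sub>2\<^sup>T\<close> and \<open>a\<^sub>2 b\<^sub>1\<^sup>T\<close> in the image of \<open>T\<close> are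
\<open>\<beta> T\<^sub>1\<^sub>1\<close> and \<open>- \<gamma> T\<^sub>2\<^sub>2\<close>, which are in the ratio \<open>\<beta> : \<gamma>\<close> of the pole exactly when \<open>T\<close> is traceless.\<close>

lemma compression_equivalent:
  fixes P :: "complex^2^'a" and Q :: "complex^2^'b"
  assumes a: "a1 $ i * a2 $ i' \<noteq> a1 $ i' * a2 $ i" and b: "b1 $ j * b2 $ j' \<noteq> b1 $ j' * b2 $ j"
    and bg: "\<beta> \<noteq> 0" "\<gamma> \<noteq> 0"
    and K: "K = {M. \<exists>s t r. M = mscale s (outer a1 b1) + mscale t (outer a2 b2)
      + mscale r (mscale \<beta> (outer a1 b2) + mscale \<gamma> (outer a2 b1))}"
    and P: "range ((*v) P) = vec.span {a1, a2}" and Q: "range ((*v) Q) = vec.span {b1, b2}"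
  shows "GL_equivalent {X. P ** X ** transpose Q \<in> K} {X. trace X = 0}"
proof -
  have "a1 \<in> range ((*v) P)" "a2 \<in> range ((*v) P)" "b1 \<in> range ((*v) Q)" "b2 \<in> range ((*v) Q)"
    unfolding P Q by (simp_all add: vec.span_base)
  then obtain \<alpha>1 \<alpha>2 \<beta>1 \<beta>2 where pre: "P *v \<alpha>1 = a1" "P *v \<alpha>2 = a2" "Q *v \<beta>1 = b1" "Q *v \<beta>2 = b2"
    by (metis imageE)
  define G :: "complex^2^2" where "G = (\<chi> m n. if n = 1 then \<beta> * \<alpha>1 $ m else - \<gamma> * \<alpha>2 $ m)"
  define H :: "complex^2^2" where "H = (\<chi> m n. if n = 1 then \<beta>2 $ m else \<beta>1 $ m)"
  have Gv: "P *v (G *v c) = (c $ 1 * \<beta>) *s a1 + (- c $ 2 * \<gamma>) *s a2" for c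
  proof -
    have "G *v c = (c $ 1 * \<beta>) *s \<alpha>1 + (- c $ 2 * \<gamma>) *s \<alpha>2"
      by (simp add: G_def matrix_vector_mult_def vec_eq_iff sum_2 algebra_simps)
    then show ?thesis by (simp only: matrix_vector_right_distrib vector_scalar_commute pre)
  qed
  have Hv: "Q *v (H *v c) = c $ 1 *s b2 + c $ 2 *s b1" for c
  proof -
    have "H *v c = c $ 1 *s \<beta>2 + c $ 2 *s \<beta>1"
      by (simp add: H_def matrix_vector_mult_def vec_eq_iff sum_2 algebra_simps)
    then show ?thesis by (simp only: matrix_vector_right_distrib vector_scalar_commute pre)
  qed
  have "c = 0" if "G *v c = 0" for c
  proof -
    have 0: "(c $ 1 * \<beta>) *s a1 + (- c $ 2 * \<gamma>) *s a2 = 0" using Gv[of c] that by simp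
    have "c $ 1 * \<beta> * a1 $ n + - c $ 2 * \<gamma> * a2 $ n = 0" for n
      using arg_cong[OF 0, of "\<lambda>v. v $ n"] by simp
    then have "c $ 1 * \<beta> = 0 \<and> - c $ 2 * \<gamma> = 0" using two_equations_trivial a by blast
    then show ?thesis using bg by (simp add: vec_eq_iff forall_2)
  qed
  then have G: "invertible G" by (simp add: invertible_det_nz trivial_kernel_iff_det [symmetric])
  have "c = 0" if "H *v c = 0" for c
  proof -
    have 0: "c $ 1 *s b2 + c $ 2 *s b1 = 0" using Hv[of c] that by simp
    have "c $ 2 * b1 $ n + c $ 1 * b2 $ n = 0" for n
      using arg_cong[OF 0, of "\<lambda>v. v $ n"] by (simp add: add.commute)
    then have "c $ 2 = 0 \<and> c $ 1 = 0" using two_equations_trivial b by blast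
    then show ?thesis by (simp add: vec_eq_iff forall_2)
  qed
  then have H: "invertible H" by (simp add: invertible_det_nz trivial_kernel_iff_det [symmetric])
  let ?F = "\<lambda>T. G ** T ** transpose H"
  have PQ: "(P ** ?F T ** transpose Q) $ m $ n
      = T $ 1 $ 1 * (\<beta> * (a1 $ m * b2 $ n)) + T $ 1 $ 2 * (\<beta> * (a1 $ m * b1 $ n))
        - T $ 2 $ 1 * (\<gamma> * (a2 $ m * b2 $ n)) - T $ 2 $ 2 * (\<gamma> * (a2 $ m * b1 $ n))" for T m n
  proof -
    have PG: "(P ** G) $ m $ 1 = \<beta> * a1 $ m" "(P ** G) $ m $ 2 = - \<gamma> * a2 $ m" for m
      unfolding matrix_component_axis[of "P ** G"] matrix_vector_mul_assoc [symmetric] Gv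
      by (simp_all add: axis_def)
    have QH: "(Q ** H) $ n $ 1 = b2 $ n" "(Q ** H) $ n $ 2 = b1 $ n" for n
      unfolding matrix_component_axis[of "Q ** H"] matrix_vector_mul_assoc [symmetric] Hv
      by (simp_all add: axis_def)
    have "P ** ?F T ** transpose Q = (P ** G) ** T ** transpose (Q ** H)"
      by (simp add: matrix_transpose_mul matrix_mul_assoc)
    also have "\<dots> $ m $ n = (\<Sum>l\<in>UNIV. (\<Sum>k\<in>UNIV. (P ** G) $ m $ k * T $ k $ l) * (Q ** H) $ n $ l)"
      by (simp add: matrix_matrix_mult_def[of _ "transpose (Q ** H)"] matrix_matrix_mult_def[of _ T])
    also have "\<dots> = T $ 1 $ 1 * (\<beta> * (a1 $ m * b2 $ n)) + T $ 1 $ 2 * (\<beta> * (a1 $ m * b1 $ n))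
        - T $ 2 $ 1 * (\<gamma> * (a2 $ m * b2 $ n)) - T $ 2 $ 2 * (\<gamma> * (a2 $ m * b1 $ n))"
      by (simp add: sum_2 PG QH algebra_simps)
    finally show ?thesis .
  qed
  have iff: "P ** ?F T ** transpose Q \<in> K \<longleftrightarrow> trace T = 0" for T
  proof
    assume "trace T = 0"
    then have T: "T $ 2 $ 2 = - T $ 1 $ 1" by (simp add: trace_def sum_2 add_eq_0_iff)
    have "P ** ?F T ** transpose Q = mscale (T $ 1 $ 2 * \<beta>) (outer a1 b1)
        + mscale (- T $ 2 $ 1 * \<gamma>) (outer a2 b2)
        + mscale (T $ 1 $ 1) (mscale \<beta> (outer a1 b2) + mscale \<gamma> (outer a2 b1))"
      unfolding vec_eq_iff PQ by (simp add: mscale_def T algebra_simps)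
    then show "P ** ?F T ** transpose Q \<in> K" unfolding K by blast
  next
    assume "P ** ?F T ** transpose Q \<in> K"
    then obtain s t r where str: "P ** ?F T ** transpose Q = mscale s (outer a1 b1) + mscale t (outer a2 b2)
      + mscale r (mscale \<beta> (outer a1 b2) + mscale \<gamma> (outer a2 b1))" unfolding K by blast
    have eq: "((T $ 1 $ 2 * \<beta> - s) * b1 $ n + (T $ 1 $ 1 - r) * \<beta> * b2 $ n) * a1 $ m
        + ((- T $ 2 $ 2 - r) * \<gamma> * b1 $ n + (- T $ 2 $ 1 * \<gamma> - t) * b2 $ n) * a2 $ m = 0" for m n
    proof -
      have "(P ** ?F T ** transpose Q) $ m $ n = s * (a1 $ m * b1 $ n) + t * (a2 $ m * b2 $ n)
          + r * (\<beta> * (a1 $ m * b2 $ n) + \<gamma> * (a2 $ m * b1 $ n))"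
        unfolding str by (simp add: mscale_def)
      then show ?thesis unfolding PQ by algebra
    qed
    have "(T $ 1 $ 2 * \<beta> - s) * b1 $ n + (T $ 1 $ 1 - r) * \<beta> * b2 $ n = 0
        \<and> (- T $ 2 $ 2 - r) * \<gamma> * b1 $ n + (- T $ 2 $ 1 * \<gamma> - t) * b2 $ n = 0" for n
      using two_equations_trivial[OF eq[of n i] eq[of n i'] a] .
    then have "(T $ 1 $ 1 - r) * \<beta> = 0 \<and> (- T $ 2 $ 2 - r) * \<gamma> = 0"
      using two_equations_trivial[of "T $ 1 $ 2 * \<beta> - s" "b1 $ j" "(T $ 1 $ 1 - r) * \<beta>" "b2 $ j" "b1 $ j'" "b2 $ j'"]
        two_equations_trivial[of "(- T $ 2 $ 2 - r) * \<gamma>" "b1 $ j" "- T $ 2 $ 1 * \<gamma> - t" "b2 $ j" "b1 $ j'" "b2 $ j'"] b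
      by blast
    then have "T $ 1 $ 1 = r" "- T $ 2 $ 2 = r" using bg by simp_all
    then have "T $ 1 $ 1 = r" "T $ 2 $ 2 = - r" by (metis minus_minus)+
    then show "trace T = 0" by (simp add: trace_def sum_2)
  qed
  have "{X. P ** X ** transpose Q \<in> K} = ?F ` {T. trace T = 0}"
  proof
    show "?F ` {T. trace T = 0} \<subseteq> {X. P ** X ** transpose Q \<in> K}" using iff by blast
    show "{X. P ** X ** transpose Q \<in> K} \<subseteq> ?F ` {T. trace T = 0}"
    proof
      fix X assume X: "X \<in> {X. P ** X ** transpose Q \<in> K}"
      obtain G' where G': "G ** G' = mat 1" using G by (auto simp: invertible_def)
      obtain B where "H ** B = mat 1" using H by (auto simp: invertible_def)
      then have "transpose B ** transpose H = mat 1"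
        by (metis matrix_transpose_mul transpose_mat)
      then obtain H' where H': "H' ** transpose H = mat 1" by blast
      have "?F (G' ** X ** H') = (G ** G') ** X ** (H' ** transpose H)"
        by (simp only: matrix_mul_assoc)
      then have "X = ?F (G' ** X ** H')" by (simp add: G' H')
      moreover from this have "trace (G' ** X ** H') = 0" using X iff by (metis mem_Collect_eq)
      ultimately show "X \<in> ?F ` {T. trace T = 0}" by blast
    qed
  qed
  then show ?thesis unfolding GL_equivalent_def using G H by blast
qed

theorem smooth_conic_compression:
  fixes e :: "3 \<Rightarrow> complex^'b^'a"
  assumes e: "plane_coords e K" and T: "has_type K e Smooth_Conic"
  shows "\<exists>U V. vec.subspace U \<and> vec.dim U = 2 \<and> vec.subspace V \<and> vec.dim V = 2 \<and>
        K \<subseteq> tensor U V \<and>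
        (\<forall>(P :: complex^2^'a) (Q :: complex^2^'b).
          range ((*v) P) = U \<and> range ((*v) Q) = V \<longrightarrow>
          GL_equivalent {X. P ** X ** transpose Q \<in> K} {X. trace X = 0})"
proof -
  obtain a1 a2 b1 b2 i i' j j' \<beta> \<gamma> where
    a: "a1 $ i * a2 $ i' \<noteq> a1 $ i' * a2 $ i" and b: "b1 $ j * b2 $ j' \<noteq> b1 $ j' * b2 $ j"
    and bg: "\<beta> \<noteq> 0" "\<gamma> \<noteq> 0"
    and K: "K = {M. \<exists>s t r. M = mscale s (outer a1 b1) + mscale t (outer a2 b2)
      + mscale r (mscale \<beta> (outer a1 b2) + mscale \<gamma> (outer a2 b1))}"
    by (rule smooth_conic_normal_form[OF e T])
  let ?U = "vec.span {a1, a2}" and ?V = "vec.span {b1, b2}"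
  have ab: "outer x y \<in> tensor ?U ?V" if "x \<in> {a1, a2}" "y \<in> {b1, b2}" for x y
    unfolding tensor_def using that by (intro cmat.span_base) (blast intro: vec.span_base)
  have "K \<subseteq> tensor ?U ?V"
  proof
    fix M assume "M \<in> K"
    then obtain s t r where M: "M = mscale s (outer a1 b1) + mscale t (outer a2 b2)
      + mscale r (mscale \<beta> (outer a1 b2) + mscale \<gamma> (outer a2 b1))" unfolding K by blast
    have "cmat.subspace (tensor ?U ?V)" by (simp add: tensor_def)
    then show "M \<in> tensor ?U ?V"
      unfolding M using ab by (intro cmat.subspace_add cmat.subspace_scale) simp_all
  qed
  then show ?thesis
    using dim_span_pair[OF a] dim_span_pair[OF b] compression_equivalent[OF a b bg K]
    by (intro exI[of _ ?U] exI[of _ ?V]) simp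
qed

section \<open>Classification of the plane sections\<close>

text \<open>The cofactor of \<open>c\<close> in a minor is a linear form that is again divisible by \<open>c\<close>, hence a multiple of it.\<close>

lemma no_doubled_Segre_line:
  assumes e: "plane_coords e K" and dbl: "doubled_Segre_line e c"
  shows "in_Segre K"
proof -
  have L: "Segre_line (zero_locus e c)" and dvd: "\<And>m. m \<in> minors e \<Longrightarrow> linform c ^ 2 dvd m"
    using dbl by (auto simp: doubled_Segre_line_def)
  have multiple: "\<exists>k. m = cnst k * linform c ^ 2" if m: "m \<in> minors e" for m
  proof (cases "c = 0")
    case True
    then have "m = 0" using dvd[OF m] by (simp add: power2_eq_square)
    then show ?thesis by (intro exI[of _ 0]) (simp add: cnst_def)
  next
    case False
    have cc: "linform c * linform c dvd m" using dvd[OF m] by (simp add: power2_eq_square)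
    then have "linform c dvd m" by (rule dvd_mult_left)
    then obtain d where d: "m = linform c * linform d"
      using linform_dvd_quadratic[OF quadratic_minor[OF m]] by metis
    then have "linform c dvd linform d" using cc False by simp
    then obtain k where "d = k *s c" by (rule linform_dvd_linform)
    then have "m = cnst k * linform c ^ 2" by (intro pol_eqI) (simp add: d power2_eq_square)
    then show ?thesis ..
  qed
  have "rank_le_1 (pt e y)" for y by (rule no_doubled_line[OF e L multiple])
  then show ?thesis using range_pt[OF e] by (intro in_SegreI) blast
qed

theorem theorem1p1:
  fixes K :: "(complex^'b^'a) set" and e :: "3 \<Rightarrow> complex^'b^'a"
  assumes "CARD('a) \<ge> 2" and "CARD('b) \<ge> 2"
    and "cmat.subspace K" and "cmat.dim K = 3"
    and "plane_coords e K"
  shows "(proj_dim (minors_ideal e) \<ge> 1 \<longrightarrow> (\<exists>!T. has_type K e T)) \<and>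
    (\<not> in_Segre K \<longrightarrow> \<not> (\<exists>c. doubled_Segre_line e c)) \<and>
    (has_type K e Smooth_Conic \<longrightarrow>
      (\<exists>U V. vec.subspace U \<and> vec.dim U = 2 \<and> vec.subspace V \<and> vec.dim V = 2 \<and>
        K \<subseteq> tensor U V \<and>
        (\<forall>(P :: complex^2^'a) (Q :: complex^2^'b).
          range ((*v) P) = U \<and> range ((*v) Q) = V \<longrightarrow>
          GL_equivalent {X. P ** X ** transpose Q \<in> K} {X. trace X = 0})))"
proof (intro conjI impI)
  assume "proj_dim (minors_ideal e) \<ge> 1"
  then obtain T where "has_type K e T" using positive_dimension_type[OF assms(5,3,4)] by blast
  then show "\<exists>!T. has_type K e T" using section_type_unique[OF assms(5,3)] by blast
next
  assume "\<not> in_Segre K"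
  then show "\<not> (\<exists>c. doubled_Segre_line e c)" using no_doubled_Segre_line[OF assms(5)] by blast
qed (rule smooth_conic_compression[OF assms(5)])

end
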